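(* Let $n$ be a positive integer and let $b=b(n)$ be a function of $n$. Let $\mathcal{B}=\{a_1,\ldots,a_b\}$ be a factor base of $b$ residues modulo $n$. Suppose an oracle provides random multiplicative relations of size $\le O(\log n)$ amongst the residues in $\mathcal{B}$. Then there is a Monte Carlo algorithm to solve the period problem for modulus $n$, whose runtime is $O(b^4\log b)\,\mathrm{poly}(\log n)$ and which requires at most $O(b)$ calls to the oracle. Furthermore, under the Hypothesis on sublattice generation (stated in the context), the probability of success approaches $1/\zeta(c+1)$ (as $n\to\infty$), where a total of $b+c$ calls are made to the oracle and $\zeta$ denotes the Riemann zeta function.
   Context: Period problem for an integer $n$: compute the multiplicative order of a given residue modulo $n$. The multiplicative order of $a$ modulo $n$ is denoted $\mathrm{ord}(a)$. A Monte Carlo algorithm is one whose output may be incorrect with a finite probability. The algorithm succeeds if its output is the correct multiplicative order. Multiplicative relations. The residues $a_1,\ldots,a_b$ of the factor base are units modulo $n$. A multiplicative relation amongst them is a relationship $\prod_{i=1}^b a_i^{e_i}=1$ modulo $n$ with $e_i\in\mathbb{Z}$; its exponent vector is $\mathbf{e}=(e_i)_{i=1}^b\in\mathbb{Z}^b$. The size of a relation is the logarithm of the $1$-norm $|\mathbf{e}|_1$ of its exponent vector. The lattice of exponent vectors of all valid relations is $$\Lambda_{\mathcal{B}}=\Big\{\mathbf{e}=(e_i)_{i=1}^b\in\mathbb{Z}^b : \prod_{i=1}^b a_i^{e_i}=1 \text{ modulo } n\Big\}.$$ Let $S_i$ be the $i$-th coordinate subspace, i.e. the vectors whose entries are nonzero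 only in the $i$-th position. For a lattice $\Lambda\subseteq\mathbb{Z}^b$, the restriction $\Lambda|_{S_i}$ is the sublattice $\Lambda\cap S_i$ of vectors of $\Lambda$ lying in $S_i$. (Thus $\Lambda_{\mathcal{B}}|_{S_i}$ is generated by the vector whose $i$-th entry is $\mathrm{ord}(a_i)$ and whose other entries are $0$.) Hypothesis on sublattice generation. Let $n>0$ tend to $\infty$, and let $b=f(n)$ be a given function of $n$. Let $\Lambda_{\mathcal{B}}'\subseteq\Lambda_{\mathcal{B}}$ be a lattice generated by $b+c$ relations randomly chosen from amongst those in $\Lambda_{\mathcal{B}}$ of size $O(\log n)$. Then, asymptotically, the probability that $\Lambda_{\mathcal{B}}'|_{S_i}=\Lambda_{\mathcal{B}}|_{S_i}$ is equal to the probability that $c+1$ random integers (in the sense of natural density) share no common factor, i.e. $1/\zeta(c+1)$. Here $\mathrm{poly}(\log n)$ denotes a quantity bounded by a polynomial in $\log n$. *)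

theory Defs
  imports
    "HOL-Probability.Probability"
    "HOL-Number_Theory.Number_Theory"
    "HOL-Computational_Algebra.Polynomial"
    "HOL-Library.Landau_Symbols"
    "HOL-Library.Log_Nat"
begin

section \<open>Multiplicative relations\<close>

text \<open>
  A factor base is \<open>a 0, \<dots>, a (b - 1)\<close> and an exponent vector is an \<open>int list\<close> of length \<open>b\<close>;
  coordinates are numbered from \<open>0\<close>.
\<close>

definition factor_base :: "nat \<Rightarrow> nat \<Rightarrow> (nat \<Rightarrow> nat) \<Rightarrow> bool" where
  "factor_base n b a \<longleftrightarrow>
     0 < b \<and> inj_on a {..<b} \<and> (\<forall>j<b. a j < n \<and> coprime (a j) n)"

definition unit_power :: "nat \<Rightarrow> nat \<Rightarrow> int \<Rightarrow> int" where
  "unit_power n x e =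
     (if 0 \<le> e then int x ^ nat e else modular_inverse (int n) (int x) ^ nat (- e))"

definition relation_lattice :: "nat \<Rightarrow> nat \<Rightarrow> (nat \<Rightarrow> nat) \<Rightarrow> int list set" where
  "relation_lattice n b a =
     {e. length e = b \<and> [(\<Prod>j<b. unit_power n (a j) (e ! j)) = 1] (mod int n)}"

text \<open>
  Since \<open>ln 0 = 0\<close>, the zero vector has size \<open>0\<close>, so it is a relation of admissible size.
\<close>

definition relation_size :: "int list \<Rightarrow> real" where
  "relation_size e = ln (real_of_int (\<Sum>x\<leftarrow>e. \<bar>x\<bar>))"

definition short_relations :: "real \<Rightarrow> nat \<Rightarrow> nat \<Rightarrow> (nat \<Rightarrow> nat) \<Rightarrow> int list set" where
  "short_relations K n b a = {e \<in> relation_lattice n b a. relation_size e \<le> K * ln (real n)}"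

definition generated_lattice :: "nat \<Rightarrow> int list list \<Rightarrow> int list set" where
  "generated_lattice b rs =
     {e. length e = b \<and> (\<exists>z :: nat \<Rightarrow> int. \<forall>j<b. e ! j = (\<Sum>k<length rs. z k * rs ! k ! j))}"

definition coordinate_subspace :: "nat \<Rightarrow> nat \<Rightarrow> int list set" where
  "coordinate_subspace b i = {e. length e = b \<and> (\<forall>j<b. j \<noteq> i \<longrightarrow> e ! j = 0)}"


section \<open>The hypothesis on sublattice generation\<close>

text \<open>
  The series is taken in \<^typ>\<open>ennreal\<close>, so that \<open>\<zeta>(1) = \<infinity>\<close> and \<open>1 / \<zeta>(1) = 0\<close>.
\<close>

definition zeta :: "nat \<Rightarrow> ennreal" where
  "zeta s = (\<Sum>k. ennreal (1 / real (Suc k) ^ s))"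

text \<open>
  \<open>D n\<close> is the distribution of one random relation modulo \<open>n\<close>; the \<open>b n + c\<close> relations are
  drawn independently from it. If \<open>D n\<close> is \<^const>\<open>pmf_of_set\<close> of \<^const>\<open>short_relations\<close>, the
  relations are uniform among those of admissible size.
\<close>

definition sublattice_generation_hypothesis ::
  "(nat \<Rightarrow> nat) \<Rightarrow> (nat \<Rightarrow> nat \<Rightarrow> nat) \<Rightarrow> nat \<Rightarrow> (nat \<Rightarrow> int list pmf) \<Rightarrow> (nat \<Rightarrow> nat) \<Rightarrow> bool" where
  "sublattice_generation_hypothesis b a c D i \<longleftrightarrow>
     (\<lambda>n. measure_pmf.prob (replicate_pmf (b n + c) (D n))
            {rs. generated_lattice (b n) rs \<inter> coordinate_subspace (b n) (i n) =
                 relation_lattice n (b n) (a n) \<inter> coordinate_subspace (b n) (i n)})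
       \<longlonglongrightarrow> enn2real (1 / zeta (c + 1))"


section \<open>Random access programs with an oracle\<close>

text \<open>
  The memory consists of arrays of integers, numbered by \<open>nat\<close> and indexed by \<open>int\<close>; a scalar
  variable is the entry \<open>0\<close> of an array. A fixed program mentions finitely many arrays. Time is
  bit cost (the logarithmic cost criterion for random access machines): every access is charged
  for the bits of the index and of the value. Multiplication and division of \<open>k\<close> bits of operands
  are charged \<open>k\<close> times the bit length of \<open>k\<close>, the bit complexity \<open>O(k log k)\<close> of these
  operations.
\<close>

type_synonym memory = "nat \<Rightarrow> int \<Rightarrow> int"

datatype binop = Add | Sub | Mul | Quo | Rem

datatype expr = Num int | Entry nat expr | Op binop expr expr

datatype program =
    Skip
  | Assign nat expr expr
  | Seq program program
  | Cond expr program program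
  | While expr program
  | Query nat

definition bits :: "int \<Rightarrow> nat" where
  "bits x = 1 + nat (bitlen \<bar>x\<bar>)"

fun binop_value :: "binop \<Rightarrow> int \<Rightarrow> int \<Rightarrow> int" where
  "binop_value Add x y = x + y"
| "binop_value Sub x y = x - y"
| "binop_value Mul x y = x * y"
| "binop_value Quo x y = x div y"
| "binop_value Rem x y = x mod y"

fun binop_cost :: "binop \<Rightarrow> nat \<Rightarrow> nat" where
  "binop_cost Add k = k"
| "binop_cost Sub k = k"
| "binop_cost Mul k = k * bits (int k)"
| "binop_cost Quo k = k * bits (int k)"
| "binop_cost Rem k = k * bits (int k)"

fun expr_value :: "expr \<Rightarrow> memory \<Rightarrow> int" where
  "expr_value (Num k) s = k"
| "expr_value (Entry x e) s = s x (expr_value e s)"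
| "expr_value (Op f e1 e2) s = binop_value f (expr_value e1 s) (expr_value e2 s)"

fun expr_cost :: "expr \<Rightarrow> memory \<Rightarrow> nat" where
  "expr_cost (Num k) s = bits k"
| "expr_cost (Entry x e) s =
     expr_cost e s + bits (expr_value e s) + bits (s x (expr_value e s))"
| "expr_cost (Op f e1 e2) s =
     expr_cost e1 s + expr_cost e2 s +
     binop_cost f (bits (expr_value e1 s) + bits (expr_value e2 s))"

definition store :: "memory \<Rightarrow> nat \<Rightarrow> int \<Rightarrow> int \<Rightarrow> memory" where
  "store s x k v = s(x := (s x)(k := v))"

text \<open>
  \<open>exec p (s, rs) t (s', rs')\<close>: started in memory \<open>s\<close>, program \<open>p\<close> halts after time \<open>t\<close> in
  memory \<open>s'\<close>, where \<open>rs\<close> are the answers that the oracle is going to give and \<open>rs'\<close> those that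
  have not been asked for. Hence \<open>length rs - length rs'\<close> oracle calls are made. Tests are
  \<open>0 < e\<close>. \<open>Query x\<close> writes the next answer to the entries \<open>0, 1, \<dots>\<close> of array \<open>x\<close>; it has no
  transition when \<open>rs\<close> is empty.
\<close>

inductive exec ::
  "program \<Rightarrow> memory \<times> int list list \<Rightarrow> nat \<Rightarrow> memory \<times> int list list \<Rightarrow> bool" where
  Skip: "exec Skip (s, rs) 1 (s, rs)"
| Assign:
    "exec (Assign x d e) (s, rs)
       (1 + expr_cost d s + expr_cost e s + bits (expr_value d s) + bits (expr_value e s))
       (store s x (expr_value d s) (expr_value e s), rs)"
| Seq: "exec p (s, rs) t (s1, rs1) \<Longrightarrow> exec q (s1, rs1) u (s2, rs2) \<Longrightarrow>
    exec (Seq p q) (s, rs) (1 + t + u) (s2, rs2)"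
| CondTrue: "0 < expr_value e s \<Longrightarrow> exec p (s, rs) t (s1, rs1) \<Longrightarrow>
    exec (Cond e p q) (s, rs) (1 + expr_cost e s + t) (s1, rs1)"
| CondFalse: "\<not> 0 < expr_value e s \<Longrightarrow> exec q (s, rs) t (s1, rs1) \<Longrightarrow>
    exec (Cond e p q) (s, rs) (1 + expr_cost e s + t) (s1, rs1)"
| WhileFalse: "\<not> 0 < expr_value e s \<Longrightarrow>
    exec (While e p) (s, rs) (1 + expr_cost e s) (s, rs)"
| WhileTrue: "0 < expr_value e s \<Longrightarrow> exec p (s, rs) t (s1, rs1) \<Longrightarrow>
    exec (While e p) (s1, rs1) u (s2, rs2) \<Longrightarrow>
    exec (While e p) (s, rs) (1 + expr_cost e s + t + u) (s2, rs2)"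
| Query:
    "exec (Query x) (s, r # rs)
       (1 + (\<Sum>j<length r. bits (int j) + bits (r ! j)))
       (s(x := (\<lambda>k. if 0 \<le> k \<and> k < int (length r) then r ! nat k else s x k)), rs)"

inductive_cases exec_SkipE: "exec Skip (s, rs) t r"
inductive_cases exec_AssignE: "exec (Assign x d e) (s, rs) t r"
inductive_cases exec_SeqE: "exec (Seq p q) (s, rs) t r"
inductive_cases exec_CondE: "exec (Cond e p q) (s, rs) t r"
inductive_cases exec_WhileE: "exec (While e p) (s, rs) t r"
inductive_cases exec_QueryE: "exec (Query x) (s, rs) t r"

lemma exec_deterministic:
  assumes "exec p c t d" and "exec p c t' d'"
  shows "t = t' \<and> d = d'"
  using assms
proof (induction arbitrary: t' d' rule: exec.induct)
  case (Skip s rs)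
  then show ?case by (auto elim: exec_SkipE)
next
  case (Assign x d e s rs)
  then show ?case by (auto elim: exec_AssignE)
next
  case (Seq p s rs t s1 rs1 q u s2 rs2)
  from Seq.prems show ?case
    by (rule exec_SeqE) (auto dest: Seq.IH)
next
  case (CondTrue e s p rs t s1 rs1 q)
  from CondTrue.prems show ?case
    by (rule exec_CondE) (use CondTrue.hyps in \<open>auto dest: CondTrue.IH\<close>)
next
  case (CondFalse e s q rs t s1 rs1 p)
  from CondFalse.prems show ?case
    by (rule exec_CondE) (use CondFalse.hyps in \<open>auto dest: CondFalse.IH\<close>)
next
  case (WhileFalse e s p rs)
  from WhileFalse.prems show ?case
    by (rule exec_WhileE) (use WhileFalse.hyps in auto)
next
  case (WhileTrue e s p rs t s1 rs1 u s2 rs2)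
  from WhileTrue.prems show ?case
    by (rule exec_WhileE) (use WhileTrue.hyps in \<open>auto dest: WhileTrue.IH\<close>)
next
  case (Query x s r rs)
  then show ?case by (auto elim: exec_QueryE)
qed


section \<open>The period problem\<close>

text \<open>
  The input consists of the modulus, the number of residues, the number of surplus oracle calls,
  the factor base, and the position \<open>i\<close> in the factor base of the residue whose order is wanted.
  The output is entry \<open>0\<close> of array \<open>0\<close>.
\<close>

definition program_input :: "nat \<Rightarrow> nat \<Rightarrow> nat \<Rightarrow> (nat \<Rightarrow> nat) \<Rightarrow> nat \<Rightarrow> memory" where
  "program_input n b c a i = (\<lambda>x k.
     if x = 0 \<and> k = 0 then int n
     else if x = 1 \<and> k = 0 then int b
     else if x = 2 \<and> k = 0 then int c
     else if x = 3 \<and> k = 0 then int i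
     else if x = 4 \<and> 0 \<le> k \<and> k < int b then int (a (nat k))
     else 0)"

definition program_output :: "memory \<Rightarrow> int" where
  "program_output s = s 0 0"

definition success_probability ::
  "program \<Rightarrow> nat \<Rightarrow> nat \<Rightarrow> nat \<Rightarrow> (nat \<Rightarrow> nat) \<Rightarrow> nat \<Rightarrow> int list pmf \<Rightarrow> real" where
  "success_probability p n b c a i D =
     measure_pmf.prob (replicate_pmf (b + c) D)
       {rs. \<exists>t s. exec p (program_input n b c a i, rs) t (s, []) \<and> program_output s = int (ord n (a i))}"

end

theory Submission
  imports Defs "Jordan_Normal_Form.Determinant" "HOL-Library.Function_Algebras"
begin

text \<open>
  Let \<open>L\<close> be the lattice generated by the \<open>b + c\<close> relations. The program computes the generator
  \<open>g \<ge> 0\<close> of the group of all \<open>m\<close> with \<open>m e\<^sub>i \<in> L\<close>. As \<open>m e\<^sub>i\<close> is a relation iff \<open>ord (a\<^sub>i)\<close>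
  divides \<open>m\<close>, the output is \<open>ord (a\<^sub>i)\<close> iff \<open>L\<close> and the lattice of all relations agree on \<open>S\<^sub>i\<close>.
  So for every \<open>n \<ge> 1\<close> the success probability is exactly the probability in the hypothesis.

  The rank of \<open>L\<close> is arbitrary. Fraction-free elimination finds a nonzero minor \<open>d\<close> of maximal
  size of the matrix of relations, together with an integer matrix \<open>T\<close> whose rows lie in \<open>L\<close> and
  for which \<open>T / d\<close> is a projection onto the rational span of \<open>L\<close>. If \<open>e\<^sub>i\<close> is not in this span,
  then \<open>g = 0\<close>. Otherwise \<open>m e\<^sub>i \<in> L + d \<int>\<^sup>b\<close> implies \<open>m e\<^sub>i \<in> L\<close> (apply \<open>T / d\<close>), and a
  triangular basis of \<open>L + d \<int>\<^sup>b\<close> can be computed modulo \<open>d\<close>. If the coordinate \<open>i\<close> comes first,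
  then \<open>g\<close> is the first diagonal entry of this basis.

  Each relation is inserted into the triangular basis by the Euclidean algorithm with least
  absolute remainders, applied to whole rows. Every swap of rows halves a diagonal entry, hence
  there are at most \<open>b log \<bar>d\<bar>\<close> swaps for all relations together. This amounts to
  \<open>b\<^sup>3 poly (log n)\<close> operations on numbers of \<open>b poly (log n)\<close> bits; as \<open>b \<le> n\<close>, factors
  \<open>log b\<close> are absorbed by \<open>poly (log n)\<close>.
\<close>


section \<open>Bounding the running time of programs\<close>

text \<open>Growth of numbers is the obstacle. Plain integer elimination may double the bit length
  with each pivot. Here table entries are, up to sign and a diagonal term, minors of a matrix with
  entries from the relations, 0 and 1; with relation entries at most \<open>n ^ k\<close>,
  \<open>k >= K\<close>, the Leibniz formula leaves \<open>b poly(log n)\<close> bits. The Euclidean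
  phase is kept small by working modulo \<open>d\<close>, at the price of enlarging \<open>L\<close>
  by \<open>d \<int>\<^sup>b\<close>. The projection undoes this, but only if the image of the
  target unit vector is under control: pivoting on its column only as a last resort forces this
  image to be \<open>d\<close> times the vector, or 0.

  The exponent 4 arises as follows. The column steps number about \<open>(b + c) b\<close>, the
  swaps \<open>b\<close> times the bit length, so there are \<open>b^2 poly(log n)\<close> row
  operations. Each touches \<open>b\<close> entries of \<open>b poly(log n)\<close> bits. In the
  elimination every relation costs \<open>b^2\<close> entry operations, which is again cubic in
  total.

  Randomness enters through the oracle answers alone: the program is deterministic, so its success
  is an event on lists of relations.\<close>

fun esize :: "expr \<Rightarrow> nat" where
  "esize (Num k) = 1"
| "esize (Entry x e) = esize e + 1"
| "esize (Op f e1 e2) = esize e1 + esize e2"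

fun small_constants :: "expr \<Rightarrow> bool" where
  "small_constants (Num k) \<longleftrightarrow> \<bar>k\<bar> \<le> 2"
| "small_constants (Entry x e) \<longleftrightarrow> small_constants e"
| "small_constants (Op f e1 e2) \<longleftrightarrow> small_constants e1 \<and> small_constants e2"

text \<open>The limits fit the program below: its largest expression, the rounded quotient in
  \<open>subtract_program\<close>, has size 23, and its largest literal is 2.\<close>

definition simple_expr :: "expr \<Rightarrow> bool" where
  "simple_expr e \<longleftrightarrow> small_constants e \<and> esize e \<le> 24"

fun arrays_written :: "program \<Rightarrow> nat set" where
  "arrays_written Skip = {}"
| "arrays_written (Assign x d e) = {x}"
| "arrays_written (Seq p q) = arrays_written p \<union> arrays_written q"
| "arrays_written (Cond e p q) = arrays_written p \<union> arrays_written q"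
| "arrays_written (While e p) = arrays_written p"
| "arrays_written (Query x) = {x}"

lemma exec_frame:
  assumes "exec p c t d" "y \<notin> arrays_written p"
  shows "fst d y = fst c y"
  using assms by (induction rule: exec.induct) (auto simp: store_def)

text \<open>\<open>0 < l\<close> makes \<open>2 ^ l\<close> at least 2, so that the literals 0, 1, 2
  obey the same bound as memory entries.\<close>

definition memory_bounded :: "nat \<Rightarrow> memory \<Rightarrow> bool" where
  "memory_bounded l s \<longleftrightarrow> 0 < l \<and> (\<forall>x k. \<bar>s x k\<bar> \<le> 2 ^ l)"

lemma bitlen_mono: "0 \<le> x \<Longrightarrow> x \<le> y \<Longrightarrow> bitlen x \<le> bitlen y"
  by (simp add: bitlen_def floorlog_mono nat_mono)

lemma bits_le:
  assumes "\<bar>x\<bar> \<le> 2 ^ k"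
  shows "bits x \<le> k + 2"
proof -
  have "bitlen \<bar>x\<bar> \<le> bitlen (2 ^ k)"
    using assms by (intro bitlen_mono) auto
  also have "bitlen (2 ^ k) = int k + 1"
    using bitlen_pow2[of 1 k] by (simp add: bitlen_alt_def)
  finally show ?thesis by (simp add: bits_def)
qed

lemma bits_nat_mono: "m \<le> n \<Longrightarrow> bits (int m) \<le> bits (int n)"
  unfolding bits_def by (intro add_left_mono nat_mono bitlen_mono) auto

lemma abs_div_le: "\<bar>x div y\<bar> \<le> \<bar>x\<bar>" for x y :: int
proof -
  have pos: "\<bar>x div y\<bar> \<le> \<bar>x\<bar>" if "y > 0" for x y :: int
  proof (rule ccontr)
    define q where "q = x div y"
    have 1: "y * q \<le> x" "x < y * (q + 1)"
      using that mult_div_mod_eq[of y x] pos_mod_bound[OF that, of x] pos_mod_sign[OF that, of x]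
      unfolding q_def distrib_left by linarith+
    assume "\<not> \<bar>x div y\<bar> \<le> \<bar>x\<bar>"
    then consider "q \<ge> \<bar>x\<bar> + 1" | "q + 1 \<le> - \<bar>x\<bar>" by (auto simp: q_def abs_if split: if_splits)
    then show False
    proof cases
      case 1
      then have "q * 1 \<le> q * y" using that by (intro mult_left_mono) auto
      then show False using 1 \<open>y * q \<le> x\<close> by (simp add: mult.commute)
    next
      case 2
      then have "(q + 1) * y \<le> (q + 1) * 1" using that by (intro mult_left_mono_neg) auto
      then show False using 2 \<open>x < y * (q + 1)\<close> by (simp add: mult.commute)
    qed
  qed
  consider "y > 0" | "y = 0" | "y < 0" by linarith
  then show ?thesis
    by cases (use pos[of y x] pos[of "-y" "-x"] in auto)
qed

lemma abs_mod_le: "\<bar>x mod y\<bar> \<le> \<bar>y\<bar>" if "y \<noteq> 0" for x y :: int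
  using that abs_mod_less[of y x] by simp

lemma add_le_mult_two: "x + y \<le> x * y" if "2 \<le> x" "2 \<le> y" for x y :: int
proof -
  have "0 \<le> (x - 2) * (y - 1) + (y - 2)" using that by (intro add_nonneg_nonneg mult_nonneg_nonneg) auto
  then show ?thesis by (simp add: algebra_simps)
qed

lemma esize_pos: "0 < esize e" by (induction e) auto

text \<open>The product of the operand bounds serves all five operators: sums are below products
  once both factors are at least 2, and division by zero is harmless since
  \<open>x div 0 = 0\<close> and \<open>x mod 0 = x\<close>.\<close>

lemma expr_value_bound:
  assumes "memory_bounded l s" "small_constants e"
  shows "\<bar>expr_value e s\<bar> \<le> 2 ^ (l * esize e)"
  using assms(2)
proof (induction e)
  case (Num k)
  then have "\<bar>k\<bar> \<le> 2 ^ 1" by simp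
  also have "\<dots> \<le> 2 ^ l" using assms(1) by (intro power_increasing) (auto simp: memory_bounded_def)
  finally show ?case by simp
next
  case (Entry x e)
  have "\<bar>s x (expr_value e s)\<bar> \<le> 2 ^ l" using assms(1) by (auto simp: memory_bounded_def)
  also have "\<dots> \<le> 2 ^ (l * esize (Entry x e))" by (intro power_increasing) auto
  finally show ?case by simp
next
  case (Op f e1 e2)
  let ?x = "expr_value e1 s" and ?y = "expr_value e2 s"
  let ?X = "2 ^ (l * esize e1) :: int" and ?Y = "2 ^ (l * esize e2) :: int"
  have xy: "\<bar>?x\<bar> \<le> ?X" "\<bar>?y\<bar> \<le> ?Y" using Op by auto
  have "0 < l * esize e1" "0 < l * esize e2" using assms(1) esize_pos by (auto simp: memory_bounded_def)
  then have "(2::int) ^ 1 \<le> ?X" "(2::int) ^ 1 \<le> ?Y" by (intro power_increasing; simp)+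
  then have 2: "2 \<le> ?X" "2 \<le> ?Y" by auto
  have add: "?X + ?Y \<le> ?X * ?Y" by (rule add_le_mult_two[OF 2])
  have "\<bar>binop_value f ?x ?y\<bar> \<le> ?X * ?Y"
  proof (cases f)
    case Mul
    then show ?thesis using xy by (auto simp: abs_mult intro: mult_mono)
  next
    case Quo
    then show ?thesis using xy add 2 abs_div_le[of ?x ?y] by simp
  next
    case Rem
    then show ?thesis using xy add 2 abs_mod_le[of ?y ?x] by (cases "?y = 0") auto
  qed (use xy add in auto)
  then show ?case by (simp add: power_add[symmetric] algebra_simps)
qed

text \<open>
  An upper bound for the time of an assignment or a test in a memory whose entries have at most
  \<open>l\<close> bits, if its expressions are simple. So it suffices to count steps and to bound the memory.
\<close>

definition step_cost :: "nat \<Rightarrow> nat" where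
  "step_cost l = 100 * (32 * l + 4) * bits (int (32 * l + 4))"

lemma bits_ge_1: "1 \<le> bits x" by (simp add: bits_def)

lemma binop_cost_le: "binop_cost f k \<le> k * bits (int k)"
  using bits_ge_1[of "int k"] by (cases f) auto

text \<open>The extra \<open>C\<close> on the left makes the induction close: each of the two
  operands leaves a slack of \<open>C\<close>, one of which pays for the operation and one of which
  is passed on. Two operands together have at most \<open>24 l + 4\<close> bits, rounded up to
  \<open>32 l + 4\<close>.\<close>

lemma expr_cost_bound:
  assumes "memory_bounded l s" "small_constants e" "esize e \<le> 24"
  defines "C \<equiv> (32 * l + 4) * bits (int (32 * l + 4))"
  shows "expr_cost e s + C \<le> (2 * esize e) * C"
  using assms(2,3)
proof (induction e)
  case (Num k)
  then have "\<bar>k\<bar> \<le> 2 ^ 1" by simp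
  then have "bits k \<le> 3" using bits_le by fastforce
  also have "\<dots> \<le> (32 * l + 4) * 1" by simp
  also have "\<dots> \<le> C" unfolding C_def by (intro mult_le_mono2 bits_ge_1)
  finally show ?case by simp
next
  case (Entry x e)
  have b: "\<bar>expr_value e s\<bar> \<le> 2 ^ (l * esize e)" using Entry assms by (intro expr_value_bound) auto
  have "esize e \<le> 23" using Entry.prems by simp
  then have "l * esize e \<le> l * 23" by (rule mult_le_mono2)
  with bits_le[OF b] have "bits (expr_value e s) \<le> l * 23 + 2" by linarith
  moreover have "bits (s x (expr_value e s)) \<le> l + 2"
    using assms(1) by (intro bits_le) (auto simp: memory_bounded_def)
  moreover have "(32 * l + 4) * 1 \<le> C" unfolding C_def by (intro mult_le_mono2 bits_ge_1)
  moreover have "expr_cost e s + C \<le> 2 * esize e * C" using Entry by simp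
  ultimately show ?case by (simp add: algebra_simps)
next
  case (Op f e1 e2)
  let ?k = "bits (expr_value e1 s) + bits (expr_value e2 s)"
  have b: "\<bar>expr_value e1 s\<bar> \<le> 2 ^ (l * esize e1)" "\<bar>expr_value e2 s\<bar> \<le> 2 ^ (l * esize e2)"
    using Op assms by (auto intro!: expr_value_bound)
  have "?k \<le> l * (esize e1 + esize e2) + 4" using bits_le[OF b(1)] bits_le[OF b(2)] by (simp add: algebra_simps)
  also have "\<dots> \<le> l * 32 + 4" using Op by (intro add_le_mono mult_le_mono2) auto
  finally have k: "?k \<le> 32 * l + 4" by simp
  have "binop_cost f ?k \<le> ?k * bits (int ?k)" by (rule binop_cost_le)
  also have "\<dots> \<le> C" unfolding C_def by (intro mult_le_mono k bits_nat_mono)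
  finally have c: "binop_cost f ?k \<le> C" .
  have "expr_cost e1 s + C \<le> 2 * esize e1 * C" "expr_cost e2 s + C \<le> 2 * esize e2 * C"
    using Op by auto
  with c show ?case by (simp add: algebra_simps)
qed

text \<open>This explains the factor 100 in \<open>step_cost\<close>: size at most 24 gives cost at
  most \<open>48 C\<close> for each of the two expressions, the bits of index and value add at most
  \<open>C\<close> each, and the rest covers the constant.\<close>

lemma step_cost_ge:
  assumes "memory_bounded l s" "simple_expr d" "simple_expr e"
  shows "1 + expr_cost d s + expr_cost e s + bits (expr_value d s) + bits (expr_value e s) \<le> step_cost l"
proof -
  define C where "C = (32 * l + 4) * bits (int (32 * l + 4))"
  have C: "32 * l + 4 \<le> C" unfolding C_def using bits_ge_1[of "int (32 * l + 4)"] mult_le_mono2 by fastforce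
  have *: "expr_cost e s \<le> 48 * C \<and> bits (expr_value e s) \<le> C" if "simple_expr e" for e
  proof -
    have e: "small_constants e" "esize e \<le> 24" using that by (auto simp: simple_expr_def)
    have "2 * esize e * C \<le> 48 * C" using e by (intro mult_le_mono1) auto
    moreover have "expr_cost e s + C \<le> (2 * esize e) * C"
      unfolding C_def by (rule expr_cost_bound[OF assms(1) e])
    moreover have "l * esize e \<le> l * 24" using e by (intro mult_le_mono2)
    moreover have "bits (expr_value e s) \<le> l * esize e + 2"
      by (intro bits_le expr_value_bound assms e)
    ultimately show ?thesis using C by linarith
  qed
  have "step_cost l = 100 * C" by (simp add: step_cost_def C_def)
  then show ?thesis using *[OF assms(2)] *[OF assms(3)] C by linarith
qed

lemma test_cost_le:
  assumes "memory_bounded l s" "simple_expr e"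
  shows "1 + expr_cost e s \<le> step_cost l"
  using step_cost_ge[OF assms(1) assms(2) assms(2)] by simp

lemma step_cost_pos: "l + 3 \<le> step_cost l"
proof -
  have "(100 * (32 * l + 4)) * 1 \<le> step_cost l" unfolding step_cost_def by (intro mult_le_mono2 bits_ge_1)
  then show ?thesis by simp
qed

text \<open>A total correctness triple with a clock that ticks in units of
  \<open>step_cost l\<close>. The memory bound and the frame condition are built in, so that
  postconditions need not repeat them.\<close>

definition runs ::
  "nat \<Rightarrow> program \<Rightarrow> memory \<Rightarrow> int list list \<Rightarrow> nat \<Rightarrow> (memory \<Rightarrow> int list list \<Rightarrow> bool) \<Rightarrow> bool" where
  "runs l p s rs N Q \<longleftrightarrow> (\<exists>t s' rs'. exec p (s, rs) t (s', rs') \<and> t \<le> N * step_cost l \<and>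
     memory_bounded l s' \<and> (\<forall>y. y \<notin> arrays_written p \<longrightarrow> s' y = s y) \<and> Q s' rs')"

lemma runsI:
  assumes "exec p (s, rs) t (s', rs')" "t \<le> N * step_cost l" "memory_bounded l s'" "Q s' rs'"
  shows "runs l p s rs N Q"
  using assms exec_frame[OF assms(1)] unfolding runs_def by fastforce

lemma runs_conseq:
  assumes "runs l p s rs N Q"
    "\<And>s' rs'. memory_bounded l s' \<Longrightarrow> (\<forall>y. y \<notin> arrays_written p \<longrightarrow> s' y = s y) \<Longrightarrow> Q s' rs' \<Longrightarrow> Q' s' rs'"
    "N \<le> N'"
  shows "runs l p s rs N' Q'"
proof -
  have "N * step_cost l \<le> N' * step_cost l" using assms(3) by (rule mult_le_mono1)
  then show ?thesis using assms(1,2) unfolding runs_def by (meson le_trans)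
qed

lemma runs_Skip:
  assumes "memory_bounded l s" "Q s rs" "1 \<le> N"
  shows "runs l Skip s rs N Q"
proof (rule runsI)
  show "1 \<le> N * step_cost l" using mult_le_mono[OF assms(3), of 1 "step_cost l"] step_cost_pos[of l] by simp
  show "exec Skip (s, rs) 1 (s, rs)" by (rule exec.Skip)
qed (use assms in auto)

lemma memory_bounded_store:
  "memory_bounded l s \<Longrightarrow> \<bar>v\<bar> \<le> 2 ^ l \<Longrightarrow> memory_bounded l (store s x k v)"
  by (auto simp: memory_bounded_def store_def)

lemma runs_Assign:
  assumes "memory_bounded l s" "simple_expr d" "simple_expr e" "\<bar>expr_value e s\<bar> \<le> 2 ^ l"
    "Q (store s x (expr_value d s) (expr_value e s)) rs" "1 \<le> N"
  shows "runs l (Assign x d e) s rs N Q"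
proof (rule runsI[OF exec.Assign])
  show "1 + expr_cost d s + expr_cost e s + bits (expr_value d s) + bits (expr_value e s) \<le> N * step_cost l"
    using step_cost_ge[OF assms(1-3)] mult_le_mono1[OF assms(6), of "step_cost l"] by linarith
qed (use assms in \<open>auto intro: memory_bounded_store\<close>)

lemma runs_Seq:
  assumes "runs l p s rs Np Qp"
    "\<And>s' rs'. memory_bounded l s' \<Longrightarrow> (\<forall>y. y \<notin> arrays_written p \<longrightarrow> s' y = s y) \<Longrightarrow> Qp s' rs' \<Longrightarrow>
       runs l q s' rs' Nq Q"
    "Np + Nq + 1 \<le> N"
  shows "runs l (Seq p q) s rs N Q"
proof -
  obtain t s1 rs1 where 1: "exec p (s, rs) t (s1, rs1)" "t \<le> Np * step_cost l" "memory_bounded l s1"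
    "\<forall>y. y \<notin> arrays_written p \<longrightarrow> s1 y = s y" "Qp s1 rs1"
    using assms(1) unfolding runs_def by blast
  then obtain u s2 rs2 where 2: "exec q (s1, rs1) u (s2, rs2)" "u \<le> Nq * step_cost l"
    "memory_bounded l s2" "Q s2 rs2"
    using assms(2) unfolding runs_def by blast
  have "1 + t + u \<le> (Np + Nq + 1) * step_cost l"
    using 1(2) 2(2) step_cost_pos[of l] by (simp add: algebra_simps)
  also have "\<dots> \<le> N * step_cost l" using assms(3) by (rule mult_le_mono1)
  finally show ?thesis using 1 2 by (intro runsI[OF exec.Seq])
qed

lemma runs_Cond:
  assumes "memory_bounded l s" "simple_expr e"
    "0 < expr_value e s \<Longrightarrow> runs l p s rs N' Q" "\<not> 0 < expr_value e s \<Longrightarrow> runs l q s rs N' Q"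
    "N' + 1 \<le> N"
  shows "runs l (Cond e p q) s rs N Q"
proof -
  have N: "1 + expr_cost e s + t \<le> N * step_cost l" if "t \<le> N' * step_cost l" for t
    using that test_cost_le[OF assms(1,2)] mult_le_mono1[OF assms(5), of "step_cost l"] by simp
  show ?thesis
  proof (cases "0 < expr_value e s")
    case True
    then obtain t s1 rs1 where "exec p (s, rs) t (s1, rs1)" "t \<le> N' * step_cost l"
      "memory_bounded l s1" "Q s1 rs1"
      using assms(3) unfolding runs_def by blast
    then show ?thesis using True N by (intro runsI[OF exec.CondTrue])
  next
    case False
    then obtain t s1 rs1 where "exec q (s, rs) t (s1, rs1)" "t \<le> N' * step_cost l"
      "memory_bounded l s1" "Q s1 rs1"
      using assms(4) unfolding runs_def by blast
    then show ?thesis using False N by (intro runsI[OF exec.CondFalse])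
  qed
qed

text \<open>One measure gives both termination and time: it drops in every iteration, hence bounds
  their number, and each iteration is charged \<open>N\<close> for the body and 1 for the
  test.\<close>

lemma runs_While:
  fixes \<mu> :: "memory \<Rightarrow> int list list \<Rightarrow> nat"
  assumes "I s rs" "memory_bounded l s" "simple_expr e"
    and step: "\<And>s' rs'. I s' rs' \<Longrightarrow> memory_bounded l s' \<Longrightarrow>
      (\<forall>y. y \<notin> arrays_written p \<longrightarrow> s' y = s y) \<Longrightarrow> 0 < expr_value e s' \<Longrightarrow>
      runs l p s' rs' N (\<lambda>s'' rs''. I s'' rs'' \<and> \<mu> s'' rs'' < \<mu> s' rs')"
    and fin: "\<And>s' rs'. I s' rs' \<Longrightarrow> memory_bounded l s' \<Longrightarrow>
      (\<forall>y. y \<notin> arrays_written p \<longrightarrow> s' y = s y) \<Longrightarrow> \<not> 0 < expr_value e s' \<Longrightarrow> Q s' rs'"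
  shows "runs l (While e p) s rs ((N + 1) * \<mu> s rs + 1) Q"
proof -
  have "runs l (While e p) s' rs' ((N + 1) * \<mu> s' rs' + 1) Q"
    if "I s' rs'" "memory_bounded l s'" "\<forall>y. y \<notin> arrays_written p \<longrightarrow> s' y = s y" for s' rs'
    using that
  proof (induction "\<mu> s' rs'" arbitrary: s' rs' rule: less_induct)
    case less
    show ?case
    proof (cases "0 < expr_value e s'")
      case False
      show ?thesis
      proof (rule runsI[OF exec.WhileFalse])
        show "1 + expr_cost e s' \<le> ((N + 1) * \<mu> s' rs' + 1) * step_cost l"
          using test_cost_le[OF less.prems(2) assms(3)] by simp
      qed (use False less.prems fin in auto)
    next
      case True
      obtain t s1 rs1 where 1: "exec p (s', rs') t (s1, rs1)" "t \<le> N * step_cost l"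
        "memory_bounded l s1" "\<forall>y. y \<notin> arrays_written p \<longrightarrow> s1 y = s' y" "I s1 rs1"
        "\<mu> s1 rs1 < \<mu> s' rs'"
        using step[OF less.prems True] unfolding runs_def by blast
      then have "runs l (While e p) s1 rs1 ((N + 1) * \<mu> s1 rs1 + 1) Q"
        using less.prems by (intro less.hyps) auto
      then obtain u s2 rs2 where 2: "exec (While e p) (s1, rs1) u (s2, rs2)"
        "u \<le> ((N + 1) * \<mu> s1 rs1 + 1) * step_cost l" "memory_bounded l s2" "Q s2 rs2"
        unfolding runs_def by blast
      have "(N + 1) * (\<mu> s1 rs1 + 1) \<le> (N + 1) * \<mu> s' rs'" using 1(6) by (intro mult_le_mono2) auto
      then have "(N + 1) * (\<mu> s1 rs1 + 1) * step_cost l \<le> (N + 1) * \<mu> s' rs' * step_cost l"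
        by (rule mult_le_mono1)
      then have "1 + expr_cost e s' + t + u \<le> ((N + 1) * \<mu> s' rs' + 1) * step_cost l"
        using 1(2) 2(2) test_cost_le[OF less.prems(2) assms(3)] by (simp add: algebra_simps)
      then show ?thesis using 1 2 True by (intro runsI[OF exec.WhileTrue])
    qed
  qed
  then show ?thesis using assms(1,2) by blast
qed

section \<open>Counting loops, matrices in memory and row updates\<close>

abbreviation Var :: "nat \<Rightarrow> expr" where
  "Var x \<equiv> Entry x (Num 0)"

abbreviation Set :: "nat \<Rightarrow> expr \<Rightarrow> program" where
  "Set x e \<equiv> Assign x (Num 0) e"

definition For :: "nat \<Rightarrow> nat \<Rightarrow> program \<Rightarrow> program" where
  "For x m p = Seq (Set x (Num 0))
     (While (Op Sub (Var m) (Var x)) (Seq p (Set x (Op Add (Var x) (Num 1)))))"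

lemma arrays_written_For [simp]: "arrays_written (For x m p) = insert x (arrays_written p)"
  by (auto simp: For_def)

lemma store_other [simp]: "y \<noteq> x \<Longrightarrow> store s x k v y = s y"
  by (simp add: store_def)

lemma store_same: "store s x k v x = (s x)(k := v)"
  by (simp add: store_def)

text \<open>\<open>indep\<close> keeps the counter out of the invariant, as it changes after the
  body. Beyond \<open>N\<close>, a pass pays for test, sequencing and increment; the final 3 pays
  for the initial assignment, its sequencing and the failing test.\<close>

lemma runs_For:
  assumes "memory_bounded l s" "s m 0 = int n" "x \<notin> arrays_written p" "m \<notin> arrays_written p" "m \<noteq> x"
    and init: "I 0 s rs"
    and indep: "\<And>k s rs v. I k s rs \<Longrightarrow> I k (store s x 0 v) rs"
    and step: "\<And>k s' rs'. k < n \<Longrightarrow> I k s' rs' \<Longrightarrow> memory_bounded l s' \<Longrightarrow>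
      (\<forall>y. y \<noteq> x \<and> y \<notin> arrays_written p \<longrightarrow> s' y = s y) \<Longrightarrow> s' x 0 = int k \<Longrightarrow>
      runs l p s' rs' N (I (Suc k))"
    and N': "(N + 3) * n + 3 \<le> N'"
  shows "runs l (For x m p) s rs N' (I n)"
proof -
  let ?e = "Op Sub (Var m) (Var x)" and ?p = "Seq p (Set x (Op Add (Var x) (Num 1)))"
  let ?J = "\<lambda>s' rs'. \<exists>k\<le>n. s' x 0 = int k \<and> I k s' rs' \<and> (\<forall>y. y \<noteq> x \<and> y \<notin> arrays_written p \<longrightarrow> s' y = s y)"
  let ?s = "store s x 0 0"
  have n: "int n \<le> 2 ^ l" using assms(1,2) unfolding memory_bounded_def by (metis abs_of_nat)
  then have Suc_le: "int k + 1 \<le> 2 ^ l" if "k < n" for k using that by linarith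
  have b: "memory_bounded l ?s" using assms(1) by (intro memory_bounded_store) auto
  have "runs l (While ?e ?p) ?s rs ((N + 2 + 1) * nat (int n - ?s x 0) + 1) (I n)"
  proof (rule runs_While[where I = ?J and \<mu> = "\<lambda>s rs. nat (int n - s x 0)"])
    show "?J ?s rs" using init indep by (intro exI[of _ 0]) (auto simp: store_same)
    fix s' rs'
    assume J: "?J s' rs'" and b': "memory_bounded l s'"
    then obtain k where k: "k \<le> n" "s' x 0 = int k" "I k s' rs'"
      and fr: "\<forall>y. y \<noteq> x \<and> y \<notin> arrays_written p \<longrightarrow> s' y = s y" by blast
    have m: "s' m 0 = int n" using fr assms(2,4,5) by simp
    { assume "\<not> 0 < expr_value ?e s'"
      then have "k = n" using k m by simp
      then show "I n s' rs'" using k by simp }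
    assume "0 < expr_value ?e s'"
    then have kn: "k < n" using k m by simp
    show "runs l ?p s' rs' (N + 2) (\<lambda>s'' rs''. ?J s'' rs'' \<and> nat (int n - s'' x 0) < nat (int n - s' x 0))"
    proof (rule runs_Seq[OF step[OF kn k(3) b' fr k(2)]])
      fix s1 rs1
      assume 1: "memory_bounded l s1" "\<forall>y. y \<notin> arrays_written p \<longrightarrow> s1 y = s' y" "I (Suc k) s1 rs1"
      then have x: "s1 x 0 = int k" using k(2) assms(3) by simp
      show "runs l (Set x (Op Add (Var x) (Num 1))) s1 rs1 1
          (\<lambda>s'' rs''. ?J s'' rs'' \<and> nat (int n - s'' x 0) < nat (int n - s' x 0))"
      proof (rule runs_Assign[OF 1(1)])
        show "\<bar>expr_value (Op Add (Var x) (Num 1)) s1\<bar> \<le> 2 ^ l" using Suc_le[OF kn] x by simp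
        show "?J (store s1 x (expr_value (Num 0) s1) (expr_value (Op Add (Var x) (Num 1)) s1)) rs1 \<and>
          nat (int n - store s1 x (expr_value (Num 0) s1) (expr_value (Op Add (Var x) (Num 1)) s1) x 0) < nat (int n - s' x 0)"
          using x kn k indep[OF 1(3)] fr 1(2)
          by (intro conjI exI[of _ "Suc k"]) (auto simp: store_same)
      qed (auto simp: simple_expr_def)
    qed simp
  qed (use b in \<open>auto simp: simple_expr_def\<close>)
  then have 1: "runs l (While ?e ?p) ?s rs ((N + 3) * n + 1) (I n)"
    by (simp add: store_same numeral_3_eq_3)
  have "runs l (Set x (Num 0)) s rs 1 (\<lambda>s' rs'. s' = ?s \<and> rs' = rs)"
    using assms(1) by (intro runs_Assign) (auto simp: simple_expr_def)
  then show ?thesis unfolding For_def using 1 N' by (elim runs_Seq) auto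
qed

text \<open>Without the cut-off, column \<open>b\<close> of a row would be the first entry of the
  next row. With it, rows are finitely supported vectors and can be compared as functions.\<close>

definition matrix_at :: "memory \<Rightarrow> nat \<Rightarrow> nat \<Rightarrow> nat \<Rightarrow> nat \<Rightarrow> int" where
  "matrix_at s Y b j x = (if x < b then s Y (int j * int b + int x) else 0)"

lemma matrix_at_cong: "s Y = s' Y \<Longrightarrow> matrix_at s Y b = matrix_at s' Y b"
  by (intro ext) (simp add: matrix_at_def)

text \<open>Row-major addresses are injective: quotient and remainder modulo \<open>b\<close>
  recover row and column.\<close>

lemma matrix_at_upd:
  assumes "x < b" "s' Y = (s Y)(int j * int b + int x := v)"
  shows "matrix_at s' Y b = (matrix_at s Y b)(j := (matrix_at s Y b j)(x := v))"
proof (intro ext)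
  fix i z
  have "int i * int b + int z = int j * int b + int x \<longleftrightarrow> i = j \<and> z = x" if "z < b"
  proof
    assume "int i * int b + int z = int j * int b + int x"
    then have e: "i * b + z = j * b + x" by (metis of_nat_add of_nat_eq_iff of_nat_mult)
    have "(i * b + z) div b = i" "(j * b + x) div b = j" using that assms(1) by auto
    with e show "i = j \<and> z = x" by auto
  qed auto
  then show "matrix_at s' Y b i z = ((matrix_at s Y b)(j := (matrix_at s Y b j)(x := v))) i z"
    using assms by (auto simp: matrix_at_def)
qed

text \<open>The row is overwritten from left to right, and the hypothesis on \<open>s'\<close>
  records that the entries from \<open>k\<close> on are still the old ones. This permits in-place
  updates that read the entry they replace.\<close>

lemma runs_map:
  assumes "memory_bounded l s" "s m 0 = int b" "distinct [x, m, y]" "simple_expr d" "simple_expr e"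
    and step: "\<And>k s'. k < b \<Longrightarrow> memory_bounded l s' \<Longrightarrow> (\<forall>z. z \<noteq> x \<and> z \<noteq> y \<longrightarrow> s' z = s z) \<Longrightarrow>
      s' x 0 = int k \<Longrightarrow>
      matrix_at s' y b = (matrix_at s y b)(j := \<lambda>z. if z < k then f z else matrix_at s y b j z) \<Longrightarrow>
      expr_value d s' = int j * int b + int k \<and> expr_value e s' = f k \<and> \<bar>f k\<bar> \<le> 2 ^ l"
    and "4 * b + 3 \<le> N"
  shows "runs l (For x m (Assign y d e)) s rs N
    (\<lambda>s' rs'. rs' = rs \<and> matrix_at s' y b = (matrix_at s y b)(j := \<lambda>z. if z < b then f z else 0))"
proof -
  let ?I = "\<lambda>k s' rs'. rs' = rs \<and>
    matrix_at s' y b = (matrix_at s y b)(j := \<lambda>z. if z < k then f z else matrix_at s y b j z)"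
  have "runs l (For x m (Assign y d e)) s rs N (?I b)"
  proof (rule runs_For[where I = ?I and N = 1])
    fix k s' rs'
    assume k: "k < b" "?I k s' rs'" "memory_bounded l s'"
      "\<forall>z. z \<noteq> x \<and> z \<notin> arrays_written (Assign y d e) \<longrightarrow> s' z = s z" "s' x 0 = int k"
    then have e: "expr_value d s' = int j * int b + int k" "expr_value e s' = f k" "\<bar>f k\<bar> \<le> 2 ^ l"
      using step[of k s'] by auto
    show "runs l (Assign y d e) s' rs' 1 (?I (Suc k))"
    proof (rule runs_Assign)
      have "matrix_at (store s' y (int j * int b + int k) (f k)) y b = (matrix_at s' y b)(j := (matrix_at s' y b j)(k := f k))"
        using k by (intro matrix_at_upd) (auto simp: store_same)
      then show "?I (Suc k) (store s' y (expr_value d s') (expr_value e s')) rs'"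
        using k e by (auto simp: fun_eq_iff)
    qed (use assms(4,5) e(3) e(2) k(3) in simp_all)
  next
    show "?I 0 s rs" by (simp add: fun_eq_iff)
    show "?I k (store s' x 0 v) rs'" if "?I k s' rs'" for k v and s' :: memory and rs'
      using that assms(3) matrix_at_cong[of "store s' x 0 v" y s' b] by simp
    show "(1 + 3) * b + 3 \<le> N" using assms(7) by simp
  qed (use assms(1-3) in simp_all)
  then show ?thesis
    by (rule runs_conseq) (simp_all add: fun_eq_iff matrix_at_def)
qed

lemma runs_Query:
  assumes "memory_bounded l s" "rs = r # rs'" "\<And>v. v \<in> set r \<Longrightarrow> \<bar>v\<bar> \<le> 2 ^ l" "int (length r) \<le> 2 ^ l"
    "2 * length r + 1 \<le> N"
    "Q (s(x := (\<lambda>k. if 0 \<le> k \<and> k < int (length r) then r ! nat k else s x k))) rs'"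
  shows "runs l (Query x) s rs N Q"
  unfolding assms(2)
proof (rule runsI[OF exec.Query])
  have "(\<Sum>j<length r. bits (int j) + bits (r ! j)) \<le> (\<Sum>j<length r. 2 * step_cost l)"
  proof (rule sum_mono)
    fix j assume "j \<in> {..<length r}"
    then have "\<bar>int j\<bar> \<le> 2 ^ l" "\<bar>r ! j\<bar> \<le> 2 ^ l" using assms(3)[of "r ! j"] assms(4) by auto
    then have "bits (int j) \<le> l + 2" "bits (r ! j) \<le> l + 2" using bits_le by blast+
    then show "bits (int j) + bits (r ! j) \<le> 2 * step_cost l" using step_cost_pos[of l] by linarith
  qed
  then have "1 + (\<Sum>j<length r. bits (int j) + bits (r ! j)) \<le> (2 * length r + 1) * step_cost l"
    using step_cost_pos[of l] by (simp add: algebra_simps)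
  also have "\<dots> \<le> N * step_cost l" using assms(5) by (rule mult_le_mono1)
  finally show "1 + (\<Sum>j<length r. bits (int j) + bits (r ! j)) \<le> N * step_cost l" .
  show "memory_bounded l (s(x := \<lambda>k. if 0 \<le> k \<and> k < int (length r) then r ! nat k else s x k))"
    using assms by (auto simp: memory_bounded_def)
qed (use assms in auto)

section \<open>Fraction-free elimination\<close>

definition mdet :: "nat \<Rightarrow> (nat \<Rightarrow> nat \<Rightarrow> int) \<Rightarrow> int" where
  "mdet b B = det (mat b b (\<lambda>(i, j). B i j))"

text \<open>The adjugate, whence the transposed indices. Matrices stay functions of two indices so
  that replacing a row is the function update \<open>B(c := v)\<close>.\<close>

definition madj :: "nat \<Rightarrow> (nat \<Rightarrow> nat \<Rightarrow> int) \<Rightarrow> nat \<Rightarrow> nat \<Rightarrow> int" where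
  "madj b B i j = cofactor (mat b b (\<lambda>(i, j). B i j)) j i"

lemma madj_left:
  assumes "j < b" "x < b"
  shows "(\<Sum>y<b. madj b B j y * B y x) = (if j = x then mdet b B else 0)"
proof -
  let ?A = "mat b b (\<lambda>(i, j). B i j)"
  have A: "?A \<in> carrier_mat b b" by simp
  have "(adj_mat ?A * ?A) $$ (j, x) = (\<Sum>y<b. madj b B j y * B y x)"
    using assms by (simp add: times_mat_def scalar_prod_def adj_mat_def madj_def atLeast0LessThan)
  then show ?thesis unfolding adj_mat(3)[OF A] using assms by (cases "j = x") (auto simp: mdet_def)
qed

lemma madj_right:
  assumes "j < b" "x < b"
  shows "(\<Sum>y<b. B j y * madj b B y x) = (if j = x then mdet b B else 0)"
proof -
  let ?A = "mat b b (\<lambda>(i, j). B i j)"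
  have A: "?A \<in> carrier_mat b b" by simp
  have "(?A * adj_mat ?A) $$ (j, x) = (\<Sum>y<b. B j y * madj b B y x)"
    using assms by (simp add: times_mat_def scalar_prod_def adj_mat_def madj_def atLeast0LessThan)
  then show ?thesis unfolding adj_mat(2)[OF A] using assms by (cases "j = x") (auto simp: mdet_def)
qed

lemma mdet_row:
  assumes "c < b"
  shows "mdet b B = (\<Sum>y<b. B c y * madj b B y c)"
  using madj_right[of c b c B] assms by simp

text \<open>A cofactor along row \<open>c\<close> deletes that row, so it cannot depend on it. Hence
  the determinant is linear in a replaced row with unchanged coefficients.\<close>

lemma madj_upd:
  assumes "c < b"
  shows "madj b (B(c := v)) y c = madj b B y c"
proof -
  have "mat_delete (mat b b (\<lambda>(i, j). (B(c := v)) i j)) c y = mat_delete (mat b b (\<lambda>(i, j). B i j)) c y"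
    using assms by (intro eq_matI) (auto simp: mat_delete_def)
  then show ?thesis by (simp add: madj_def cofactor_def)
qed

lemma mdet_upd:
  assumes "c < b"
  shows "mdet b (B(c := v)) = (\<Sum>y<b. v y * madj b B y c)"
  using mdet_row[OF assms, of "B(c := v)"] madj_upd[OF assms] by simp

lemma mdet_one: "mdet b (\<lambda>i j. if i = j then 1 else 0) = 1"
proof -
  have "mat b b (\<lambda>(i, j). if i = j then 1 else 0 :: int) = 1\<^sub>m b" by (intro eq_matI) auto
  then show ?thesis by (simp add: mdet_def)
qed

lemma madj_one: "i < b \<Longrightarrow> j < b \<Longrightarrow> madj b (\<lambda>i j. if i = j then 1 else 0) i j = (if i = j then 1 else 0)"
  using madj_left[of i b j "\<lambda>i j. if i = j then 1 else 0"] by (simp add: mdet_one if_distrib cong: if_cong)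

text \<open>Leibniz formula with \<open>b!\<close> terms. The factorial contributes about
  \<open>b log b\<close> bits, which fits into \<open>b poly(log n)\<close>.\<close>

lemma det_bound:
  assumes "A \<in> carrier_mat b b" "\<And>i j. i < b \<Longrightarrow> j < b \<Longrightarrow> \<bar>A $$ (i, j)\<bar> \<le> M"
  shows "\<bar>det A :: int\<bar> \<le> fact b * M ^ b"
proof -
  have "\<bar>det A\<bar> \<le> (\<Sum>p\<in>{p. p permutes {0..<b}}. \<bar>signof p * (\<Prod>i = 0..<b. A $$ (i, p i))\<bar>)"
    unfolding det_def'[OF assms(1)] by (rule sum_abs)
  also have "\<dots> \<le> (\<Sum>p\<in>{p. p permutes {0..<b}}. M ^ b)"
  proof (rule sum_mono)
    fix p assume "p \<in> {p. p permutes {0..<b}}"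
    then have p: "p permutes {0..<b}" by simp
    have "\<bar>signof p * (\<Prod>i = 0..<b. A $$ (i, p i))\<bar> = (\<Prod>i = 0..<b. \<bar>A $$ (i, p i)\<bar>)"
      by (simp add: abs_mult abs_prod sign_def)
    also have "\<dots> \<le> (\<Prod>i = 0..<b. M)"
      using permutes_in_image[OF p] assms(2) by (intro prod_mono) auto
    finally show "\<bar>signof p * (\<Prod>i = 0..<b. A $$ (i, p i))\<bar> \<le> M ^ b" by simp
  qed
  also have "\<dots> = fact b * M ^ b" by (simp add: card_permutations)
  finally show ?thesis .
qed

lemma mdet_bound:
  assumes "\<And>i j. i < b \<Longrightarrow> j < b \<Longrightarrow> \<bar>B i j\<bar> \<le> M"
  shows "\<bar>mdet b B\<bar> \<le> fact b * M ^ b"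
  unfolding mdet_def using assms by (intro det_bound) auto

lemma madj_bound:
  assumes "\<And>i j. i < b \<Longrightarrow> j < b \<Longrightarrow> \<bar>B i j\<bar> \<le> M" "i < b" "j < b" "1 \<le> M"
  shows "\<bar>madj b B i j\<bar> \<le> fact b * M ^ b"
proof -
  have "\<bar>madj b B i j\<bar> = \<bar>det (mat_delete (mat b b (\<lambda>(i, j). B i j)) j i)\<bar>"
    by (simp add: madj_def cofactor_def abs_mult power_abs)
  also have "\<dots> \<le> fact (b - 1) * M ^ (b - 1)"
    using assms by (intro det_bound) (auto simp: mat_delete_def)
  also have "\<dots> \<le> fact b * M ^ b"
    using assms by (intro mult_mono power_increasing fact_mono) auto
  finally show ?thesis .
qed

text \<open>
  \<open>B\<close> is the unit matrix with the rows in \<open>P\<close> replaced by some of the relations \<open>A 0, \<dots>, A (k - 1)\<close>,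
  and \<open>T = adj B \<cdot> D \<cdot> B\<close>, where \<open>D\<close> is the diagonal matrix that selects the rows in \<open>P\<close>. The condition
  \<open>T0\<close> holds because the column \<open>0\<close> becomes a pivot only when no other column can.
\<close>

locale pivoted =
  fixes b :: nat and A :: "nat \<Rightarrow> nat \<Rightarrow> int" and k :: nat and T :: "nat \<Rightarrow> nat \<Rightarrow> int" and d :: int
    and P :: "nat set" and B :: "nat \<Rightarrow> nat \<Rightarrow> int"
  assumes P: "P \<subseteq> {..<b}"
    and pivot_row: "\<And>p. p \<in> P \<Longrightarrow> \<exists>r<k. \<forall>x<b. B p x = A r x"
    and unit_row: "\<And>p x. p < b \<Longrightarrow> p \<notin> P \<Longrightarrow> x < b \<Longrightarrow> B p x = (if p = x then 1 else 0)"
    and d: "mdet b B = d" "d \<noteq> 0"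
    and T: "\<And>j x. j < b \<Longrightarrow> x < b \<Longrightarrow> T j x = (if j = x then d else 0) - (if x \<in> P then 0 else madj b B j x)"
    and dep: "\<And>r x. r < k \<Longrightarrow> x < b \<Longrightarrow> x \<notin> P \<Longrightarrow> (\<Sum>y<b. A r y * madj b B y x) = 0"
    and T0: "\<And>x. 0 \<in> P \<Longrightarrow> x < b \<Longrightarrow> x \<noteq> 0 \<Longrightarrow> T 0 x = 0"
begin

text \<open>\<open>d I - T\<close> is \<open>adj B\<close> with the columns in \<open>P\<close>
  erased. So the residual of \<open>v\<close> at \<open>x\<close> outside \<open>P\<close> is
  \<open>d\<close> times the coordinate of \<open>v\<close> along the unit row \<open>x\<close> in
  the basis of rows of \<open>B\<close>; it vanishes iff \<open>v\<close> is in the rational span of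
  the pivot rows.\<close>

lemma residual:
  assumes "x < b"
  shows "d * v x - (\<Sum>j<b. v j * T j x) = (if x \<in> P then 0 else (\<Sum>j<b. v j * madj b B j x))"
proof -
  have "(\<Sum>j<b. v j * T j x) = (\<Sum>j<b. (if j = x then v j * d else 0) - v j * (if x \<in> P then 0 else madj b B j x))"
    using assms by (intro sum.cong refl) (auto simp: T algebra_simps)
  also have "\<dots> = v x * d - (\<Sum>j<b. v j * (if x \<in> P then 0 else madj b B j x))"
    using assms by (simp add: sum_subtractf)
  finally show ?thesis by simp
qed

text \<open>Row \<open>c\<close> of \<open>B\<close> is a unit vector, so row \<open>c\<close> of
  \<open>B adj B = d I\<close> is row \<open>c\<close> of \<open>adj B\<close> itself.\<close>

lemma madj_unit:
  assumes "c < b" "c \<notin> P" "x < b"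
  shows "madj b B c x = (if c = x then d else 0)"
proof -
  have "(\<Sum>y<b. B c y * madj b B y x) = (\<Sum>y<b. if c = y then madj b B y x else 0)"
    using assms by (intro sum.cong refl) (auto simp: unit_row)
  then show ?thesis using madj_right[of c b x B] assms d by (cases "c = x") auto
qed

lemma T_unit:
  assumes "c < b" "c \<notin> P" "x < b"
  shows "T c x = 0"
  using assms by (auto simp: T madj_unit)

text \<open>Splitting \<open>adj B B = d I\<close> into pivot rows and unit rows shows that rows of
  \<open>T\<close> are integer combinations of relations, which is why they lie in
  \<open>L\<close>.\<close>

lemma T_combination:
  assumes "j < b" "x < b"
  shows "T j x = (\<Sum>p\<in>P. madj b B j p * B p x)"
proof -
  have fin: "finite P" using P finite_subset by blast
  have "(if j = x then d else 0) = (\<Sum>y<b. madj b B j y * B y x)"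
    using madj_left[OF assms] d by simp
  also have "\<dots> = (\<Sum>y\<in>{..<b} - P. madj b B j y * B y x) + (\<Sum>y\<in>P. madj b B j y * B y x)"
    using P by (intro sum.subset_diff) auto
  also have "(\<Sum>y\<in>{..<b} - P. madj b B j y * B y x) = (\<Sum>y\<in>{..<b} - P. if y = x then madj b B j y else 0)"
    using assms by (intro sum.cong refl) (auto simp: unit_row)
  also have "\<dots> = (if x \<in> P then 0 else madj b B j x)"
    using assms by simp
  finally show ?thesis using T[OF assms] by simp
qed

text \<open>A vanishing residual means that the new relation already lies in the rational span of
  the pivot rows, so only \<open>dep\<close> has to be extended.\<close>

lemma skip:
  assumes "\<And>x. x < b \<Longrightarrow> d * A k x - (\<Sum>j<b. A k j * T j x) = 0"
  shows "pivoted b A (Suc k) T d P B"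
proof
  show "\<exists>r<Suc k. \<forall>x<b. B p x = A r x" if "p \<in> P" for p
    using pivot_row[OF that] less_Suc_eq by blast
  show "(\<Sum>y<b. A r y * madj b B y x) = 0" if "r < Suc k" "x < b" "x \<notin> P" for r x
    using that dep assms[of x] residual[of x "A k"] by (cases "r = k") auto
qed (use P unit_row d T T0 in auto)

text \<open>
  The division by \<open>d\<close> is exact since the new entries are entries of \<open>adj B'\<close>, up to sign.
\<close>

lemma pivot:
  assumes w: "\<And>x. x < b \<Longrightarrow> w x = d * A k x - (\<Sum>j<b. A k j * T j x)"
    and c: "c < b" "w c \<noteq> 0" "c = 0 \<Longrightarrow> (\<And>x. x < b \<Longrightarrow> x \<noteq> 0 \<Longrightarrow> w x = 0)"
    and T': "\<And>j x. j < b \<Longrightarrow> x < b \<Longrightarrow> T' j x = (if j = c then w x else (w c * T j x - T j c * w x) div d)"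
  shows "pivoted b A (Suc k) T' (w c) (insert c P) (B(c := A k))"
proof -
  define B' where "B' = B(c := A k)"
  define M where "M = madj b B"
  define M' where "M' = madj b B'"
  define y where "y x = (\<Sum>j<b. A k j * M j x)" for x
  \<comment> \<open>This is the Sherman-Morrison update for replacing row \<open>c\<close>, cleared
    of denominators; \<open>X\<close> will turn out to be \<open>d adj B'\<close>.\<close>
  define X where "X j x = (if x = c then d * M j c else w c * M j x - M j c * y x)" for j x
  have wy: "w x = (if x \<in> P then 0 else y x)" if "x < b" for x
    using residual[OF that, of "A k"] w[OF that] by (simp add: y_def M_def)
  have cP: "c \<notin> P" using c wy by auto
  have wc: "w c = y c" using wy c cP by auto
  have d': "mdet b B' = w c" using mdet_upd[OF c(1), of B "A k"] by (simp add: B'_def wc y_def M_def)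
  have yB: "(\<Sum>x<b. y x * B x z) = d * A k z" if "z < b" for z
  proof -
    have "(\<Sum>x<b. y x * B x z) = (\<Sum>x<b. \<Sum>j<b. A k j * (M j x * B x z))"
      by (simp add: y_def sum_distrib_right mult.assoc)
    also have "\<dots> = (\<Sum>j<b. A k j * (\<Sum>x<b. M j x * B x z))"
      by (subst sum.swap) (simp add: sum_distrib_left)
    also have "\<dots> = (\<Sum>j<b. if j = z then A k j * d else 0)"
      using that madj_left[of _ b z B] d by (intro sum.cong refl) (auto simp: M_def)
    finally show ?thesis using that by simp
  qed
  have XB: "(\<Sum>x<b. X j x * B' x z) = (if j = z then d * w c else 0)" if "j < b" "z < b" for j z
  proof -
    have "(\<Sum>x<b. X j x * B' x z) = (\<Sum>x<b. (w c * M j x - M j c * y x) * B x z + (if x = c then d * M j c * A k z else 0))"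
      by (intro sum.cong refl) (auto simp: X_def B'_def wc)
    also have "\<dots> = w c * (\<Sum>x<b. M j x * B x z) - M j c * (\<Sum>x<b. y x * B x z) + d * M j c * A k z"
      using c(1) by (simp add: sum.distrib sum_subtractf left_diff_distrib sum_distrib_left mult.assoc)
    also have "\<dots> = (if j = z then d * w c else 0)"
      using that madj_left[of j b z B] d yB[of z] by (simp add: M_def)
    finally show ?thesis .
  qed
  \<comment> \<open>Multiplying \<open>X B' = d (w c) I\<close> on the right by
    \<open>adj B'\<close> gives \<open>X (w c) = d (w c) adj B'\<close>, and \<open>w c\<close>, the
    determinant of \<open>B'\<close>, cancels.\<close>
  have X: "d * M' j x = X j x" if "j < b" "x < b" for j x
  proof -
    have "(\<Sum>z<b. (\<Sum>u<b. X j u * B' u z) * M' z x) = (\<Sum>z<b. if j = z then d * w c * M' z x else 0)"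
      using that by (intro sum.cong refl) (auto simp: XB)
    then have 1: "(\<Sum>z<b. (\<Sum>u<b. X j u * B' u z) * M' z x) = d * w c * M' j x" using that by simp
    have "(\<Sum>z<b. (\<Sum>u<b. X j u * B' u z) * M' z x) = (\<Sum>u<b. X j u * (\<Sum>z<b. B' u z * M' z x))"
      by (simp add: sum_distrib_right sum_distrib_left mult.assoc) (rule sum.swap)
    also have "\<dots> = (\<Sum>u<b. if u = x then X j u * w c else 0)"
      using that madj_right[of _ b x B'] by (intro sum.cong refl) (auto simp: M'_def d')
    finally have "d * w c * M' j x = X j x * w c" using 1 that by simp
    then show ?thesis using c(2) by simp
  qed
  have Mc: "M c x = (if c = x then d else 0)" if "x < b" for x
    using madj_unit[OF c(1) cP that] by (simp add: M_def)
  have T'': "T' j x = (if j = x then w c else 0) - (if x \<in> insert c P then 0 else M' j x)"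
    if jx: "j < b" "x < b" for j x
  proof (cases "j = c")
    case True
    show ?thesis
    proof (cases "x \<in> insert c P")
      case True
      then show ?thesis using \<open>j = c\<close> T'[OF jx] wy[OF jx(2)] cP by auto
    next
      case False
      then have "d * M' c x = - d * y x" using X[OF c(1) jx(2)] Mc[OF jx(2)] Mc[OF c(1)] by (auto simp: X_def)
      then have "d * (M' c x + y x) = 0" by (simp add: algebra_simps)
      then have "M' c x = - y x" using d(2) by simp
      then show ?thesis using \<open>j = c\<close> T'[OF jx] wy[OF jx(2)] False by auto
    qed
  next
    case False
    then have Tc: "T j c = - M j c" using T[OF jx(1) c(1)] cP by (simp add: M_def)
    have "w c * T j x - T j c * w x = d * ((if j = x then w c else 0) - (if x \<in> insert c P then 0 else M' j x))"
    proof (cases "x \<in> insert c P")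
      case True
      then consider "x = c" | "x \<in> P" "x \<noteq> c" by auto
      then show ?thesis
      proof cases
        case 1
        then show ?thesis using False by simp
      next
        case 2
        then show ?thesis using T[OF jx] wy[OF jx(2)] by simp
      qed
    next
      case F: False
      then have "d * M' j x = w c * M j x - M j c * y x" using X[OF jx] by (auto simp: X_def)
      moreover have "M j x = (if j = x then d else 0) - T j x" using F T[OF jx] by (simp add: M_def)
      moreover have "w x = y x" using F wy[OF jx(2)] by simp
      ultimately show ?thesis using F Tc by (simp add: algebra_simps)
    qed
    then show ?thesis using T'[OF jx] False d(2) by simp
  qed
  show ?thesis
  proof (fold B'_def, unfold_locales)
    show "insert c P \<subseteq> {..<b}" using P c by auto
    show "\<exists>r<Suc k. \<forall>x<b. B' p x = A r x" if "p \<in> insert c P" for p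
    proof (cases "p = c")
      case True
      then show ?thesis by (auto simp: B'_def)
    next
      case False
      then show ?thesis using that pivot_row[of p] less_Suc_eq by (auto simp: B'_def)
    qed
    show "B' p x = (if p = x then 1 else 0)" if "p < b" "p \<notin> insert c P" "x < b" for p x
      using that unit_row by (simp add: B'_def)
    show "T' j x = (if j = x then w c else 0) - (if x \<in> insert c P then 0 else madj b B' j x)"
      if "j < b" "x < b" for j x
      using T''[OF that] by (simp add: M'_def)
    show "(\<Sum>u<b. A r u * madj b B' u x) = 0" if r: "r < Suc k" "x < b" "x \<notin> insert c P" for r x
    proof (cases "r = k")
      case True
      have "(\<Sum>u<b. B' c u * madj b B' u x) = 0" using madj_right[of c b x B'] c r by auto
      then show ?thesis using True by (simp add: B'_def)
    next
      case False
      then have 0: "(\<Sum>u<b. A r u * M u x) = 0" "(\<Sum>u<b. A r u * M u c) = 0"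
        using r c cP dep[of r] by (auto simp: M_def)
      have "d * (\<Sum>u<b. A r u * M' u x) = (\<Sum>u<b. A r u * (d * M' u x))"
        by (simp add: sum_distrib_left mult.left_commute)
      also have "\<dots> = (\<Sum>u<b. A r u * X u x)"
        using r X by (intro sum.cong refl) auto
      also have "\<dots> = (\<Sum>u<b. w c * (A r u * M u x) - (A r u * M u c) * y x)"
        using r by (intro sum.cong refl) (simp add: X_def right_diff_distrib mult.assoc mult.left_commute)
      also have "\<dots> = w c * (\<Sum>u<b. A r u * M u x) - (\<Sum>u<b. A r u * M u c) * y x"
        by (simp add: sum_subtractf sum_distrib_left sum_distrib_right)
      finally show ?thesis using d(2) by (simp add: 0 M'_def)
    qed
    \<comment> \<open>If column 0 is the new pivot, row 0 becomes \<open>w\<close>, which then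
      vanishes off column 0. If it was a pivot before, row 0 of \<open>T\<close> vanishes at
      \<open>x\<close> and at \<open>c\<close>.\<close>
    show "T' 0 x = 0" if "0 \<in> insert c P" "x < b" "x \<noteq> 0" for x
    proof (cases "c = 0")
      case True
      then show ?thesis using that c T'[of 0 x] by simp
    next
      case False
      then have "T 0 x = 0" "T 0 c = 0" using that c T0 by auto
      then show ?thesis using that False T'[of 0 x] by simp
    qed
  qed (use d' c in auto)
qed

text \<open>\<open>d\<close> and the entries of \<open>adj B\<close> are minors, up to sign, of
  \<open>B\<close>, whose rows are relations or unit vectors. The factor 2 is for diagonal entries
  of \<open>T\<close>, where \<open>d\<close> and an adjugate entry are subtracted.\<close>

lemma bounds:
  assumes "\<And>r x. r < k \<Longrightarrow> x < b \<Longrightarrow> \<bar>A r x\<bar> \<le> m" "1 \<le> m"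
  shows "\<bar>d\<bar> \<le> fact b * m ^ b" "\<And>j x. j < b \<Longrightarrow> x < b \<Longrightarrow> \<bar>T j x\<bar> \<le> 2 * (fact b * m ^ b)"
proof -
  have B: "\<bar>B i j\<bar> \<le> m" if "i < b" "j < b" for i j
  proof (cases "i \<in> P")
    case True
    then show ?thesis using pivot_row[OF True] assms that by auto
  qed (use that assms unit_row in auto)
  show d': "\<bar>d\<bar> \<le> fact b * m ^ b" using mdet_bound[of b B m] B d by simp
  show "\<bar>T j x\<bar> \<le> 2 * (fact b * m ^ b)" if "j < b" "x < b" for j x
    using madj_bound[of b B m j x] that assms B d' unfolding T[OF that] by (auto split: if_splits)
qed

text \<open>Row 0 of \<open>T\<close> is \<open>d\<close> times the projection of the first unit
  vector. By \<open>T0\<close> and \<open>T_unit\<close> the vector is either fixed or sent to 0 by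
  \<open>T / d\<close>.\<close>

lemma row_0:
  assumes "0 < b" "x < b"
  shows "T 0 x = (if x = 0 \<and> 0 \<in> P then d else 0)"
  using assms T[of 0 x] T0[of x] T_unit[of 0 x] by (cases "0 \<in> P"; cases "x = 0") auto

text \<open>By \<open>dep\<close>, relations processed so far have no component along the unit rows,
  so \<open>T / d\<close> fixes them.\<close>

lemma projection:
  assumes "r < k" "x < b"
  shows "d * A r x = (\<Sum>j<b. A r j * T j x)"
  using residual[OF assms(2), of "A r"] dep[of r x] assms by (cases "x \<in> P") auto

end

lemma pivoted_init:
  assumes "\<And>j x. j < b \<Longrightarrow> x < b \<Longrightarrow> T j x = 0"
  shows "pivoted b A 0 T 1 {} (\<lambda>i j. if i = j then 1 else 0)"
  by unfold_locales (use assms in \<open>auto simp: mdet_one madj_one\<close>)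

section \<open>Triangular bases modulo a minor\<close>

text \<open>A module over the integers rather than a vector space: \<open>zvec.span\<close> is then
  the generated lattice, which sees divisibility.\<close>

interpretation zvec: Modules.module "\<lambda>(c :: int) (v :: nat \<Rightarrow> int) x. c * v x"
  by unfold_locales (auto simp: algebra_simps fun_eq_iff)

abbreviation unit_at :: "nat \<Rightarrow> nat \<Rightarrow> int" where
  "unit_at x \<equiv> (\<lambda>y. if y = x then 1 else 0)"

definition multiples :: "nat \<Rightarrow> int \<Rightarrow> (nat \<Rightarrow> int) set" where
  "multiples b d = (\<lambda>x y. d * unit_at x y) ` {..<b}"

definition lower_triangular :: "nat \<Rightarrow> (nat \<Rightarrow> nat \<Rightarrow> int) \<Rightarrow> bool" where
  "lower_triangular b H \<longleftrightarrow> (\<forall>i<b. H i i \<noteq> 0 \<and> (\<forall>y>i. H i y = 0))"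

lemma span_lower_triangular_zero:
  assumes "lower_triangular b H" "m \<le> b" "f \<in> zvec.span (H ` {..<m})" "m \<le> y"
  shows "f y = 0"
  using assms(3)
proof (induction rule: zvec.span_induct)
  case base
  then show ?case by (auto simp: zvec.subspace_def)
next
  case (step f)
  then show ?case using assms by (auto simp: lower_triangular_def)
qed

text \<open>The last row is the only one that reaches the last column, where its entry is nonzero.
  If the vector vanishes there, the coefficient of that row must be 0; repeat for the rows before
  it.\<close>

lemma span_lower_triangular:
  assumes "lower_triangular b H" "m \<le> b" "f \<in> zvec.span (H ` {..<m})" "\<And>y. x \<le> y \<Longrightarrow> f y = 0" "x \<le> m"
  shows "f \<in> zvec.span (H ` {..<x})"
  using assms(2,3,5)
proof (induction m)
  case (Suc m)
  show ?case
  proof (cases "x = Suc m")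
    case False
    have "f \<in> zvec.span (insert (H m) (H ` {..<m}))" using Suc.prems by (simp add: lessThan_Suc)
    then obtain c where c: "f - (\<lambda>x. c * H m x) \<in> zvec.span (H ` {..<m})"
      by (auto simp: zvec.span_insert)
    have "(f - (\<lambda>x. c * H m x)) m = 0" using Suc.prems by (intro span_lower_triangular_zero[OF assms(1) _ c]) auto
    moreover have "f m = 0" using assms(4) False Suc.prems by simp
    moreover have "H m m \<noteq> 0" using assms(1) Suc.prems by (auto simp: lower_triangular_def)
    ultimately have "c = 0" by simp
    then have "f \<in> zvec.span (H ` {..<m})" using c by (simp add: fun_diff_def)
    then show ?thesis using Suc False by simp
  qed (use Suc in simp)
qed simp

text \<open>
  \<open>v\<close> is what remains of the relation \<open>A r\<close> when the columns right of \<open>j\<close> have been eliminated. The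
  entries of \<open>v\<close> left of \<open>j\<close> may be reduced modulo \<open>d\<close> as the rows above \<open>j\<close> of \<open>H\<close> generate the
  multiples of \<open>d\<close> there.
\<close>

definition inserting ::
  "nat \<Rightarrow> int \<Rightarrow> (nat \<Rightarrow> nat \<Rightarrow> int) \<Rightarrow> nat \<Rightarrow> (nat \<Rightarrow> nat \<Rightarrow> int) \<Rightarrow> (nat \<Rightarrow> int) \<Rightarrow> nat \<Rightarrow> bool" where
  "inserting b d A r H v j \<longleftrightarrow> j < b \<and> lower_triangular b H \<and> (\<forall>x>j. v x = 0) \<and>
     (\<forall>x<j. (\<lambda>y. d * unit_at x y) \<in> zvec.span (H ` {..<Suc x})) \<and>
     zvec.span (insert v (H ` {..<b})) = zvec.span (A ` {..<Suc r} \<union> multiples b d)"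

definition inserted :: "nat \<Rightarrow> int \<Rightarrow> (nat \<Rightarrow> nat \<Rightarrow> int) \<Rightarrow> nat \<Rightarrow> (nat \<Rightarrow> nat \<Rightarrow> int) \<Rightarrow> bool" where
  "inserted b d A r H \<longleftrightarrow> lower_triangular b H \<and>
     zvec.span (H ` {..<b}) = zvec.span (A ` {..<r} \<union> multiples b d)"

lemma inserted_init:
  assumes "d \<noteq> 0" "\<And>j. j < b \<Longrightarrow> H j = (\<lambda>x. d * unit_at j x)"
  shows "inserted b d A 0 H"
proof -
  have "H ` {..<b} = multiples b d" unfolding multiples_def using assms(2) by (intro image_cong) auto
  then show ?thesis using assms by (auto simp: inserted_def lower_triangular_def)
qed

lemma span_insert_cong:
  assumes "zvec.span S = zvec.span S'"
  shows "zvec.span (insert v S) = zvec.span (insert v S')"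
  using assms by (simp add: zvec.span_insert)

text \<open>The vector \<open>d e_x\<close> lies in the span of \<open>H\<close> and vanishes right
  of \<open>x\<close>, so triangularity places it in the span of the rows up to \<open>x\<close>, as
  the invariant demands.\<close>

lemma inserted_start:
  assumes "inserted b d A r H" "0 < b" "\<And>x. b \<le> x \<Longrightarrow> A r x = 0"
  shows "inserting b d A r H (A r) (b - 1)"
proof -
  have lt: "lower_triangular b H" and sp: "zvec.span (H ` {..<b}) = zvec.span (A ` {..<r} \<union> multiples b d)"
    using assms by (auto simp: inserted_def)
  have "(\<lambda>y. d * unit_at x y) \<in> zvec.span (H ` {..<Suc x})" if "x < b" for x
  proof (rule span_lower_triangular[OF lt])
    show "(\<lambda>y. d * unit_at x y) \<in> zvec.span (H ` {..<b})"
      unfolding sp using that by (intro zvec.span_base) (auto simp: multiples_def)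
  qed (use that in auto)
  then show ?thesis using lt span_insert_cong[OF sp, of "A r"] assms
    by (auto simp: inserting_def lessThan_Suc)
qed

text \<open>The change from \<open>v\<close> to \<open>v'\<close> is a multiple of
  \<open>H j\<close> plus multiples of \<open>d e_x\<close> with \<open>x < j\<close>, all in the
  span of \<open>H\<close>. Column \<open>j\<close> is exempt from reduction modulo
  \<open>d\<close>, since the invariant supplies \<open>d e_x\<close> only for \<open>x < j\<close>;
  right of \<open>j\<close> both vectors vanish.\<close>

lemma inserting_reduce:
  assumes "inserting b d A r H v j"
    "\<And>x. x < b \<Longrightarrow> v' x = (if x = j then v x - q * H j x else (v x - q * H j x) mod d)"
    "\<And>x. b \<le> x \<Longrightarrow> v' x = 0"
  shows "inserting b d A r H v' j"
proof -
  have j: "j < b" and lt: "lower_triangular b H" and v: "\<And>x. x > j \<Longrightarrow> v x = 0"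
    and D: "\<And>x. x < j \<Longrightarrow> (\<lambda>y. d * unit_at x y) \<in> zvec.span (H ` {..<Suc x})"
    and sp: "zvec.span (insert v (H ` {..<b})) = zvec.span (A ` {..<Suc r} \<union> multiples b d)"
    using assms(1) by (auto simp: inserting_def)
  have H: "\<And>x. x > j \<Longrightarrow> H j x = 0" using lt j by (auto simp: lower_triangular_def)
  have v': "v' x = 0" if "x > j" for x
    using assms(2,3)[of x] that H v by (cases "x < b") auto
  define u where "u x = (v x - q * H j x) div d" for x
  have e: "v' - v = (\<lambda>y. - q * H j y) + (\<Sum>x<j. (\<lambda>y. - u x * (d * unit_at x y)))"
  proof
    fix y
    have "(\<Sum>x<j. (\<lambda>y. - u x * (d * unit_at x y))) y = (\<Sum>x<j. - u x * (d * unit_at x y))"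
      by (induction j) (auto simp: plus_fun_def zero_fun_def)
    also have "\<dots> = (\<Sum>x<j. if x = y then - u x * d else 0)"
      by (intro sum.cong) auto
    also have "\<dots> = (if y < j then - u y * d else 0)" by simp
    finally have s: "(\<Sum>x<j. (\<lambda>y. - u x * (d * unit_at x y))) y = (if y < j then - u y * d else 0)" .
    have "v' y - v y = - q * H j y + (if y < j then - u y * d else 0)"
    proof -
      consider "y < j" | "y = j" | "y > j" by linarith
      then show ?thesis
      proof cases
        case 1
        then have "v' y = (v y - q * H j y) mod d" using assms(2)[of y] j by simp
        also have "\<dots> = v y - q * H j y - u y * d" unfolding u_def by (simp add: minus_div_mult_eq_mod)
        finally show ?thesis using 1 by simp
      qed (use assms(2)[of y] j v' v H in auto)
    qed
    then show "(v' - v) y = ((\<lambda>y. - q * H j y) + (\<Sum>x<j. (\<lambda>y. - u x * (d * unit_at x y)))) y"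
      using s by simp
  qed
  have "(\<lambda>y. - q * H j y) \<in> zvec.span (H ` {..<b})"
    using j zvec.span_scale[OF zvec.span_base[of "H j" "H ` {..<b}"], of "- q"] by auto
  moreover have "(\<Sum>x<j. (\<lambda>y. - u x * (d * unit_at x y))) \<in> zvec.span (H ` {..<b})"
  proof (rule zvec.span_sum)
    fix x assume x: "x \<in> {..<j}"
    have "zvec.span (H ` {..<Suc x}) \<subseteq> zvec.span (H ` {..<b})"
      using x j by (intro zvec.span_mono) auto
    then have "(\<lambda>y. d * unit_at x y) \<in> zvec.span (H ` {..<b})" using D[of x] x by auto
    from zvec.span_scale[OF this, of "- u x"]
    show "(\<lambda>y. - u x * (d * unit_at x y)) \<in> zvec.span (H ` {..<b})" .
  qed
  ultimately have "v' - v \<in> zvec.span (H ` {..<b})" unfolding e by (rule zvec.span_add)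
  then have "zvec.span (insert v' (H ` {..<b})) = zvec.span (insert v (H ` {..<b}))"
    by (rule zvec.eq_span_insert_eq)
  then show ?thesis using j lt v' D sp by (simp add: inserting_def)
qed

text \<open>The set formed by \<open>v\<close> and the rows of \<open>H\<close> stays the same, and
  so do the rows before \<open>j\<close>, which generate the multiples of \<open>d\<close>.\<close>

lemma inserting_swap:
  assumes "inserting b d A r H v j" "v j \<noteq> 0"
  shows "inserting b d A r (H(j := v)) (H j) j"
proof -
  have j: "j < b" and lt: "lower_triangular b H" and v: "\<And>x. x > j \<Longrightarrow> v x = 0"
    using assms(1) by (auto simp: inserting_def)
  have "insert (H j) ((H(j := v)) ` {..<b}) = insert v (H ` {..<b})"
    using j by (auto simp: image_iff)
  moreover have "(H(j := v)) ` {..<Suc x} = H ` {..<Suc x}" if "x < j" for x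
    using that by (intro image_cong) auto
  ultimately show ?thesis using assms lt v by (auto simp: inserting_def lower_triangular_def)
qed

lemma inserting_down:
  assumes "inserting b d A r H v j" "v j = 0" "0 < j"
  shows "inserting b d A r H v (j - 1)"
proof -
  have "v x = 0" if "x > j - 1" for x
    using assms that by (cases "x = j") (auto simp: inserting_def)
  then show ?thesis using assms by (auto simp: inserting_def)
qed

lemma inserting_done:
  assumes "inserting b d A r H v 0" "v 0 = 0"
  shows "inserted b d A (Suc r) H"
proof -
  have "v = 0"
  proof
    show "v x = 0 x" for x using assms by (cases "x = 0") (auto simp: inserting_def)
  qed
  moreover have "zvec.span (insert 0 S) = zvec.span S" for S :: "(nat \<Rightarrow> int) set"
  proof -
    have "x - (\<lambda>_. 0) = x" for x :: "nat \<Rightarrow> int" by (simp add: fun_eq_iff)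
    then show ?thesis by (simp add: zvec.span_insert zvec.scale_zero_right)
  qed
  ultimately show ?thesis using assms by (auto simp: inserting_def inserted_def)
qed

text \<open>A vector supported in column 0 involves row 0 alone, and row 0 is itself supported
  there.\<close>

lemma inserted_final:
  assumes "inserted b d A r H" "0 < b"
  shows "(\<lambda>y. m * unit_at 0 y) \<in> zvec.span (A ` {..<r} \<union> multiples b d) \<longleftrightarrow> H 0 0 dvd m"
proof -
  have lt: "lower_triangular b H" and sp: "zvec.span (H ` {..<b}) = zvec.span (A ` {..<r} \<union> multiples b d)"
    using assms by (auto simp: inserted_def)
  have H0: "H 0 = (\<lambda>y. H 0 0 * unit_at 0 y)" using lt assms by (auto simp: lower_triangular_def)
  have 1: "(\<lambda>y. m * unit_at 0 y) \<in> zvec.span (H ` {..<b}) \<longleftrightarrow> (\<lambda>y. m * unit_at 0 y) \<in> zvec.span (H ` {..<Suc 0})"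
  proof
    show "(\<lambda>y. m * unit_at 0 y) \<in> zvec.span (H ` {..<Suc 0})" if "(\<lambda>y. m * unit_at 0 y) \<in> zvec.span (H ` {..<b})"
      using assms by (intro span_lower_triangular[OF lt order.refl that]) auto
    have "zvec.span (H ` {..<Suc 0}) \<subseteq> zvec.span (H ` {..<b})" using assms by (intro zvec.span_mono) auto
    then show "(\<lambda>y. m * unit_at 0 y) \<in> zvec.span (H ` {..<b})" if "(\<lambda>y. m * unit_at 0 y) \<in> zvec.span (H ` {..<Suc 0})"
      using that by blast
  qed
  have "zvec.span (H ` {..<Suc 0}) = range (\<lambda>k x. k * H 0 x)"
    by (simp add: lessThan_Suc zvec.span_singleton)
  then have "(\<lambda>y. m * unit_at 0 y) \<in> zvec.span (H ` {..<Suc 0}) \<longleftrightarrow> (\<exists>k. (\<lambda>y. m * unit_at 0 y) = (\<lambda>x. k * H 0 x))"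
    by auto
  also have "\<dots> \<longleftrightarrow> H 0 0 dvd m"
  proof
    assume "\<exists>k. (\<lambda>y. m * unit_at 0 y) = (\<lambda>x. k * H 0 x)"
    then obtain k where "(\<lambda>y. m * unit_at 0 y) = (\<lambda>x. k * H 0 x)" by blast
    from fun_cong[OF this, of 0] show "H 0 0 dvd m" by simp
  next
    assume "H 0 0 dvd m"
    then obtain k where "m = H 0 0 * k" by blast
    then show "\<exists>k. (\<lambda>y. m * unit_at 0 y) = (\<lambda>x. k * H 0 x)"
      by (intro exI[of _ k]) (subst H0, auto)
  qed
  finally show ?thesis using 1 sp by simp
qed

section \<open>Deciding which multiples of the first unit vector lie in the lattice\<close>

context pivoted begin

text \<open>\<open>\<tau> f\<close> is \<open>f T\<close>, the projection scaled by
  \<open>d\<close>. It multiplies \<open>L\<close> by \<open>d\<close> and maps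
  \<open>L + d \<int>\<^sup>b\<close> into \<open>d L\<close>, because \<open>d e_x\<close> goes to
  \<open>d\<close> times row \<open>x\<close> of \<open>T\<close>. As the first unit vector
  \<open>e_0\<close> goes to \<open>d e_0\<close> or 0, cancelling \<open>d\<close> settles
  membership.\<close>

lemma span_target:
  assumes b: "0 < b" and A: "\<And>r x. b \<le> x \<Longrightarrow> A r x = 0"
  shows "(\<lambda>y. m * unit_at 0 y) \<in> zvec.span (A ` {..<k}) \<longleftrightarrow>
    (if T 0 0 = 0 then m = 0 else (\<lambda>y. m * unit_at 0 y) \<in> zvec.span (A ` {..<k} \<union> multiples b d))"
proof -
  define \<tau> where "\<tau> f x = (if x < b then \<Sum>j<b. f j * T j x else 0)" for f :: "nat \<Rightarrow> int" and x
  have Tz: "(\<lambda>x. if x < b then T j x else 0) \<in> zvec.span (A ` {..<k})" if j: "j < b" for j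
  proof -
    have "(\<lambda>x. if x < b then T j x else 0) = (\<Sum>p\<in>P. (\<lambda>x. madj b B j p * (if x < b then B p x else 0)))"
    proof
      fix x
      have fin: "finite P" using P finite_subset by blast
      have "(\<Sum>p\<in>P. (\<lambda>x. madj b B j p * (if x < b then B p x else 0))) x = (\<Sum>p\<in>P. madj b B j p * (if x < b then B p x else 0))"
        using fin by (induction P) (auto simp: plus_fun_def zero_fun_def)
      then show "(if x < b then T j x else 0) = (\<Sum>p\<in>P. (\<lambda>x. madj b B j p * (if x < b then B p x else 0))) x"
        using T_combination[OF j, of x] by simp
    qed
    also have "\<dots> \<in> zvec.span (A ` {..<k})"
    proof (rule zvec.span_sum)
      fix p assume "p \<in> P"
      then obtain r where r: "r < k" "\<forall>x<b. B p x = A r x" using pivot_row by blast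
      then have "(\<lambda>x. if x < b then B p x else 0) = A r" using A by (auto simp: fun_eq_iff)
      then have "(\<lambda>x. if x < b then B p x else 0) \<in> zvec.span (A ` {..<k})" using r by (auto intro: zvec.span_base)
      from zvec.span_scale[OF this, of "madj b B j p"]
      show "(\<lambda>x. madj b B j p * (if x < b then B p x else 0)) \<in> zvec.span (A ` {..<k})" .
    qed
    finally show ?thesis .
  qed
  have \<tau>_zero: "\<tau> 0 = (\<lambda>x. d * 0 x)" by (auto simp: \<tau>_def)
  have \<tau>_add: "\<tau> (f + g) x = \<tau> f x + \<tau> g x" for f g x
    by (simp add: \<tau>_def distrib_right sum.distrib)
  have \<tau>_scale: "\<tau> (\<lambda>x. c * f x) x = c * \<tau> f x" for c f x
    by (simp add: \<tau>_def sum_distrib_left mult.assoc)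
  have A\<tau>: "\<tau> (A r) = (\<lambda>x. d * A r x)" if "r < k" for r
    using projection[OF that] A by (auto simp: \<tau>_def fun_eq_iff)
  have 1: "\<exists>g\<in>zvec.span (A ` {..<k}). \<tau> f = (\<lambda>x. d * g x)" if "f \<in> zvec.span (A ` {..<k} \<union> multiples b d)" for f
    using that
  proof (induction rule: zvec.span_induct)
    case base
    show ?case
    proof (rule zvec.subspaceI; unfold mem_Collect_eq)
      show "\<exists>g\<in>zvec.span (A ` {..<k}). \<tau> 0 = (\<lambda>x. d * g x)"
        by (intro bexI[of _ 0] zvec.span_zero \<tau>_zero)
      fix f f' :: "nat \<Rightarrow> int" and c :: int
      assume f: "\<exists>g\<in>zvec.span (A ` {..<k}). \<tau> f = (\<lambda>x. d * g x)"
      then obtain g where g: "g \<in> zvec.span (A ` {..<k})" "\<tau> f = (\<lambda>x. d * g x)" by blast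
      show "\<exists>g\<in>zvec.span (A ` {..<k}). \<tau> (\<lambda>x. c * f x) = (\<lambda>x. d * g x)"
        by (intro bexI[of _ "\<lambda>x. c * g x"] zvec.span_scale g ext) (simp add: \<tau>_scale g)
      assume "\<exists>g\<in>zvec.span (A ` {..<k}). \<tau> f' = (\<lambda>x. d * g x)"
      then obtain g' where g': "g' \<in> zvec.span (A ` {..<k})" "\<tau> f' = (\<lambda>x. d * g' x)" by blast
      show "\<exists>g\<in>zvec.span (A ` {..<k}). \<tau> (f + f') = (\<lambda>x. d * g x)"
        by (intro bexI[of _ "g + g'"] zvec.span_add g g' ext) (simp add: \<tau>_add g g' distrib_left)
    qed
  next
    case (step f)
    then consider r where "r < k" "f = A r" | x where "x < b" "f = (\<lambda>y. d * unit_at x y)"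
      unfolding multiples_def by blast
    then show ?case
    proof cases
      case 1
      then show ?thesis using A\<tau> by (intro bexI[of _ "A r"] zvec.span_base) auto
    next
      case 2
      have "\<tau> f y = d * (if y < b then T x y else 0)" for y
      proof -
        have "(\<Sum>j<b. d * unit_at x j * T j y) = (\<Sum>j<b. if j = x then d * T j y else 0)"
          by (intro sum.cong) auto
        then show ?thesis using 2 by (simp add: \<tau>_def)
      qed
      then show ?thesis using Tz[OF 2(1)] by (intro bexI[of _ "\<lambda>y. if y < b then T x y else 0"]) auto
    qed
  qed
  have \<tau>0: "\<tau> (\<lambda>y. m * unit_at 0 y) x = (if x = 0 then m * T 0 0 else 0)" for x
  proof -
    have "(\<Sum>j<b. m * unit_at 0 j * T j x) = (\<Sum>j<b. if j = 0 then m * T j x else 0)"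
      by (intro sum.cong) auto
    then show ?thesis using b row_0[OF b, of x] row_0[OF b b] by (auto simp: \<tau>_def)
  qed
  have 2: "\<tau> f = (\<lambda>x. d * f x)" if "f \<in> zvec.span (A ` {..<k})" for f
    using that
  proof (induction rule: zvec.span_induct)
    case base
    show ?case
    proof (rule zvec.subspaceI; unfold mem_Collect_eq)
      show "\<tau> 0 = (\<lambda>x. d * 0 x)" by (rule \<tau>_zero)
      fix f f' :: "nat \<Rightarrow> int" and c :: int
      assume f: "\<tau> f = (\<lambda>x. d * f x)"
      show "\<tau> (\<lambda>x. c * f x) = (\<lambda>x. d * (c * f x))" by (intro ext) (simp add: \<tau>_scale f)
      assume "\<tau> f' = (\<lambda>x. d * f' x)"
      then show "\<tau> (f + f') = (\<lambda>x. d * (f + f') x)" by (intro ext) (simp add: \<tau>_add f distrib_left)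
    qed
  next
    case (step f)
    then show ?case using A\<tau> by auto
  qed
  show ?thesis
  proof (cases "T 0 0 = 0")
    case True
    \<comment> \<open>On the lattice \<open>\<tau>\<close> is multiplication by \<open>d\<close>,
      while here it kills the first unit vector.\<close>
    have "m = 0" if "(\<lambda>y. m * unit_at 0 y) \<in> zvec.span (A ` {..<k})"
    proof -
      have "0 = d * m" using fun_cong[OF 2[OF that], of 0] \<tau>0[of 0] True by simp
      then show ?thesis using d by simp
    qed
    moreover have "(\<lambda>y. 0 * unit_at 0 y) \<in> zvec.span (A ` {..<k})"
      using zvec.span_zero[of "A ` {..<k}"] by (simp add: zero_fun_def)
    ultimately show ?thesis using True by auto
  next
    case False
    then have T00: "T 0 0 = d" using row_0[OF b b] by (auto split: if_splits)
    have "(\<lambda>y. m * unit_at 0 y) \<in> zvec.span (A ` {..<k})"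
      if m: "(\<lambda>y. m * unit_at 0 y) \<in> zvec.span (A ` {..<k} \<union> multiples b d)"
    proof -
      obtain g where g: "g \<in> zvec.span (A ` {..<k})" "\<tau> (\<lambda>y. m * unit_at 0 y) = (\<lambda>x. d * g x)"
        using 1[OF m] by blast
      have "g = (\<lambda>y. m * unit_at 0 y)"
      proof
        fix x
        have "d * g x = d * (m * unit_at 0 x)"
          using fun_cong[OF g(2), of x] \<tau>0[of x] T00 by (cases "x = 0") auto
        then show "g x = m * unit_at 0 x" using d(2) by (simp split: if_splits)
      qed
      then show ?thesis using g by simp
    qed
    moreover have "zvec.span (A ` {..<k}) \<subseteq> zvec.span (A ` {..<k} \<union> multiples b d)" by (intro zvec.span_mono) auto
    ultimately show ?thesis using False by auto
  qed
qed

text \<open>\<open>T 0 0 div d\<close> is 1 or 0 and replaces the case distinction: a generator 0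
  divides \<open>m\<close> only for \<open>m = 0\<close>.\<close>

lemma span_target_iff_dvd:
  assumes "0 < b" "\<And>r x. b \<le> x \<Longrightarrow> A r x = 0" "inserted b d A k H"
  shows "(\<lambda>y. m * unit_at 0 y) \<in> zvec.span (A ` {..<k}) \<longleftrightarrow> H 0 0 * (T 0 0 div d) dvd m"
  using span_target[OF assms(1,2), of m] inserted_final[OF assms(3,1), of m] row_0[OF assms(1,1)] d
  by (cases "0 \<in> P") auto

end

section \<open>The program\<close>

text \<open>
  The columns of the relations are rotated by \<open>i\<close> when they are read, so that column \<open>0\<close> belongs
  to the residue whose order is wanted. Matrices are stored by rows of length \<open>b\<close>.
\<close>

abbreviation (input) "aBuf \<equiv> 5 :: nat"
abbreviation (input) "aRel \<equiv> 6 :: nat"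
abbreviation (input) "aTab \<equiv> 7 :: nat"
abbreviation (input) "aDen \<equiv> 8 :: nat"
abbreviation (input) "aRes \<equiv> 9 :: nat"
abbreviation (input) "aTri \<equiv> 10 :: nat"
abbreviation (input) "aTotal \<equiv> 11 :: nat"
abbreviation (input) "aRow \<equiv> 12 :: nat"
abbreviation (input) "aCol \<equiv> 13 :: nat"
abbreviation (input) "aJ \<equiv> 14 :: nat"
abbreviation (input) "aPiv \<equiv> 15 :: nat"
abbreviation (input) "aTmp \<equiv> 16 :: nat"
abbreviation (input) "aQuo \<equiv> 17 :: nat"
abbreviation (input) "aRest \<equiv> 18 :: nat"
abbreviation (input) "aSwap \<equiv> 19 :: nat"

abbreviation position :: "nat \<Rightarrow> nat \<Rightarrow> expr" where
  "position j x \<equiv> Op Add (Op Mul (Var j) (Var 1)) (Var x)"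

abbreviation cell :: "nat \<Rightarrow> nat \<Rightarrow> nat \<Rightarrow> expr" where
  "cell y j x \<equiv> Entry y (position j x)"

definition read_program :: program where
  "read_program = For aRow aTotal
     (Seq (Query aBuf)
       (For aCol 1 (Assign aRel (position aRow aCol)
         (Entry aBuf (Op Rem (Op Add (Var aCol) (Var 3)) (Var 1))))))"

text \<open>The entry in the pivot column is saved in \<open>aTmp\<close> because the in-place pass
  overwrites it. The pivot row comes after the loop, which also runs over that row, and the old
  denominator is needed until the end.\<close>

definition pivot_program :: program where
  "pivot_program = Seq
     (For aJ 1
       (Seq (Set aTmp (cell aTab aJ aPiv))
         (For aCol 1 (Assign aTab (position aJ aCol)
           (Op Quo (Op Sub (Op Mul (Entry aRes (Var aPiv)) (cell aTab aJ aCol))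
             (Op Mul (Var aTmp) (Entry aRes (Var aCol)))) (Var aDen))))))
     (Seq (For aCol 1 (Assign aTab (position aPiv aCol) (Entry aRes (Var aCol))))
       (Set aDen (Entry aRes (Var aPiv))))"

definition residual_program :: program where
  "residual_program = Seq
     (For aCol 1 (Assign aRes (Var aCol) (Op Mul (Var aDen) (cell aRel aRow aCol))))
     (For aJ 1
       (For aCol 1 (Assign aRes (Var aCol)
         (Op Sub (Entry aRes (Var aCol)) (Op Mul (cell aRel aRow aJ) (cell aTab aJ aCol))))))"

text \<open>The last nonzero column is chosen, hence column \<open>0\<close> only if all others vanish.\<close>

definition search_program :: program where
  "search_program = Seq
     (Set aPiv (Var 1))
     (For aCol 1 (Cond (Op Mul (Entry aRes (Var aCol)) (Entry aRes (Var aCol)))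
       (Set aPiv (Var aCol)) Skip))"

definition eliminate_program :: program where
  "eliminate_program = Seq (Set aDen (Num 1))
     (For aRow aTotal
       (Seq residual_program
         (Seq search_program
           (Cond (Op Sub (Var 1) (Var aPiv)) pivot_program Skip))))"

definition diagonal_program :: program where
  "diagonal_program = For aJ 1 (Assign aTri (position aJ aJ) (Var aDen))"

definition swap_program :: program where
  "swap_program = Seq
     (For aCol 1 (Assign aSwap (Var aCol) (cell aRel aRow aCol)))
     (Seq (For aCol 1 (Assign aRel (position aRow aCol) (cell aTri aJ aCol)))
       (For aCol 1 (Assign aTri (position aJ aCol) (Entry aSwap (Var aCol)))))"

text \<open>\<open>(2 v + h) div (2 h)\<close> rounds \<open>v / h\<close> to a nearest integer. The
  remainder in column \<open>aJ\<close> is kept in \<open>aRest\<close> and restored afterwards,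
  since the pass reduces that column modulo \<open>aDen\<close> too; \<open>aRest\<close> then
  decides between swapping and advancing.\<close>

definition subtract_program :: program where
  "subtract_program = Seq
     (Set aQuo (Op Quo (Op Add (Op Mul (Num 2) (cell aRel aRow aJ)) (cell aTri aJ aJ))
       (Op Mul (Num 2) (cell aTri aJ aJ))))
     (Seq (Set aRest (Op Sub (cell aRel aRow aJ) (Op Mul (Var aQuo) (cell aTri aJ aJ))))
       (Seq (For aCol 1 (Assign aRel (position aRow aCol)
           (Op Rem (Op Sub (cell aRel aRow aCol) (Op Mul (Var aQuo) (cell aTri aJ aCol))) (Var aDen))))
         (Assign aRel (position aRow aJ) (Var aRest))))"

definition advance_program :: program where
  "advance_program = Cond (Var aJ) (Set aJ (Op Sub (Var aJ) (Num 1)))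
     (Seq (Set aJ (Op Sub (Var 1) (Num 1))) (Set aRow (Op Add (Var aRow) (Num 1))))"

text \<open>A single loop handles relations, columns and Euclidean steps together, so that one
  potential can count the swaps of all relations at once.\<close>

definition reduce_program :: program where
  "reduce_program = Seq (Set aRow (Num 0)) (Seq (Set aJ (Op Sub (Var 1) (Num 1)))
     (While (Op Sub (Var aTotal) (Var aRow))
       (Seq subtract_program
         (Cond (Op Mul (Var aRest) (Var aRest)) swap_program advance_program))))"

definition output_program :: program where
  "output_program = Seq
     (Set 0 (Op Mul (Var aTri) (Op Quo (Var aTab) (Var aDen))))
     (Cond (Var 0) Skip (Set 0 (Op Sub (Num 0) (Var 0))))"

definition period_program :: program where
  "period_program = Seq (Set aTotal (Op Add (Var 1) (Var 2)))
     (Seq read_program (Seq eliminate_program (Seq diagonal_program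
       (Seq reduce_program output_program))))"

section \<open>Subroutines for reading the relations and for elimination\<close>

lemma entry_matrix_at: "x < b \<Longrightarrow> s y (int j * int b + int x) = matrix_at s y b j x"
  by (simp add: matrix_at_def)

lemma entry_matrix_at_0: "x < b \<Longrightarrow> s y (int x) = matrix_at s y b 0 x"
  by (simp add: matrix_at_def)

lemma matrix_at_outside: "b \<le> x \<Longrightarrow> matrix_at s y b j x = 0"
  by (simp add: matrix_at_def)

lemma memory_boundedD: "memory_bounded l s \<Longrightarrow> \<bar>s x k\<bar> \<le> 2 ^ l"
  by (simp add: memory_bounded_def)

lemma matrix_at_bounded: "memory_bounded l s \<Longrightarrow> \<bar>matrix_at s y b j x\<bar> \<le> 2 ^ l"
  by (simp add: memory_bounded_def matrix_at_def)

lemma runs_read: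
  assumes "memory_bounded l s" "s 1 0 = int b" "s 3 0 = int i" "s aTotal 0 = int (length rs)"
    and rs: "\<And>r v. r \<in> set rs \<Longrightarrow> v \<in> set r \<Longrightarrow> \<bar>v\<bar> \<le> 2 ^ l" "\<And>r. r \<in> set rs \<Longrightarrow> length r = b"
    and "0 < b"
  shows "runs l read_program s rs ((6 * b + 8) * length rs + 3) (\<lambda>s' rs'. rs' = [] \<and>
    (\<forall>r<length rs. matrix_at s' aRel b r = (\<lambda>x. if x < b then rs ! r ! ((x + i) mod b) else 0)))"
proof -
  let ?F = "\<lambda>r x. rs ! r ! ((x + i) mod b)"
  let ?I = "\<lambda>k s' rs'. rs' = drop k rs \<and>
    (\<forall>r<k. matrix_at s' aRel b r = (\<lambda>x. if x < b then ?F r x else 0))"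
  have "runs l read_program s rs ((6 * b + 8) * length rs + 3) (?I (length rs))"
    unfolding read_program_def
  proof (rule runs_For[where I = ?I and N = "6 * b + 5"])
    fix k s' rs'
    assume k: "k < length rs" "?I k s' rs'" and s': "memory_bounded l s'" "s' aRow 0 = int k"
      and fr: "\<forall>y. y \<noteq> aRow \<and> y \<notin> arrays_written (Seq (Query aBuf) (For aCol 1 (Assign aRel (position aRow aCol)
         (Entry aBuf (Op Rem (Op Add (Var aCol) (Var 3)) (Var 1)))))) \<longrightarrow> s' y = s y"
    define r where "r = rs ! k"
    have r: "r \<in> set rs" "length r = b" using k rs(2) by (auto simp: r_def)
    have b: "s' 1 0 = int b" "s' 3 0 = int i" using fr assms by auto
    have 1: "runs l (Query aBuf) s' rs' (2 * b + 1) (\<lambda>s1 rs1. rs1 = drop (Suc k) rs \<and> (\<forall>z<b. s1 aBuf (int z) = r ! z))"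
    proof (rule runs_Query[OF s'(1), of _ r "drop (Suc k) rs"])
      show "rs' = r # drop (Suc k) rs" using k by (simp add: r_def Cons_nth_drop_Suc)
      have "int b \<le> 2 ^ l" using memory_boundedD[OF s'(1), of 1 0] b by simp
      then show "int (length r) \<le> 2 ^ l" using r by simp
    qed (use r rs in auto)
    show "runs l (Seq (Query aBuf) (For aCol 1 (Assign aRel (position aRow aCol)
         (Entry aBuf (Op Rem (Op Add (Var aCol) (Var 3)) (Var 1)))))) s' rs' (6 * b + 5) (?I (Suc k))"
    proof (rule runs_Seq[OF 1])
      fix s1 rs1
      assume s1: "memory_bounded l s1" "\<forall>y. y \<notin> arrays_written (Query aBuf) \<longrightarrow> s1 y = s' y"
        "rs1 = drop (Suc k) rs \<and> (\<forall>z<b. s1 aBuf (int z) = r ! z)"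
      have m: "matrix_at s1 aRel b = matrix_at s' aRel b" using s1(2) by (intro matrix_at_cong) simp
      show "runs l (For aCol 1 (Assign aRel (position aRow aCol)
         (Entry aBuf (Op Rem (Op Add (Var aCol) (Var 3)) (Var 1))))) s1 rs1 (4 * b + 3) (?I (Suc k))"
      proof (rule runs_conseq[OF runs_map[where f = "?F k" and j = k and b = b and N = "4 * b + 3"]])
        fix z s2
        assume z: "z < b" "memory_bounded l s2" "\<forall>y. y \<noteq> aCol \<and> y \<noteq> aRel \<longrightarrow> s2 y = s1 y" "s2 aCol 0 = int z"
        then have e: "s2 1 0 = int b" "s2 3 0 = int i" "s2 aRow 0 = int k" "s2 aBuf = s1 aBuf"
          using s1(2) b s' by auto
        have "(int z + int i) mod int b = int ((z + i) mod b)" by (simp add: zmod_int)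
        then have "s1 aBuf ((int z + int i) mod int b) = ?F k z" using s1(3) assms(7) by (simp add: r_def)
        moreover have "\<bar>?F k z\<bar> \<le> 2 ^ l" using rs(1)[OF r(1)] assms(7) r(2) by (auto simp: r_def)
        ultimately show "expr_value (position aRow aCol) s2 = int k * int b + int z \<and>
          expr_value (Entry aBuf (Op Rem (Op Add (Var aCol) (Var 3)) (Var 1))) s2 = ?F k z \<and> \<bar>?F k z\<bar> \<le> 2 ^ l"
          using e z by simp
      next
        fix s2 rs2
        assume "rs2 = rs1 \<and> matrix_at s2 aRel b = (matrix_at s1 aRel b)(k := \<lambda>z. if z < b then ?F k z else 0)"
        then show "?I (Suc k) s2 rs2" using m s1(3) k(2) by (auto simp: less_Suc_eq)
      qed (use s1 b in \<open>auto simp: simple_expr_def\<close>)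
    qed simp
  next
    show "?I k (store s' aRow 0 v) rs'" if "?I k s' rs'" for k s' rs' v
      using that matrix_at_cong[of "store s' aRow 0 v" aRel s' b] by simp
  qed (use assms in auto)
  then show ?thesis by (rule runs_conseq) auto
qed

text \<open>The bound is required for every partial sum \<open>m <= b\<close>, because the
  accumulator is written back to memory after each subtraction.\<close>

lemma runs_residual:
  assumes "memory_bounded l s" "s 1 0 = int b" "s aRow 0 = int k"
  defines "A \<equiv> matrix_at s aRel b k" and "T \<equiv> matrix_at s aTab b" and "d \<equiv> s aDen 0"
  assumes b: "\<And>m x. m \<le> b \<Longrightarrow> x < b \<Longrightarrow> \<bar>d * A x - (\<Sum>j<m. A j * T j x)\<bar> \<le> 2 ^ l"
  shows "runs l residual_program s rs (4 * b * b + 10 * b + 7) (\<lambda>s' rs'. rs' = rs \<and>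
    (\<forall>x<b. matrix_at s' aRes b 0 x = d * A x - (\<Sum>j<b. A j * T j x)))"
  unfolding residual_program_def
proof (rule runs_Seq[OF runs_map[where f = "\<lambda>x. d * A x" and j = 0 and b = b and N = "4 * b + 3"]])
  fix x s1
  assume x: "x < b" "\<forall>y. y \<noteq> aCol \<and> y \<noteq> aRes \<longrightarrow> s1 y = s y" "s1 aCol 0 = int x"
  then have e: "s1 1 0 = int b" "s1 aRow 0 = int k" "s1 aDen 0 = d" "s1 aRel = s aRel"
    using assms(2,3) by (auto simp: d_def)
  then show "expr_value (Var aCol) s1 = int 0 * int b + int x \<and>
     expr_value (Op Mul (Var aDen) (cell aRel aRow aCol)) s1 = d * A x \<and> \<bar>d * A x\<bar> \<le> 2 ^ l"
    using x b[of 0 x] by (simp add: A_def entry_matrix_at)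
next
  fix s1 rs1
  assume s1: "memory_bounded l s1"
    "\<forall>y. y \<notin> arrays_written (For aCol 1 (Assign aRes (Var aCol) (Op Mul (Var aDen) (cell aRel aRow aCol)))) \<longrightarrow> s1 y = s y"
    "rs1 = rs \<and> matrix_at s1 aRes b = (matrix_at s aRes b)(0 := \<lambda>z. if z < b then d * A z else 0)"
  have e1: "s1 1 0 = int b" "s1 aRow 0 = int k" "s1 aDen 0 = d" "s1 aRel = s aRel" "s1 aTab = s aTab"
    using s1(2) assms(2,3) by (auto simp: d_def)
  let ?f = "\<lambda>m x. d * A x - (\<Sum>j<m. A j * T j x)"
  let ?I = "\<lambda>m s' rs'. rs' = rs \<and> (\<forall>x<b. matrix_at s' aRes b 0 x = ?f m x)"
  show "runs l (For aJ 1 (For aCol 1 (Assign aRes (Var aCol)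
         (Op Sub (Entry aRes (Var aCol)) (Op Mul (cell aRel aRow aJ) (cell aTab aJ aCol)))))) s1 rs1
       ((4 * b + 6) * b + 3) (?I b)"
  proof (rule runs_For[where I = ?I and N = "4 * b + 3"])
    fix m s2 rs2
    assume m: "m < b" "?I m s2 rs2" "memory_bounded l s2" "s2 aJ 0 = int m"
      "\<forall>y. y \<noteq> aJ \<and> y \<notin> arrays_written (For aCol 1 (Assign aRes (Var aCol)
         (Op Sub (Entry aRes (Var aCol)) (Op Mul (cell aRel aRow aJ) (cell aTab aJ aCol))))) \<longrightarrow> s2 y = s1 y"
    have e2: "s2 1 0 = int b" "s2 aRow 0 = int k" "s2 aDen 0 = d" "s2 aRel = s aRel" "s2 aTab = s aTab"
      using m(5) e1 by auto
    show "runs l (For aCol 1 (Assign aRes (Var aCol)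
         (Op Sub (Entry aRes (Var aCol)) (Op Mul (cell aRel aRow aJ) (cell aTab aJ aCol))))) s2 rs2 (4 * b + 3) (?I (Suc m))"
    proof (rule runs_conseq[OF runs_map[where f = "?f (Suc m)" and j = 0 and b = b and N = "4 * b + 3"]])
      fix x s3
      assume x: "x < b" "\<forall>y. y \<noteq> aCol \<and> y \<noteq> aRes \<longrightarrow> s3 y = s2 y" "s3 aCol 0 = int x"
        "matrix_at s3 aRes b = (matrix_at s2 aRes b)(0 := \<lambda>z. if z < x then ?f (Suc m) z else matrix_at s2 aRes b 0 z)"
      have e3: "s3 1 0 = int b" "s3 aRow 0 = int k" "s3 aDen 0 = d" "s3 aRel = s aRel" "s3 aTab = s aTab" "s3 aJ 0 = int m"
        using x e2 m by auto
      have "s3 aRes (int x) = ?f m x" using x m(2) by (simp add: entry_matrix_at_0)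
      then show "expr_value (Var aCol) s3 = int 0 * int b + int x \<and>
        expr_value (Op Sub (Entry aRes (Var aCol)) (Op Mul (cell aRel aRow aJ) (cell aTab aJ aCol))) s3 = ?f (Suc m) x \<and>
        \<bar>?f (Suc m) x\<bar> \<le> 2 ^ l"
        using x e3 b[of "Suc m" x] m(1) by (simp add: A_def T_def entry_matrix_at)
    next
      fix s3 rs3
      assume "rs3 = rs2 \<and> matrix_at s3 aRes b = (matrix_at s2 aRes b)(0 := \<lambda>z. if z < b then ?f (Suc m) z else 0)"
      then show "?I (Suc m) s3 rs3" using m(2) by simp
    qed (use m e2 in \<open>auto simp: simple_expr_def\<close>)
  next
    show "?I m (store s' aJ 0 v) rs'" if "?I m s' rs'" for m s' rs' v
      using that matrix_at_cong[of "store s' aJ 0 v" aRes s' b] by simp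
  qed (use s1 e1 in auto)
qed (use assms in \<open>auto simp: simple_expr_def algebra_simps\<close>)

text \<open>The value \<open>b\<close>, which is not a column, signals a vanishing residual. Squares
  are tested because conditions only test positivity.\<close>

lemma runs_search:
  assumes "memory_bounded l s" "s 1 0 = int b"
  defines "w \<equiv> matrix_at s aRes b 0"
  shows "runs l search_program s rs (5 * b + 5) (\<lambda>s' rs'. rs' = rs \<and>
    (\<exists>c. s' aPiv 0 = int c \<and> (c = b \<and> (\<forall>x<b. w x = 0) \<or> c < b \<and> w c \<noteq> 0 \<and> (\<forall>x<b. c < x \<longrightarrow> w x = 0))))"
  unfolding search_program_def
proof (rule runs_Seq[where Np = 1 and Qp = "\<lambda>s' rs'. rs' = rs \<and> s' aPiv 0 = int b"])
  show "runs l (Set aPiv (Var 1)) s rs 1 (\<lambda>s' rs'. rs' = rs \<and> s' aPiv 0 = int b)"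
    using assms(1,2) memory_boundedD[OF assms(1), of 1 0]
    by (intro runs_Assign) (auto simp: simple_expr_def store_same)
next
  fix s1 rs1
  assume s1: "memory_bounded l s1" "\<forall>y. y \<notin> arrays_written (Set aPiv (Var 1)) \<longrightarrow> s1 y = s y"
    "rs1 = rs \<and> s1 aPiv 0 = int b"
  let ?I = "\<lambda>m s' rs'. rs' = rs \<and> (\<exists>c. s' aPiv 0 = int c \<and>
    (c = b \<and> (\<forall>x<m. w x = 0) \<or> c < b \<and> w c \<noteq> 0 \<and> (\<forall>x<m. c < x \<longrightarrow> w x = 0)))"
  show "runs l (For aCol 1 (Cond (Op Mul (Entry aRes (Var aCol)) (Entry aRes (Var aCol)))
       (Set aPiv (Var aCol)) Skip)) s1 rs1 (5 * b + 3) (?I b)"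
  proof (rule runs_For[where I = ?I and N = 2])
    fix m s2 rs2
    assume m: "m < b" "?I m s2 rs2" "memory_bounded l s2" "s2 aCol 0 = int m"
      "\<forall>y. y \<noteq> aCol \<and> y \<notin> arrays_written (Cond (Op Mul (Entry aRes (Var aCol)) (Entry aRes (Var aCol)))
       (Set aPiv (Var aCol)) Skip) \<longrightarrow> s2 y = s1 y"
    have "s2 aRes (int m) = w m" using m(1,5) s1(2) by (simp add: w_def matrix_at_def)
    then have v: "expr_value (Op Mul (Entry aRes (Var aCol)) (Entry aRes (Var aCol))) s2 = w m * w m"
      using m(4) by simp
    show "runs l (Cond (Op Mul (Entry aRes (Var aCol)) (Entry aRes (Var aCol)))
       (Set aPiv (Var aCol)) Skip) s2 rs2 2 (?I (Suc m))"
    proof (rule runs_Cond[where N' = 1])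
      assume "0 < expr_value (Op Mul (Entry aRes (Var aCol)) (Entry aRes (Var aCol))) s2"
      then have "w m \<noteq> 0" unfolding v by auto
      then have "?I (Suc m) (store s2 aPiv 0 (int m)) rs2"
        using m(1,2) by (intro conjI exI[of _ m]) (auto simp: store_same)
      then show "runs l (Set aPiv (Var aCol)) s2 rs2 1 (?I (Suc m))"
        using m(3,4) memory_boundedD[OF m(3), of aCol 0]
        by (intro runs_Assign) (auto simp: simple_expr_def)
    next
      assume "\<not> 0 < expr_value (Op Mul (Entry aRes (Var aCol)) (Entry aRes (Var aCol))) s2"
      then have "w m = 0" unfolding v by (metis not_square_less_zero linorder_neqE_linordered_idom mult_eq_0_iff)
      then have "?I (Suc m) s2 rs2" using m(2) by (auto simp: less_Suc_eq)
      then show "runs l Skip s2 rs2 1 (?I (Suc m))" using m(3) by (intro runs_Skip) auto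
    qed (use m in \<open>auto simp: simple_expr_def\<close>)
  qed (use s1 assms(2) in auto)
qed auto

lemma runs_pivot:
  fixes b :: nat
  assumes s: "memory_bounded l s" "s 1 0 = int b" "s aPiv 0 = int c" and c: "c < b"
  defines "T \<equiv> matrix_at s aTab b" and "w \<equiv> matrix_at s aRes b 0" and "d \<equiv> s aDen 0"
  assumes Tb: "\<And>j x. j < b \<Longrightarrow> x < b \<Longrightarrow> \<bar>(w c * T j x - T j c * w x) div d\<bar> \<le> 2 ^ l"
  shows "runs l pivot_program s rs (4 * b * b + 12 * b + 9) (\<lambda>s' rs'. rs' = rs \<and> s' aDen 0 = w c \<and>
    (\<forall>j<b. \<forall>x<b. matrix_at s' aTab b j x = (if j = c then w x else (w c * T j x - T j c * w x) div d)))"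
proof -
  let ?f = "\<lambda>j x. (w c * T j x - T j c * w x) div d"
  let ?I = "\<lambda>m s' rs'. rs' = rs \<and> (\<forall>j. \<forall>x<b. matrix_at s' aTab b j x = (if j < m then ?f j x else T j x))"
  let ?map = "For aCol 1 (Assign aTab (position aJ aCol)
           (Op Quo (Op Sub (Op Mul (Entry aRes (Var aPiv)) (cell aTab aJ aCol))
             (Op Mul (Var aTmp) (Entry aRes (Var aCol)))) (Var aDen)))"
  let ?p = "Seq (Set aTmp (cell aTab aJ aPiv)) ?map"
  have 1: "runs l (For aJ 1 ?p) s rs ((4 * b + 8) * b + 3) (?I b)"
  proof (rule runs_For[where I = ?I and N = "4 * b + 5"])
    fix m s1 rs1
    assume m: "m < b" "?I m s1 rs1" "memory_bounded l s1" "s1 aJ 0 = int m"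
      "\<forall>y. y \<noteq> aJ \<and> y \<notin> arrays_written ?p \<longrightarrow> s1 y = s y"
    have e1: "s1 1 0 = int b" "s1 aPiv 0 = int c" "s1 aRes = s aRes" "s1 aDen 0 = d"
      using m(5) s by (auto simp: d_def)
    have tmp: "expr_value (cell aTab aJ aPiv) s1 = T m c"
      using m(2,4) e1 c by (simp add: entry_matrix_at)
    have tmpb: "\<bar>T m c\<bar> \<le> 2 ^ l" unfolding T_def by (rule matrix_at_bounded[OF s(1)])
    show "runs l ?p s1 rs1 (4 * b + 5) (?I (Suc m))"
    proof (rule runs_Seq[where Np = 1 and Nq = "4 * b + 3" and Qp = "\<lambda>s' rs'. rs' = rs1 \<and> s' aTmp 0 = T m c"])
      show "runs l (Set aTmp (cell aTab aJ aPiv)) s1 rs1 1 (\<lambda>s' rs'. rs' = rs1 \<and> s' aTmp 0 = T m c)"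
        by (rule runs_Assign[OF m(3)], unfold tmp) (use tmpb in \<open>auto simp: simple_expr_def store_same\<close>)
    next
      fix s2 rs2
      assume s2: "memory_bounded l s2" "\<forall>y. y \<notin> arrays_written (Set aTmp (cell aTab aJ aPiv)) \<longrightarrow> s2 y = s1 y"
        "rs2 = rs1 \<and> s2 aTmp 0 = T m c"
      have e2: "s2 1 0 = int b" "s2 aPiv 0 = int c" "s2 aRes = s aRes" "s2 aDen 0 = d" "s2 aJ 0 = int m"
        using s2(2) e1 m(4) by auto
      have M2: "matrix_at s2 aTab b = matrix_at s1 aTab b" using s2(2) by (intro matrix_at_cong) simp
      show "runs l ?map s2 rs2 (4 * b + 3) (?I (Suc m))"
      proof (rule runs_conseq[OF runs_map[where f = "?f m" and j = m and b = b and N = "4 * b + 3"]])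
        fix x s3
        assume x: "x < b" "\<forall>y. y \<noteq> aCol \<and> y \<noteq> aTab \<longrightarrow> s3 y = s2 y" "s3 aCol 0 = int x"
          "matrix_at s3 aTab b = (matrix_at s2 aTab b)(m := \<lambda>z. if z < x then ?f m z else matrix_at s2 aTab b m z)"
        have e3: "s3 1 0 = int b" "s3 aPiv 0 = int c" "s3 aRes = s aRes" "s3 aDen 0 = d" "s3 aJ 0 = int m"
          "s3 aTmp 0 = T m c" using x(2) e2 s2(3) by auto
        have "matrix_at s3 aTab b m x = T m x" using x(1,4) M2 m(2) by simp
        then show "expr_value (position aJ aCol) s3 = int m * int b + int x \<and>
          expr_value (Op Quo (Op Sub (Op Mul (Entry aRes (Var aPiv)) (cell aTab aJ aCol))
             (Op Mul (Var aTmp) (Entry aRes (Var aCol)))) (Var aDen)) s3 = ?f m x \<and> \<bar>?f m x\<bar> \<le> 2 ^ l"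
          using x(1,3) e3 Tb[OF m(1) x(1)] c by (simp add: entry_matrix_at entry_matrix_at_0[of _ b] w_def)
      next
        fix s3 rs3
        assume "rs3 = rs2 \<and> matrix_at s3 aTab b = (matrix_at s2 aTab b)(m := \<lambda>z. if z < b then ?f m z else 0)"
        then show "?I (Suc m) s3 rs3" using m(2) s2(3) M2 by (auto simp: less_Suc_eq)
      qed (use s2(1) e2 in \<open>auto simp: simple_expr_def\<close>)
    qed simp
  next
    show "?I m (store s' aJ 0 v) rs'" if "?I m s' rs'" for m s' rs' v
      using that matrix_at_cong[of "store s' aJ 0 v" aTab s' b] by simp
  qed (use s in \<open>auto simp: T_def\<close>)
  let ?Q = "\<lambda>s' rs'. rs' = rs \<and> (\<forall>j<b. \<forall>x<b. matrix_at s' aTab b j x = (if j = c then w x else ?f j x))"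
  show ?thesis
    unfolding pivot_program_def
  proof (rule runs_Seq[OF 1])
    fix s1 rs1
    assume s1: "memory_bounded l s1" "\<forall>y. y \<notin> arrays_written (For aJ 1 ?p) \<longrightarrow> s1 y = s y" "?I b s1 rs1"
    have e1: "s1 1 0 = int b" "s1 aPiv 0 = int c" "s1 aRes = s aRes" using s1(2) s by auto
    have w: "s aRes (int x) = w x" if "x < b" for x using that by (simp add: w_def matrix_at_def)
    show "runs l (Seq (For aCol 1 (Assign aTab (position aPiv aCol) (Entry aRes (Var aCol))))
       (Set aDen (Entry aRes (Var aPiv)))) s1 rs1 (4 * b + 5) (\<lambda>s' rs'. rs' = rs \<and> s' aDen 0 = w c \<and>
    (\<forall>j<b. \<forall>x<b. matrix_at s' aTab b j x = (if j = c then w x else ?f j x)))"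
    proof (rule runs_Seq[OF runs_conseq[OF runs_map[where f = w and j = c and b = b and N = "4 * b + 3"], where Q' = ?Q and N' = "4 * b + 3"]])
      fix x s2
      assume "x < b" "\<forall>y. y \<noteq> aCol \<and> y \<noteq> aTab \<longrightarrow> s2 y = s1 y" "s2 aCol 0 = int x"
      then show "expr_value (position aPiv aCol) s2 = int c * int b + int x \<and>
        expr_value (Entry aRes (Var aCol)) s2 = w x \<and> \<bar>w x\<bar> \<le> 2 ^ l"
        using e1 w matrix_at_bounded[OF s(1)] by (simp add: w_def)
    next
      fix s2 rs2
      assume "rs2 = rs1 \<and> matrix_at s2 aTab b = (matrix_at s1 aTab b)(c := \<lambda>z. if z < b then w z else 0)"
      then show "?Q s2 rs2" using s1(3) by simp
    next
      fix s2 rs2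
      assume s2: "memory_bounded l s2" "?Q s2 rs2"
        "\<forall>y. y \<notin> arrays_written (For aCol 1 (Assign aTab (position aPiv aCol) (Entry aRes (Var aCol)))) \<longrightarrow> s2 y = s1 y"
      have e2: "expr_value (Entry aRes (Var aPiv)) s2 = w c" using s2(3) e1 w[OF c] by simp
      show "runs l (Set aDen (Entry aRes (Var aPiv))) s2 rs2 1 (\<lambda>s' rs'. rs' = rs \<and> s' aDen 0 = w c \<and>
          (\<forall>j<b. \<forall>x<b. matrix_at s' aTab b j x = (if j = c then w x else ?f j x)))"
        by (rule runs_Assign[OF s2(1)], unfold e2)
          (use s2(2) matrix_at_cong[of "store s2 aDen 0 (w c)" aTab s2 b] matrix_at_bounded[OF s(1)]
            in \<open>auto simp: simple_expr_def store_same w_def\<close>)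
    qed (use s1(1) e1 in \<open>auto simp: simple_expr_def\<close>)
  qed (simp add: algebra_simps)
qed

text \<open>\<open>b! M^b\<close> bounds the minors; one more factor \<open>M\<close> covers their
  products with a relation entry in the residual.\<close>

definition minor_bound :: "nat \<Rightarrow> int \<Rightarrow> int" where
  "minor_bound b M = fact b * M ^ Suc b"

text \<open>Of the factor \<open>3 + 2 b\<close>, the residual takes \<open>1 + 2 b\<close>: one
  product with \<open>d\<close> and up to \<open>b\<close> products with table entries, which are at
  most twice a minor. The constant 3 serves the Euclidean phase, where \<open>3 V <= 2 ^ l\<close>
  is asked.\<close>

lemma runs_eliminate_step:
  fixes b :: nat
  assumes s: "memory_bounded l s" "s 1 0 = int b" "s aRow 0 = int k" and k: "k < R"
    and A: "\<And>r x. r < R \<Longrightarrow> x < b \<Longrightarrow> \<bar>matrix_at s aRel b r x\<bar> \<le> M" and M: "1 \<le> M"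
    and l: "(3 + 2 * int b) * minor_bound b M \<le> 2 ^ l"
    and pv: "pivoted b (matrix_at s aRel b) k (matrix_at s aTab b) (s aDen 0) P B"
  shows "runs l (Seq residual_program
         (Seq search_program
           (Cond (Op Sub (Var 1) (Var aPiv)) pivot_program Skip))) s rs (8 * b * b + 27 * b + 24)
    (\<lambda>s' rs'. rs' = rs \<and> (\<exists>P B. pivoted b (matrix_at s aRel b) (Suc k) (matrix_at s' aTab b) (s' aDen 0) P B))"
proof -
  define A T d where "A = matrix_at s aRel b" and "T = matrix_at s aTab b" and "d = s aDen 0"
  define U where "U = fact b * M ^ b"
  interpret pivoted b A k T d P B using pv by (simp add: A_def T_def d_def)
  have A': "\<bar>A r x\<bar> \<le> M" if "r < R" "x < b" for r x using that A by (simp add: A_def)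
  have U: "1 \<le> U" unfolding U_def using mult_mono[of 1 "fact b :: int" 1 "M ^ b"] M by (simp add: one_le_power fact_ge_1)
  have V: "minor_bound b M = U * M" by (simp add: minor_bound_def U_def mult.assoc mult.commute)
  have l': "(3 + 2 * int b) * (U * M) \<le> 2 ^ l" using l by (simp only: V)
  have UM: "U \<le> U * M" using U M mult_left_mono[of 1 M U] by simp
  have d_le: "\<bar>d\<bar> \<le> U" and T_le: "\<And>j x. j < b \<Longrightarrow> x < b \<Longrightarrow> \<bar>T j x\<bar> \<le> 2 * U"
    using bounds[of M] A' k M by (auto simp: U_def)
  define w where "w x = d * A k x - (\<Sum>j<b. A k j * T j x)" for x
  have res: "\<bar>d * A k x - (\<Sum>j<m. A k j * T j x)\<bar> \<le> 2 ^ l" if "m \<le> b" "x < b" for m x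
  proof -
    have "\<bar>\<Sum>j<m. A k j * T j x\<bar> \<le> (\<Sum>j<m. \<bar>A k j * T j x\<bar>)" by (rule sum_abs)
    also have "\<dots> \<le> (\<Sum>j<m. M * (2 * U))"
      using that A'[OF k] T_le M by (intro sum_mono) (auto simp: abs_mult intro!: mult_mono)
    also have "\<dots> = int m * (M * (2 * U))" by simp
    also have "\<dots> \<le> int b * (M * (2 * U))" using that U M by (intro mult_right_mono) auto
    finally have 1: "\<bar>\<Sum>j<m. A k j * T j x\<bar> \<le> int b * (M * (2 * U))" .
    have 2: "\<bar>d * A k x\<bar> \<le> U * M" using that A'[OF k] d_le U by (auto simp: abs_mult intro!: mult_mono)
    have "\<bar>d * A k x - (\<Sum>j<m. A k j * T j x)\<bar> \<le> U * M + int b * (M * (2 * U))" using 1 2 by linarith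
    also have "\<dots> \<le> (3 + 2 * int b) * (U * M)" using UM U by (simp add: algebra_simps)
    finally show ?thesis using l' by linarith
  qed
  have 1: "runs l residual_program s rs (4 * b * b + 10 * b + 7) (\<lambda>s' rs'. rs' = rs \<and>
      (\<forall>x<b. matrix_at s' aRes b 0 x = w x))"
    using runs_residual[OF s] res unfolding A_def T_def d_def w_def by blast
  show ?thesis
  proof (rule runs_Seq[OF 1])
    fix s1 rs1
    assume s1: "memory_bounded l s1" "\<forall>y. y \<notin> arrays_written residual_program \<longrightarrow> s1 y = s y"
      "rs1 = rs \<and> (\<forall>x<b. matrix_at s1 aRes b 0 x = w x)"
    have e1: "s1 1 0 = int b" "s1 aDen 0 = d" "s1 aTab = s aTab"
      using s1(2) s by (auto simp: residual_program_def d_def)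
    have 2: "runs l search_program s1 rs1 (5 * b + 5) (\<lambda>s' rs'. rs' = rs1 \<and>
      (\<exists>c. s' aPiv 0 = int c \<and> (c = b \<and> (\<forall>x<b. matrix_at s1 aRes b 0 x = 0) \<or>
         c < b \<and> matrix_at s1 aRes b 0 c \<noteq> 0 \<and> (\<forall>x<b. c < x \<longrightarrow> matrix_at s1 aRes b 0 x = 0))))"
      by (rule runs_search[OF s1(1) e1(1)])
    show "runs l (Seq search_program (Cond (Op Sub (Var 1) (Var aPiv)) pivot_program Skip)) s1 rs1 (4 * b * b + 17 * b + 16)
      (\<lambda>s' rs'. rs' = rs \<and> (\<exists>P B. pivoted b (matrix_at s aRel b) (Suc k) (matrix_at s' aTab b) (s' aDen 0) P B))"
    proof (rule runs_Seq[OF 2])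
      fix s2 rs2
      assume s2: "memory_bounded l s2" "\<forall>y. y \<notin> arrays_written search_program \<longrightarrow> s2 y = s1 y"
        "rs2 = rs1 \<and> (\<exists>c. s2 aPiv 0 = int c \<and> (c = b \<and> (\<forall>x<b. matrix_at s1 aRes b 0 x = 0) \<or>
         c < b \<and> matrix_at s1 aRes b 0 c \<noteq> 0 \<and> (\<forall>x<b. c < x \<longrightarrow> matrix_at s1 aRes b 0 x = 0)))"
      have e2: "s2 1 0 = int b" "s2 aDen 0 = d" "s2 aTab = s aTab" "s2 aRes = s1 aRes"
        using s2(2) e1 by (auto simp: search_program_def)
      have T2: "matrix_at s2 aTab b = T" unfolding T_def using e2(3) by (rule matrix_at_cong)
      have w2: "matrix_at s2 aRes b 0 x = w x" if "x < b" for x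
        using matrix_at_cong[of s2 aRes s1 b, OF e2(4)] s1(3) that by simp
      obtain c where c: "s2 aPiv 0 = int c" "c = b \<and> (\<forall>x<b. w x = 0) \<or>
         c < b \<and> w c \<noteq> 0 \<and> (\<forall>x<b. c < x \<longrightarrow> w x = 0)"
        using s2(3) s1(3) by auto
      show "runs l (Cond (Op Sub (Var 1) (Var aPiv)) pivot_program Skip) s2 rs2 (4 * b * b + 12 * b + 10)
        (\<lambda>s' rs'. rs' = rs \<and> (\<exists>P B. pivoted b (matrix_at s aRel b) (Suc k) (matrix_at s' aTab b) (s' aDen 0) P B))"
      proof (rule runs_Cond[OF s2(1), where N' = "4 * b * b + 12 * b + 9"])
        assume "0 < expr_value (Op Sub (Var 1) (Var aPiv)) s2"
        then have cb: "c < b" "w c \<noteq> 0" "\<forall>x<b. c < x \<longrightarrow> w x = 0" using c e2 by auto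
        have piv: "pivoted b A (Suc k) T' (w c) (insert c P) (B(c := A k))"
          if "\<And>j x. j < b \<Longrightarrow> x < b \<Longrightarrow> T' j x = (if j = c then w x else (w c * T j x - T j c * w x) div d)" for T'
          using cb that by (intro pivot) (auto simp: w_def)
        have cP: "c \<notin> P" using residual[OF cb(1), of "A k"] cb(2) by (auto simp: w_def)
        let ?T' = "\<lambda>j x. if j = c then w x else (w c * T j x - T j c * w x) div d"
        \<comment> \<open>The new entries are bounded through the state after the step, where they
          are minors again. A bound computed from the old entries would let the length grow from
          pivot to pivot.\<close>
        interpret next_state: pivoted b A "Suc k" ?T' "w c" "insert c P" "B(c := A k)"
          by (rule piv) auto
        have Tb: "\<bar>(w c * T j x - T j c * w x) div d\<bar> \<le> 2 ^ l" if "j < b" "x < b" for j x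
        \<comment> \<open>The loop also passes over row \<open>c\<close>. There the old table is
          zero, hence so is the quotient, and the final row is written later.\<close>
        proof (cases "j = c")
          case True
          then show ?thesis using T_unit[OF cb(1) cP] that cb by simp
        next
          case False
          then have "\<bar>(w c * T j x - T j c * w x) div d\<bar> \<le> 2 * U"
            using next_state.bounds(2)[of M j x] that A' k M by (simp add: U_def)
          also have "\<dots> \<le> 2 * (U * M)" using UM by simp
          also have "\<dots> \<le> (3 + 2 * int b) * (U * M)" using U M by (intro mult_right_mono) auto
          finally show ?thesis using l' by linarith
        qed
        have "runs l pivot_program s2 rs2 (4 * b * b + 12 * b + 9) (\<lambda>s' rs'. rs' = rs2 \<and> s' aDen 0 = w c \<and>
          (\<forall>j<b. \<forall>x<b. matrix_at s' aTab b j x = (if j = c then w x else (w c * T j x - T j c * w x) div d)))"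
          using Tb w2 cb(1) unfolding T2[symmetric] e2(2)[symmetric]
          by (intro runs_conseq[OF runs_pivot[OF s2(1) e2(1) c(1) cb(1), of rs2] _ order.refl]) auto
        then show "runs l pivot_program s2 rs2 (4 * b * b + 12 * b + 9)
          (\<lambda>s' rs'. rs' = rs \<and> (\<exists>P B. pivoted b (matrix_at s aRel b) (Suc k) (matrix_at s' aTab b) (s' aDen 0) P B))"
        proof (rule runs_conseq[OF _ _ order.refl])
          fix s' rs'
          assume 3: "rs' = rs2 \<and> s' aDen 0 = w c \<and>
            (\<forall>j<b. \<forall>x<b. matrix_at s' aTab b j x = (if j = c then w x else (w c * T j x - T j c * w x) div d))"
          then have "pivoted b A (Suc k) (matrix_at s' aTab b) (w c) (insert c P) (B(c := A k))"
            by (intro piv) blast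
          then show "rs' = rs \<and> (\<exists>P B. pivoted b (matrix_at s aRel b) (Suc k) (matrix_at s' aTab b) (s' aDen 0) P B)"
            using 3 s2(3) s1(3) unfolding A_def[symmetric] by auto
        qed
      next
        assume "\<not> 0 < expr_value (Op Sub (Var 1) (Var aPiv)) s2"
        then have "\<forall>x<b. w x = 0" using c e2 by auto
        then have "pivoted b A (Suc k) T d P B" by (intro skip) (auto simp: w_def)
        then have "pivoted b (matrix_at s aRel b) (Suc k) (matrix_at s2 aTab b) (s2 aDen 0) P B"
          by (simp add: A_def T2 e2(2))
        then show "runs l Skip s2 rs2 (4 * b * b + 12 * b + 9)
          (\<lambda>s' rs'. rs' = rs \<and> (\<exists>P B. pivoted b (matrix_at s aRel b) (Suc k) (matrix_at s' aTab b) (s' aDen 0) P B))"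
          using s2(1,3) s1(3) by (intro runs_Skip) auto
      qed (auto simp: simple_expr_def)
    qed simp
  qed simp
qed

lemma runs_eliminate:
  fixes b :: nat
  assumes s: "memory_bounded l s" "s 1 0 = int b" "s aTotal 0 = int R"
    and A: "\<And>r x. r < R \<Longrightarrow> x < b \<Longrightarrow> \<bar>matrix_at s aRel b r x\<bar> \<le> M" and M: "1 \<le> M"
    and l: "(3 + 2 * int b) * minor_bound b M \<le> 2 ^ l"
    and T: "\<And>j x. matrix_at s aTab b j x = 0"
  shows "runs l eliminate_program s rs ((8 * b * b + 27 * b + 27) * R + 5)
    (\<lambda>s' rs'. rs' = rs \<and> (\<exists>P B. pivoted b (matrix_at s aRel b) R (matrix_at s' aTab b) (s' aDen 0) P B))"
  unfolding eliminate_program_def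
proof (rule runs_Seq[where Np = 1 and Qp = "\<lambda>s' rs'. rs' = rs \<and> s' aDen 0 = 1"])
  show "runs l (Set aDen (Num 1)) s rs 1 (\<lambda>s' rs'. rs' = rs \<and> s' aDen 0 = 1)"
    using s(1) by (intro runs_Assign) (auto simp: simple_expr_def store_same)
next
  fix s1 rs1
  assume s1: "memory_bounded l s1" "\<forall>y. y \<notin> arrays_written (Set aDen (Num 1)) \<longrightarrow> s1 y = s y"
    "rs1 = rs \<and> s1 aDen 0 = 1"
  define A where "A = matrix_at s aRel b"
  let ?I = "\<lambda>k s' rs'. rs' = rs \<and> (\<exists>P B. pivoted b A k (matrix_at s' aTab b) (s' aDen 0) P B)"
  let ?p = "Seq residual_program (Seq search_program
           (Cond (Op Sub (Var 1) (Var aPiv)) pivot_program Skip))"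
  show "runs l (For aRow aTotal ?p) s1 rs1 ((8 * b * b + 27 * b + 27) * R + 3)
    (\<lambda>s' rs'. rs' = rs \<and> (\<exists>P B. pivoted b (matrix_at s aRel b) R (matrix_at s' aTab b) (s' aDen 0) P B))"
    unfolding A_def[symmetric]
  proof (rule runs_For[where I = ?I and N = "8 * b * b + 27 * b + 24"])
    fix k s2 rs2
    assume k: "k < R" "?I k s2 rs2" "memory_bounded l s2" "s2 aRow 0 = int k"
      "\<forall>y. y \<noteq> aRow \<and> y \<notin> arrays_written ?p \<longrightarrow> s2 y = s1 y"
    have e2: "s2 1 0 = int b" "s2 aRel = s aRel"
      using k(5) s1(2) s by (auto simp: residual_program_def search_program_def pivot_program_def)
    have A2: "matrix_at s2 aRel b = A" unfolding A_def using e2(2) by (rule matrix_at_cong)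
    obtain P B where "pivoted b A k (matrix_at s2 aTab b) (s2 aDen 0) P B" using k(2) by blast
    then have "runs l ?p s2 rs2 (8 * b * b + 27 * b + 24)
      (\<lambda>s' rs'. rs' = rs2 \<and> (\<exists>P B. pivoted b (matrix_at s2 aRel b) (Suc k) (matrix_at s' aTab b) (s' aDen 0) P B))"
      using A M l unfolding A2[symmetric]
      by (intro runs_eliminate_step[OF k(3) e2(1) k(4,1)]) (auto simp: A2 A_def)
    then show "runs l ?p s2 rs2 (8 * b * b + 27 * b + 24) (?I (Suc k))"
      using k(2) unfolding A2 by simp
  next
    show "?I k (store s' aRow 0 v) rs'" if "?I k s' rs'" for k s' rs' v
      using that matrix_at_cong[of "store s' aRow 0 v" aTab s' b] by simp
    have "matrix_at s1 aTab b = matrix_at s aTab b" using s1(2) by (intro matrix_at_cong) simp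
    then have "pivoted b A 0 (matrix_at s1 aTab b) 1 {} (\<lambda>i j. if i = j then 1 else 0)"
      using T by (intro pivoted_init) simp
    then show "?I 0 s1 rs1" using s1(3) by auto
  qed (use s1 s in \<open>auto simp: residual_program_def search_program_def pivot_program_def\<close>)
qed simp

section \<open>Subroutines for the triangular basis, with amortised counting of swaps\<close>

lemma runs_diagonal:
  fixes b :: nat
  assumes s: "memory_bounded l s" "s 1 0 = int b" and z: "\<And>j x. matrix_at s aTri b j x = 0"
  shows "runs l diagonal_program s rs (4 * b + 3)
    (\<lambda>s' rs'. rs' = rs \<and> (\<forall>j<b. matrix_at s' aTri b j = (\<lambda>x. s aDen 0 * unit_at j x)))"
proof -
  let ?d = "s aDen 0" and ?p = "Assign aTri (position aJ aJ) (Var aDen)"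
  let ?I = "\<lambda>m s' rs'. rs' = rs \<and>
    (\<forall>j. matrix_at s' aTri b j = (\<lambda>x. if j < m then ?d * unit_at j x else 0))"
  have "runs l diagonal_program s rs (4 * b + 3) (?I b)"
    unfolding diagonal_program_def
  proof (rule runs_For[where I = ?I and N = 1])
    fix m s1 rs1
    assume m: "m < b" "?I m s1 rs1" "memory_bounded l s1" "s1 aJ 0 = int m"
      "\<forall>y. y \<noteq> aJ \<and> y \<notin> arrays_written ?p \<longrightarrow> s1 y = s y"
    have e: "expr_value (position aJ aJ) s1 = int m * int b + int m" "expr_value (Var aDen) s1 = ?d"
      using m(4,5) s by auto
    show "runs l ?p s1 rs1 1 (?I (Suc m))"
    proof (rule runs_Assign[OF m(3)], unfold e)
      have "matrix_at (store s1 aTri (int m * int b + int m) ?d) aTri b =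
        (matrix_at s1 aTri b)(m := (matrix_at s1 aTri b m)(m := ?d))"
        using m(1) by (intro matrix_at_upd) (simp_all add: store_same)
      then show "?I (Suc m) (store s1 aTri (int m * int b + int m) ?d) rs1"
        using m(2) by (auto simp: fun_eq_iff)
    qed (use memory_boundedD[OF s(1)] in \<open>auto simp: simple_expr_def\<close>)
  next
    show "?I m (store s' aJ 0 v) rs'" if "?I m s' rs'" for m s' rs' v
      using that matrix_at_cong[of "store s' aJ 0 v" aTri s' b] by simp
  qed (use s z in \<open>auto simp: fun_eq_iff\<close>)
  then show ?thesis by (rule runs_conseq) auto
qed

text \<open>Twice the new remainder is \<open>m - h\<close>, where \<open>m\<close> is the remainder
  modulo \<open>2 h\<close>. As \<open>m\<close> has the sign of \<open>h\<close> and lies between 0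
  and \<open>2 h\<close>, the difference is at most \<open>h\<close> in absolute value.\<close>

lemma abs_nearest_quotient:
  fixes v h :: int
  assumes "h \<noteq> 0"
  shows "2 * \<bar>v - ((2 * v + h) div (2 * h)) * h\<bar> \<le> \<bar>h\<bar>"
proof -
  define q where "q = (2 * v + h) div (2 * h)"
  define m where "m = (2 * v + h) mod (2 * h)"
  have "2 * h * q + m = 2 * v + h" unfolding q_def m_def by (rule mult_div_mod_eq)
  then have 1: "2 * (v - q * h) = m - h" by (simp add: algebra_simps)
  have "\<bar>m - h\<bar> \<le> \<bar>h\<bar>"
  proof (cases "0 < h")
    case True
    then have "0 \<le> m" "m < 2 * h" by (simp_all add: m_def)
    then show ?thesis by linarith
  next
    case False
    then have "m \<le> 0" "2 * h < m" using assms by (simp_all add: m_def)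
    then show ?thesis by linarith
  qed
  then show ?thesis using 1 unfolding q_def[symmetric] by linarith
qed

text \<open>\<open>3 V\<close> bounds the numerator \<open>2 v + h\<close> and with it the quotient,
  which has to be stored.\<close>

lemma runs_subtract:
  fixes b :: nat
  assumes s: "memory_bounded l s" "s 1 0 = int b" "s aRow 0 = int r" "s aJ 0 = int j" and j: "j < b"
  defines "v \<equiv> matrix_at s aRel b r" and "h \<equiv> matrix_at s aTri b j" and "d \<equiv> s aDen 0"
  defines "q \<equiv> (2 * v j + h j) div (2 * h j)"
  assumes hd: "h j \<noteq> 0" "d \<noteq> 0" and V: "\<bar>v j\<bar> \<le> V" "\<bar>h j\<bar> \<le> V" "3 * V \<le> 2 ^ l"
  shows "runs l subtract_program s rs (4 * b + 9) (\<lambda>s' rs'. rs' = rs \<and> s' aRest 0 = v j - q * h j \<and>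
    matrix_at s' aRel b = (matrix_at s aRel b)(r := \<lambda>x. if x < b then
      if x = j then v j - q * h j else (v x - q * h x) mod d else 0))"
proof -
  have V0: "V \<le> 2 ^ l" using V by linarith
  have half: "2 * a \<le> c \<Longrightarrow> c \<le> V \<Longrightarrow> V \<le> 2 ^ l \<Longrightarrow> 0 \<le> a \<Longrightarrow> a \<le> 2 ^ l" for a c :: int by linarith
  have "2 * \<bar>v j - q * h j\<bar> \<le> \<bar>h j\<bar>"
    unfolding q_def by (rule abs_nearest_quotient[OF hd(1)])
  then have rest_le: "\<bar>v j - q * h j\<bar> \<le> 2 ^ l"
    using V(2) V0 half[of "\<bar>v j - q * h j\<bar>" "\<bar>h j\<bar>"] by simp
  have "\<bar>2 * v j + h j\<bar> \<le> 2 ^ l" using V by linarith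
  then have q_le: "\<bar>q\<bar> \<le> 2 ^ l"
    using abs_div_le[of "2 * v j + h j" "2 * h j"] unfolding q_def by (rule order_trans[rotated])
  have d_le: "\<bar>d\<bar> \<le> 2 ^ l" unfolding d_def by (rule memory_boundedD[OF s(1)])
  let ?q = "Op Quo (Op Add (Op Mul (Num 2) (cell aRel aRow aJ)) (cell aTri aJ aJ))
       (Op Mul (Num 2) (cell aTri aJ aJ))"
  let ?y = "Op Sub (cell aRel aRow aJ) (Op Mul (Var aQuo) (cell aTri aJ aJ))"
  let ?map = "For aCol 1 (Assign aRel (position aRow aCol)
           (Op Rem (Op Sub (cell aRel aRow aCol) (Op Mul (Var aQuo) (cell aTri aJ aCol))) (Var aDen)))"
  let ?f = "\<lambda>x. (v x - q * h x) mod d"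
  let ?Q = "\<lambda>s' rs'. rs' = rs \<and> s' aRest 0 = v j - q * h j \<and>
    matrix_at s' aRel b = (matrix_at s aRel b)(r := \<lambda>x. if x < b then
      if x = j then v j - q * h j else ?f x else 0)"
  have vq: "expr_value ?q s = q"
    using s j by (simp add: entry_matrix_at q_def v_def h_def)
  have 1: "runs l (Set aQuo ?q) s rs 1 (\<lambda>s' rs'. rs' = rs \<and> s' aQuo 0 = q)"
    by (rule runs_Assign[OF s(1)], unfold vq) (use q_le in \<open>auto simp: simple_expr_def store_same\<close>)
  show ?thesis unfolding subtract_program_def
  proof (rule runs_Seq[OF 1])
    fix s1 rs1
    assume s1: "memory_bounded l s1" "\<forall>y. y \<notin> arrays_written (Set aQuo ?q) \<longrightarrow> s1 y = s y" "rs1 = rs \<and> s1 aQuo 0 = q"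
    have e1: "s1 1 0 = int b" "s1 aRow 0 = int r" "s1 aJ 0 = int j" "s1 aRel = s aRel" "s1 aTri = s aTri" "s1 aDen 0 = d"
      using s1(2) s by (auto simp: d_def)
    have vy: "expr_value ?y s1 = v j - q * h j"
      using s1(3) e1 j by (simp add: entry_matrix_at v_def h_def)
    have 2: "runs l (Set aRest ?y) s1 rs1 1 (\<lambda>s' rs'. rs' = rs \<and> s' aRest 0 = v j - q * h j)"
      by (rule runs_Assign[OF s1(1)], unfold vy) (use rest_le s1(3) in \<open>auto simp: simple_expr_def store_same\<close>)
    show "runs l (Seq (Set aRest ?y) (Seq ?map (Assign aRel (position aRow aJ) (Var aRest)))) s1 rs1 (4 * b + 7) ?Q"
    proof (rule runs_Seq[OF 2])
      fix s2 rs2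
      assume s2: "memory_bounded l s2" "\<forall>y. y \<notin> arrays_written (Set aRest ?y) \<longrightarrow> s2 y = s1 y"
        "rs2 = rs \<and> s2 aRest 0 = v j - q * h j"
      have e2: "s2 1 0 = int b" "s2 aRow 0 = int r" "s2 aJ 0 = int j" "s2 aRel = s aRel" "s2 aTri = s aTri" "s2 aDen 0 = d"
        "s2 aQuo 0 = q"
        using s2(2) e1 s1(3) by auto
      have M2: "matrix_at s2 aRel b = matrix_at s aRel b" using e2(4) by (rule matrix_at_cong)
      show "runs l (Seq ?map (Assign aRel (position aRow aJ) (Var aRest))) s2 rs2 (4 * b + 5) ?Q"
      proof (rule runs_Seq[OF runs_map[where f = ?f and j = r and b = b and N = "4 * b + 3"]])
        fix x s3
        assume x: "x < b" "\<forall>y. y \<noteq> aCol \<and> y \<noteq> aRel \<longrightarrow> s3 y = s2 y" "s3 aCol 0 = int x"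
          "matrix_at s3 aRel b = (matrix_at s2 aRel b)(r := \<lambda>z. if z < x then ?f z else matrix_at s2 aRel b r z)"
        have e3: "s3 1 0 = int b" "s3 aRow 0 = int r" "s3 aJ 0 = int j" "s3 aTri = s aTri" "s3 aDen 0 = d" "s3 aQuo 0 = q"
          using x(2) e2 by auto
        have "matrix_at s3 aRel b r x = v x" using x(1,4) M2 by (simp add: v_def)
        moreover have "\<bar>?f x\<bar> \<le> 2 ^ l" using abs_mod_le[OF hd(2), of "v x - q * h x"] d_le by linarith
        ultimately show "expr_value (position aRow aCol) s3 = int r * int b + int x \<and>
          expr_value (Op Rem (Op Sub (cell aRel aRow aCol) (Op Mul (Var aQuo) (cell aTri aJ aCol))) (Var aDen)) s3 = ?f x \<and>
          \<bar>?f x\<bar> \<le> 2 ^ l"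
          using x(1,3) e3 by (simp add: entry_matrix_at h_def)
      next
        fix s3 rs3
        assume s3: "memory_bounded l s3" "\<forall>y. y \<notin> arrays_written ?map \<longrightarrow> s3 y = s2 y"
          "rs3 = rs2 \<and> matrix_at s3 aRel b = (matrix_at s2 aRel b)(r := \<lambda>z. if z < b then ?f z else 0)"
        have e3: "expr_value (position aRow aJ) s3 = int r * int b + int j" "expr_value (Var aRest) s3 = v j - q * h j"
          using s3(2) e2 s2(3) by auto
        show "runs l (Assign aRel (position aRow aJ) (Var aRest)) s3 rs3 1 ?Q"
        proof (rule runs_Assign[OF s3(1)], unfold e3)
          have "matrix_at (store s3 aRel (int r * int b + int j) (v j - q * h j)) aRel b =
              (matrix_at s3 aRel b)(r := (matrix_at s3 aRel b r)(j := v j - q * h j))"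
            using j by (intro matrix_at_upd) (simp_all add: store_same)
          then show "?Q (store s3 aRel (int r * int b + int j) (v j - q * h j)) rs3"
            using s3(2,3) s2(3) M2 j by (auto simp: fun_eq_iff)
        qed (use rest_le in \<open>auto simp: simple_expr_def\<close>)
      qed (use s2(1) e2 in \<open>auto simp: simple_expr_def\<close>)
    qed simp
  qed simp
qed

lemma runs_swap:
  fixes b :: nat
  assumes s: "memory_bounded l s" "s 1 0 = int b" "s aRow 0 = int r" "s aJ 0 = int j"
  shows "runs l swap_program s rs (12 * b + 11) (\<lambda>s' rs'. rs' = rs \<and>
    matrix_at s' aRel b = (matrix_at s aRel b)(r := matrix_at s aTri b j) \<and>
    matrix_at s' aTri b = (matrix_at s aTri b)(j := matrix_at s aRel b r))"
  unfolding swap_program_def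
proof (rule runs_Seq[OF runs_map[where f = "matrix_at s aRel b r" and j = 0 and b = b and N = "4 * b + 3"]])
  fix x s1
  assume x: "x < b" "\<forall>y. y \<noteq> aCol \<and> y \<noteq> aSwap \<longrightarrow> s1 y = s y" "s1 aCol 0 = int x"
  then have "s1 1 0 = int b" "s1 aRow 0 = int r" "s1 aRel = s aRel" using s by auto
  then show "expr_value (Var aCol) s1 = int 0 * int b + int x \<and>
     expr_value (cell aRel aRow aCol) s1 = matrix_at s aRel b r x \<and> \<bar>matrix_at s aRel b r x\<bar> \<le> 2 ^ l"
    using x matrix_at_bounded[OF s(1)] by (simp add: entry_matrix_at)
next
  fix s1 rs1
  assume s1: "memory_bounded l s1"
    "\<forall>y. y \<notin> arrays_written (For aCol 1 (Assign aSwap (Var aCol) (cell aRel aRow aCol))) \<longrightarrow> s1 y = s y"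
    "rs1 = rs \<and> matrix_at s1 aSwap b = (matrix_at s aSwap b)(0 := \<lambda>z. if z < b then matrix_at s aRel b r z else 0)"
  have e1: "s1 1 0 = int b" "s1 aRow 0 = int r" "s1 aJ 0 = int j" "s1 aTri = s aTri" "s1 aRel = s aRel"
    using s1(2) s by auto
  let ?Q = "\<lambda>s' rs'. rs' = rs \<and>
    matrix_at s' aRel b = (matrix_at s aRel b)(r := matrix_at s aTri b j) \<and>
    matrix_at s' aTri b = (matrix_at s aTri b)(j := matrix_at s aRel b r)"
  show "runs l (Seq (For aCol 1 (Assign aRel (position aRow aCol) (cell aTri aJ aCol)))
       (For aCol 1 (Assign aTri (position aJ aCol) (Entry aSwap (Var aCol))))) s1 rs1 (8 * b + 7) ?Q"
  proof (rule runs_Seq[OF runs_map[where f = "matrix_at s aTri b j" and j = r and b = b and N = "4 * b + 3"]])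
    fix x s2
    assume x: "x < b" "\<forall>y. y \<noteq> aCol \<and> y \<noteq> aRel \<longrightarrow> s2 y = s1 y" "s2 aCol 0 = int x"
    then have "s2 1 0 = int b" "s2 aRow 0 = int r" "s2 aJ 0 = int j" "s2 aTri = s aTri" using e1 by auto
    then show "expr_value (position aRow aCol) s2 = int r * int b + int x \<and>
      expr_value (cell aTri aJ aCol) s2 = matrix_at s aTri b j x \<and> \<bar>matrix_at s aTri b j x\<bar> \<le> 2 ^ l"
      using x matrix_at_bounded[OF s(1)] by (simp add: entry_matrix_at)
  next
    fix s2 rs2
    assume s2: "memory_bounded l s2"
      "\<forall>y. y \<notin> arrays_written (For aCol 1 (Assign aRel (position aRow aCol) (cell aTri aJ aCol))) \<longrightarrow> s2 y = s1 y"
      "rs2 = rs1 \<and> matrix_at s2 aRel b = (matrix_at s1 aRel b)(r := \<lambda>z. if z < b then matrix_at s aTri b j z else 0)"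
    have e2: "s2 1 0 = int b" "s2 aJ 0 = int j" "s2 aTri = s aTri" "s2 aSwap = s1 aSwap"
      using s2(2) e1 by auto
    have sw: "s1 aSwap (int x) = matrix_at s aRel b r x" if "x < b" for x
      using s1(3) that by (simp add: entry_matrix_at_0)
    have M2: "matrix_at s2 aTri b = matrix_at s aTri b" using e2(3) by (rule matrix_at_cong)
    have R2: "matrix_at s2 aRel b = (matrix_at s aRel b)(r := matrix_at s aTri b j)"
      using s2(3) matrix_at_cong[of s1 aRel s b, OF e1(5)] by (auto simp: fun_eq_iff matrix_at_outside)
    show "runs l (For aCol 1 (Assign aTri (position aJ aCol) (Entry aSwap (Var aCol)))) s2 rs2 (4 * b + 3) ?Q"
    proof (rule runs_conseq[OF runs_map[where f = "matrix_at s aRel b r" and j = j and b = b and N = "4 * b + 3"]])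
      fix x s3
      assume x: "x < b" "\<forall>y. y \<noteq> aCol \<and> y \<noteq> aTri \<longrightarrow> s3 y = s2 y" "s3 aCol 0 = int x"
      then have "s3 1 0 = int b" "s3 aJ 0 = int j" "s3 aSwap = s1 aSwap" using e2 by auto
      then show "expr_value (position aJ aCol) s3 = int j * int b + int x \<and>
        expr_value (Entry aSwap (Var aCol)) s3 = matrix_at s aRel b r x \<and> \<bar>matrix_at s aRel b r x\<bar> \<le> 2 ^ l"
        using x sw matrix_at_bounded[OF s(1)] by simp
    next
      fix s3 rs3
      assume s3: "rs3 = rs2 \<and> matrix_at s3 aTri b = (matrix_at s2 aTri b)(j := \<lambda>z. if z < b then matrix_at s aRel b r z else 0)"
        "\<forall>y. y \<notin> arrays_written (For aCol 1 (Assign aTri (position aJ aCol) (Entry aSwap (Var aCol)))) \<longrightarrow> s3 y = s2 y"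
      have "matrix_at s3 aRel b = matrix_at s2 aRel b" using s3(2) by (intro matrix_at_cong) simp
      then show "?Q s3 rs3" using s3(1) s2(3) s1(3) M2 R2 by (auto simp: fun_eq_iff matrix_at_outside)
    qed (use s2(1) e2 in \<open>auto simp: simple_expr_def\<close>)
  qed (use s1(1) e1 in \<open>auto simp: simple_expr_def\<close>)
qed (use s in \<open>auto simp: simple_expr_def\<close>)

lemma runs_advance:
  fixes b :: nat
  assumes s: "memory_bounded l s" "s 1 0 = int b" "s aRow 0 = int r" "s aJ 0 = int j" and r: "int r < 2 ^ l" "0 < b"
  shows "runs l advance_program s rs 4 (\<lambda>s' rs'. rs' = rs \<and>
    (if 0 < j then s' aJ 0 = int (j - 1) \<and> s' aRow 0 = int r else s' aJ 0 = int (b - 1) \<and> s' aRow 0 = int (Suc r)))"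
  unfolding advance_program_def
proof (rule runs_Cond[OF s(1), where N' = 3])
  assume "0 < expr_value (Var aJ) s"
  then have j: "0 < j" using s by simp
  have e: "expr_value (Op Sub (Var aJ) (Num 1)) s = int (j - 1)" using s j by simp
  have jl: "int (j - 1) \<le> 2 ^ l" using memory_boundedD[OF s(1), of aJ 0] s(4) by simp
  show "runs l (Set aJ (Op Sub (Var aJ) (Num 1))) s rs 3 (\<lambda>s' rs'. rs' = rs \<and>
    (if 0 < j then s' aJ 0 = int (j - 1) \<and> s' aRow 0 = int r else s' aJ 0 = int (b - 1) \<and> s' aRow 0 = int (Suc r)))"
    by (rule runs_Assign[OF s(1)], unfold e) (use j jl s in \<open>auto simp: simple_expr_def store_same\<close>)
next
  assume "\<not> 0 < expr_value (Var aJ) s"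
  then have j: "j = 0" using s by simp
  have e: "expr_value (Op Sub (Var 1) (Num 1)) s = int (b - 1)" using s r by simp
  have b: "int (b - 1) \<le> 2 ^ l" using memory_boundedD[OF s(1), of 1 0] s(2) by simp
  have 1: "runs l (Set aJ (Op Sub (Var 1) (Num 1))) s rs 1 (\<lambda>s' rs'. rs' = rs \<and> s' aJ 0 = int (b - 1))"
    by (rule runs_Assign[OF s(1)], unfold e) (use b in \<open>auto simp: simple_expr_def store_same\<close>)
  show "runs l (Seq (Set aJ (Op Sub (Var 1) (Num 1))) (Set aRow (Op Add (Var aRow) (Num 1)))) s rs 3 (\<lambda>s' rs'. rs' = rs \<and>
    (if 0 < j then s' aJ 0 = int (j - 1) \<and> s' aRow 0 = int r else s' aJ 0 = int (b - 1) \<and> s' aRow 0 = int (Suc r)))"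
  proof (rule runs_Seq[OF 1])
    fix s1 rs1
    assume s1: "memory_bounded l s1" "\<forall>y. y \<notin> arrays_written (Set aJ (Op Sub (Var 1) (Num 1))) \<longrightarrow> s1 y = s y"
      "rs1 = rs \<and> s1 aJ 0 = int (b - 1)"
    then have e1: "expr_value (Op Add (Var aRow) (Num 1)) s1 = int (Suc r)" using s by simp
    have rl: "int (Suc r) \<le> 2 ^ l" using r(1) unfolding of_nat_Suc by linarith
    show "runs l (Set aRow (Op Add (Var aRow) (Num 1))) s1 rs1 1 (\<lambda>s' rs'. rs' = rs \<and>
      (if 0 < j then s' aJ 0 = int (j - 1) \<and> s' aRow 0 = int r else s' aJ 0 = int (b - 1) \<and> s' aRow 0 = int (Suc r)))"
      by (rule runs_Assign[OF s1(1)], unfold e1) (use j rl s1(3) in \<open>auto simp: simple_expr_def store_same\<close>)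
  qed simp
qed (auto simp: simple_expr_def)

text \<open>Doubling a nonzero number adds exactly one bit. This strict loss of a bit pays for a
  swap.\<close>

lemma bits_halving:
  assumes "x \<noteq> 0" "2 * \<bar>x\<bar> \<le> \<bar>y\<bar>"
  shows "bits x < bits y"
proof -
  have "bitlen \<bar>x\<bar> + 1 = bitlen (2 * \<bar>x\<bar>)"
    using assms(1) by (simp add: bitlen_alt_def log_mult)
  also have "\<dots> \<le> bitlen \<bar>y\<bar>" using assms by (intro bitlen_mono) auto
  finally show ?thesis using bitlen_nonneg[of "\<bar>x\<bar>"] by (simp add: bits_def)
qed

text \<open>The loop invariant. Entries are held below \<open>V\<close> rather than
  \<open>2 ^ l\<close>: least absolute remainders and residues modulo \<open>d\<close> never exceed
  \<open>V\<close>, while the numerator of a quotient may reach \<open>3 V\<close>.\<close>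

definition reducing :: "nat \<Rightarrow> int \<Rightarrow> (nat \<Rightarrow> nat \<Rightarrow> int) \<Rightarrow> nat \<Rightarrow> int \<Rightarrow> memory \<Rightarrow> bool" where
  "reducing b d A R V s \<longleftrightarrow> (\<exists>r j. s aRow 0 = int r \<and> s aJ 0 = int j \<and> r \<le> R \<and> j < b \<and>
     (if r = R then inserted b d A R (matrix_at s aTri b)
      else inserting b d A r (matrix_at s aTri b) (matrix_at s aRel b r) j) \<and>
     (\<forall>k. r < k \<longrightarrow> matrix_at s aRel b k = A k) \<and>
     (\<forall>i<b. \<forall>x<b. \<bar>matrix_at s aTri b i x\<bar> \<le> V) \<and> (\<forall>k<R. \<forall>x<b. \<bar>matrix_at s aRel b k x\<bar> \<le> V))"

text \<open>Advancing lowers the position, the first two summands, by one and leaves the diagonal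
  alone; swapping keeps the position and shortens a diagonal entry. Bits lost on the diagonal never
  return, so all relations share one budget of swaps.\<close>

definition potential :: "nat \<Rightarrow> nat \<Rightarrow> memory \<Rightarrow> nat" where
  "potential b R s = nat (int R - s aRow 0) * b + nat (s aJ 0) + (\<Sum>i<b. bits (matrix_at s aTri b i i))"

lemma runs_reduce_step:
  fixes b :: nat
  assumes s: "memory_bounded l s" "s 1 0 = int b" "s aDen 0 = d"
    and red: "reducing b d A R V s" "s aRow 0 < int R"
    and A: "\<And>r x. b \<le> x \<Longrightarrow> A r x = 0"
    and V: "3 * V \<le> 2 ^ l" "\<bar>d\<bar> \<le> V" "d \<noteq> 0" and R: "int R \<le> 2 ^ l"
  shows "runs l (Seq subtract_program
         (Cond (Op Mul (Var aRest) (Var aRest)) swap_program advance_program)) s rs (16 * b + 22)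
    (\<lambda>s' rs'. (rs' = rs \<and> reducing b d A R V s') \<and> potential b R s' < potential b R s)"
proof -
  obtain r j where r: "s aRow 0 = int r" "r < R" and j: "s aJ 0 = int j" "j < b"
    and ins: "inserting b d A r (matrix_at s aTri b) (matrix_at s aRel b r) j"
    and later: "\<forall>k. r < k \<longrightarrow> matrix_at s aRel b k = A k"
    and HV: "\<forall>i<b. \<forall>x<b. \<bar>matrix_at s aTri b i x\<bar> \<le> V" and AV: "\<forall>k<R. \<forall>x<b. \<bar>matrix_at s aRel b k x\<bar> \<le> V"
    using red unfolding reducing_def by (auto split: if_splits)
  define H v where "H = matrix_at s aTri b" and "v = matrix_at s aRel b r"
  define q where "q = (2 * v j + H j j) div (2 * H j j)"
  define y where "y = v j - q * H j j"
  define v' where "v' x = (if x < b then if x = j then y else (v x - q * H j x) mod d else 0)" for x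
  have Hj: "H j j \<noteq> 0" using ins j(2) by (simp add: inserting_def lower_triangular_def H_def)
  have yH: "2 * \<bar>y\<bar> \<le> \<bar>H j j\<bar>" unfolding y_def q_def by (rule abs_nearest_quotient[OF Hj])
  have ins': "inserting b d A r H v' j"
    using inserting_reduce[OF ins, of v' q] by (simp add: v'_def H_def v_def y_def)
  have v'V: "\<bar>v' x\<bar> \<le> V" if "x < b" for x
  proof -
    have "\<bar>H j j\<bar> \<le> V" using HV j(2) by (simp add: H_def)
    then have "\<bar>y\<bar> \<le> V" using yH by linarith
    moreover have "\<bar>(v x - q * H j x) mod d\<bar> \<le> V" using abs_mod_le[OF V(3)] V(2) order_trans by blast
    ultimately show ?thesis using that by (simp add: v'_def)
  qed
  have 1: "runs l subtract_program s rs (4 * b + 9) (\<lambda>s' rs'. rs' = rs \<and> s' aRest 0 = y \<and>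
    matrix_at s' aRel b = (matrix_at s aRel b)(r := v'))"
    unfolding v'_def y_def q_def v_def H_def s(3)[symmetric]
    by (rule runs_subtract[OF s(1,2) r(1) j(1,2), where V = V])
      (use Hj V HV AV j r s(3) in \<open>simp_all add: H_def\<close>)
  let ?Q = "\<lambda>s' rs'. (rs' = rs \<and> reducing b d A R V s') \<and> potential b R s' < potential b R s"
  show ?thesis
  proof (rule runs_Seq[OF 1])
    fix s1 rs1
    assume s1: "memory_bounded l s1" "\<forall>y. y \<notin> arrays_written subtract_program \<longrightarrow> s1 y = s y"
      "rs1 = rs \<and> s1 aRest 0 = y \<and> matrix_at s1 aRel b = (matrix_at s aRel b)(r := v')"
    have e1: "s1 1 0 = int b" "s1 aRow 0 = int r" "s1 aJ 0 = int j" "s1 aTri = s aTri"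
      using s1(2) s r j by (auto simp: subtract_program_def)
    have H1: "matrix_at s1 aTri b = H" unfolding H_def using e1(4) by (rule matrix_at_cong)
    have yv: "y = v' j" using j by (simp add: v'_def)
    show "runs l (Cond (Op Mul (Var aRest) (Var aRest)) swap_program advance_program) s1 rs1 (12 * b + 12) ?Q"
    proof (rule runs_Cond[OF s1(1), where N' = "12 * b + 11"])
      assume "0 < expr_value (Op Mul (Var aRest) (Var aRest)) s1"
      then have y0: "y \<noteq> 0" using s1(3) by auto
      show "runs l swap_program s1 rs1 (12 * b + 11) ?Q"
      proof (rule runs_conseq[OF runs_swap[OF s1(1) e1(1-3)] _ order.refl])
        fix s2 rs2
        assume s2: "memory_bounded l s2" "\<forall>y. y \<notin> arrays_written swap_program \<longrightarrow> s2 y = s1 y"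
          "rs2 = rs1 \<and> matrix_at s2 aRel b = (matrix_at s1 aRel b)(r := matrix_at s1 aTri b j) \<and>
            matrix_at s2 aTri b = (matrix_at s1 aTri b)(j := matrix_at s1 aRel b r)"
        have e2: "s2 aRow 0 = int r" "s2 aJ 0 = int j" using s2(2) e1 by (auto simp: swap_program_def)
        have H2: "matrix_at s2 aTri b = H(j := v')" and R2: "matrix_at s2 aRel b = (matrix_at s aRel b)(r := H j)"
          using s2(3) s1(3) H1 by auto
        have "inserting b d A r (H(j := v')) (H j) j" using ins' y0 yv by (intro inserting_swap) auto
        then have "reducing b d A R V s2" unfolding reducing_def
          using e2 r j later HV AV v'V unfolding H2 R2 by (intro exI[of _ r] exI[of _ j]) (auto simp: H_def)
        moreover have "(\<Sum>i<b. bits (matrix_at s2 aTri b i i)) < (\<Sum>i<b. bits (matrix_at s aTri b i i))"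
        proof (rule sum_strict_mono_ex1)
          show "\<forall>i\<in>{..<b}. bits (matrix_at s2 aTri b i i) \<le> bits (matrix_at s aTri b i i)"
            using bits_halving[OF y0 yH] yv by (auto simp: H2 H_def)
          show "\<exists>i\<in>{..<b}. bits (matrix_at s2 aTri b i i) < bits (matrix_at s aTri b i i)"
            using bits_halving[OF y0 yH] yv j by (intro bexI[of _ j]) (auto simp: H2 H_def)
        qed simp
        ultimately show "?Q s2 rs2" using s2(3) s1(3) e2 r j by (simp add: potential_def)
      qed
    next
      assume "\<not> 0 < expr_value (Op Mul (Var aRest) (Var aRest)) s1"
      then have "\<not> 0 < y * y" using s1(3) by simp
      then have y0: "v' j = 0" unfolding yv[symmetric] by (auto simp: zero_less_mult_iff)
      have rl: "int r < 2 ^ l" using r(2) R by linarith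
      have b: "0 < b" using j(2) by simp
      show "runs l advance_program s1 rs1 (12 * b + 11) ?Q"
      proof (rule runs_conseq[OF runs_advance[OF s1(1) e1(1-3) rl b]])
        fix s2 rs2
        assume s2: "memory_bounded l s2" "\<forall>y. y \<notin> arrays_written advance_program \<longrightarrow> s2 y = s1 y"
          "rs2 = rs1 \<and> (if 0 < j then s2 aJ 0 = int (j - 1) \<and> s2 aRow 0 = int r
             else s2 aJ 0 = int (b - 1) \<and> s2 aRow 0 = int (Suc r))"
        have "s2 aTri = s1 aTri" "s2 aRel = s1 aRel" using s2(2) by (auto simp: advance_program_def)
        then have H2: "matrix_at s2 aTri b = H" and R2: "matrix_at s2 aRel b = (matrix_at s aRel b)(r := v')"
          using H1 s1(3) matrix_at_cong[of s2 aTri s1 b] matrix_at_cong[of s2 aRel s1 b] by auto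
        have bnd: "\<forall>i<b. \<forall>x<b. \<bar>H i x\<bar> \<le> V" "\<forall>k<R. \<forall>x<b. \<bar>((matrix_at s aRel b)(r := v')) k x\<bar> \<le> V"
          using HV AV v'V by (auto simp: H_def)
        show "?Q s2 rs2"
        proof (cases "0 < j")
          case True
          have "inserting b d A r H v' (j - 1)" by (rule inserting_down[OF ins' y0 True])
          then have "reducing b d A R V s2" unfolding reducing_def H2 R2
            using s2(3) r j later bnd True by (intro exI[of _ r] exI[of _ "j - 1"]) auto
          then show ?thesis using s2(3) s1(3) r j True by (simp add: potential_def H2 H_def)
        next
          case False
          then have "inserted b d A (Suc r) H" using inserting_done[of b d A r H v'] ins' y0 by simp
          \<comment> \<open>Unless all relations are done, the next one is still in its original
            form by \<open>later\<close>, and its insertion starts at the last column.\<close>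
          then have "(if Suc r = R then inserted b d A R H else inserting b d A (Suc r) H (A (Suc r)) (b - 1))"
            using inserted_start[of b d A "Suc r" H] A b by auto
          then have "reducing b d A R V s2" unfolding reducing_def H2 R2
            using s2(3) r j later bnd False by (intro exI[of _ "Suc r"] exI[of _ "b - 1"]) auto
          moreover have "nat (int R - int (Suc r)) * b + (b - 1) < nat (int R - int r) * b"
          proof -
            have "nat (int R - int r) = Suc (nat (int R - int (Suc r)))" using r(2) by linarith
            then show ?thesis using b by simp
          qed
          ultimately show ?thesis using s2(3) s1(3) r j False by (simp add: potential_def H2 H_def)
        qed
      qed simp
    qed (auto simp: simple_expr_def)
  qed simp
qed

text \<open>The middle factor is the initial potential: \<open>R b\<close> for the rows,
  \<open>b\<close> for the column, and \<open>l + 2\<close> bits for each of the \<open>b\<close>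
  diagonal entries.\<close>

lemma runs_reduce:
  fixes b :: nat
  assumes s: "memory_bounded l s" "s 1 0 = int b" "s aTotal 0 = int R" "s aDen 0 = d" and b: "0 < b"
    and H: "\<And>j. j < b \<Longrightarrow> matrix_at s aTri b j = (\<lambda>x. d * unit_at j x)"
    and A: "\<And>r x. r < R \<Longrightarrow> x < b \<Longrightarrow> \<bar>matrix_at s aRel b r x\<bar> \<le> V"
    and V: "3 * V \<le> 2 ^ l" "\<bar>d\<bar> \<le> V" "d \<noteq> 0"
  shows "runs l reduce_program s rs ((16 * b + 23) * (R * b + b + b * (l + 2)) + 5)
    (\<lambda>s' rs'. rs' = rs \<and> inserted b d (matrix_at s aRel b) R (matrix_at s' aTri b))"
proof -
  define A where "A = matrix_at s aRel b"
  let ?p = "Seq subtract_program (Cond (Op Mul (Var aRest) (Var aRest)) swap_program advance_program)"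
  have R: "int R \<le> 2 ^ l" using memory_boundedD[OF s(1), of aTotal 0] s(3) by simp
  have "int b \<le> 2 ^ l" using memory_boundedD[OF s(1), of 1 0] s(2) by simp
  then have bl: "int b - 1 \<le> 2 ^ l" by linarith
  have 1: "runs l (Set aRow (Num 0)) s rs 1 (\<lambda>s' rs'. rs' = rs \<and> s' aRow 0 = 0)"
    by (rule runs_Assign[OF s(1)]) (auto simp: simple_expr_def store_same)
  let ?Q = "\<lambda>s' rs'. rs' = rs \<and> inserted b d A R (matrix_at s' aTri b)"
  show ?thesis unfolding reduce_program_def A_def[symmetric]
  proof (rule runs_Seq[OF 1])
    fix s1 rs1
    assume s1: "memory_bounded l s1" "\<forall>y. y \<notin> arrays_written (Set aRow (Num 0)) \<longrightarrow> s1 y = s y" "rs1 = rs \<and> s1 aRow 0 = 0"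
    then have e: "expr_value (Op Sub (Var 1) (Num 1)) s1 = int (b - 1)" using s b by simp
    have 2: "runs l (Set aJ (Op Sub (Var 1) (Num 1))) s1 rs1 1 (\<lambda>s' rs'. rs' = rs \<and> s' aJ 0 = int (b - 1))"
      by (rule runs_Assign[OF s1(1)], unfold e) (use s1(3) bl b in \<open>auto simp: simple_expr_def store_same of_nat_diff\<close>)
    show "runs l (Seq (Set aJ (Op Sub (Var 1) (Num 1))) (While (Op Sub (Var aTotal) (Var aRow)) ?p)) s1 rs1
      ((16 * b + 23) * (R * b + b + b * (l + 2)) + 3) ?Q"
    proof (rule runs_Seq[OF 2])
      fix s2 rs2
      assume s2: "memory_bounded l s2" "\<forall>y. y \<notin> arrays_written (Set aJ (Op Sub (Var 1) (Num 1))) \<longrightarrow> s2 y = s1 y"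
        "rs2 = rs \<and> s2 aJ 0 = int (b - 1)"
      have e2: "s2 1 0 = int b" "s2 aTotal 0 = int R" "s2 aDen 0 = d" "s2 aRel = s aRel" "s2 aTri = s aTri" "s2 aRow 0 = 0"
        using s2(2) s1(2,3) s by auto
      have M2: "matrix_at s2 aRel b = A" "matrix_at s2 aTri b = matrix_at s aTri b"
        using matrix_at_cong[of s2 aRel s b, OF e2(4)] matrix_at_cong[of s2 aTri s b, OF e2(5)] by (auto simp: A_def)
      have Az: "A r x = 0" if "b \<le> x" for r x using that by (simp add: A_def matrix_at_outside)
      have ini: "inserted b d A 0 (matrix_at s aTri b)" using V(3) H by (intro inserted_init) auto
      then have "inserting b d A 0 (matrix_at s aTri b) (A 0) (b - 1)" using b Az by (intro inserted_start) auto
      then have red: "reducing b d A R V s2" unfolding reducing_def M2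
        using e2 s2(3) b ini H A V by (intro exI[of _ 0] exI[of _ "b - 1"]) (auto simp: A_def)
      have pot: "potential b R s2 \<le> R * b + b + b * (l + 2)"
      proof -
        have "(\<Sum>i<b. bits (matrix_at s2 aTri b i i)) \<le> (\<Sum>i<b. l + 2)"
          using matrix_at_bounded[OF s2(1)] by (intro sum_mono bits_le)
        then show ?thesis using e2 s2(3) by (simp add: potential_def)
      qed
      have le: "(16 * b + 22 + 1) * potential b R s2 + 1 \<le> (16 * b + 23) * (R * b + b + b * (l + 2)) + 1"
        by (intro add_right_mono mult_le_mono pot) simp
      have run: "runs l (While (Op Sub (Var aTotal) (Var aRow)) ?p) s2 rs2 ((16 * b + 22 + 1) * potential b R s2 + 1) ?Q"
      proof (rule runs_While[where I = "\<lambda>s' rs'. rs' = rs \<and> reducing b d A R V s'" and \<mu> = "\<lambda>s' _. potential b R s'"])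
        fix s3 rs3
        assume I: "rs3 = rs \<and> reducing b d A R V s3" and s3: "memory_bounded l s3"
          and fr: "\<forall>y. y \<notin> arrays_written ?p \<longrightarrow> s3 y = s2 y"
        have e3: "s3 1 0 = int b" "s3 aTotal 0 = int R" "s3 aDen 0 = d"
          using fr e2 by (auto simp: subtract_program_def swap_program_def advance_program_def)
        { assume "\<not> 0 < expr_value (Op Sub (Var aTotal) (Var aRow)) s3"
          then show "?Q s3 rs3" using I e3 unfolding reducing_def by (auto split: if_splits) }
        assume "0 < expr_value (Op Sub (Var aTotal) (Var aRow)) s3"
        then have "s3 aRow 0 < int R" using e3 by simp
        then show "runs l ?p s3 rs3 (16 * b + 22) (\<lambda>s' rs'. (rs' = rs \<and> reducing b d A R V s') \<and> potential b R s' < potential b R s3)"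
          using runs_reduce_step[OF s3 e3(1,3), of A R V rs3] I Az V R by simp
      qed (use s2(1,3) red in \<open>auto simp: simple_expr_def\<close>)
      show "runs l (While (Op Sub (Var aTotal) (Var aRow)) ?p) s2 rs2 ((16 * b + 23) * (R * b + b + b * (l + 2)) + 1) ?Q"
        by (rule runs_conseq[OF run _ le])
    qed simp
  qed simp
qed

lemma runs_output:
  fixes b :: nat
  assumes s: "memory_bounded l s" and T: "s aTab 0 = 0 \<or> s aTab 0 = s aDen 0" "s aDen 0 \<noteq> 0"
  shows "runs l output_program s rs 5 (\<lambda>s' rs'. rs' = rs \<and> s' 0 0 = \<bar>s aTri 0 * (s aTab 0 div s aDen 0)\<bar>)"
proof -
  let ?v = "s aTri 0 * (s aTab 0 div s aDen 0)"
  have v: "\<bar>?v\<bar> \<le> 2 ^ l" using memory_boundedD[OF s, of aTri 0] T by auto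
  have 1: "runs l (Set 0 (Op Mul (Var aTri) (Op Quo (Var aTab) (Var aDen)))) s rs 1 (\<lambda>s' rs'. rs' = rs \<and> s' 0 0 = ?v)"
    by (rule runs_Assign[OF s]) (use v in \<open>auto simp: simple_expr_def store_same\<close>)
  show ?thesis unfolding output_program_def
  proof (rule runs_Seq[OF 1])
    fix s1 rs1
    assume s1: "memory_bounded l s1" "rs1 = rs \<and> s1 0 0 = ?v"
    show "runs l (Cond (Var 0) Skip (Set 0 (Op Sub (Num 0) (Var 0)))) s1 rs1 3
      (\<lambda>s' rs'. rs' = rs \<and> s' 0 0 = \<bar>s aTri 0 * (s aTab 0 div s aDen 0)\<bar>)"
    proof (rule runs_Cond[OF s1(1), where N' = 1])
      assume "0 < expr_value (Var 0) s1"
      then show "runs l Skip s1 rs1 1 (\<lambda>s' rs'. rs' = rs \<and> s' 0 0 = \<bar>s aTri 0 * (s aTab 0 div s aDen 0)\<bar>)"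
        using s1 by (intro runs_Skip) auto
    next
      assume "\<not> 0 < expr_value (Var 0) s1"
      then show "runs l (Set 0 (Op Sub (Num 0) (Var 0))) s1 rs1 1
        (\<lambda>s' rs'. rs' = rs \<and> s' 0 0 = \<bar>s aTri 0 * (s aTab 0 div s aDen 0)\<bar>)"
        using s1 v by (intro runs_Assign) (auto simp: simple_expr_def store_same)
    qed (auto simp: simple_expr_def)
  qed simp
qed

section \<open>Composition of the subroutines\<close>

definition period_steps :: "nat \<Rightarrow> nat \<Rightarrow> nat \<Rightarrow> nat" where
  "period_steps b R l = (6 * b + 8) * R + (8 * b * b + 27 * b + 27) * R + 4 * b +
     (16 * b + 23) * (R * b + b + b * (l + 2)) + 40"

lemma runs_period:
  fixes b :: nat
  assumes mb: "memory_bounded l (program_input n b c a i)" and b: "0 < b" and len: "length rs = b + c"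
    and rs: "\<And>r. r \<in> set rs \<Longrightarrow> length r = b" "\<And>r v. r \<in> set rs \<Longrightarrow> v \<in> set r \<Longrightarrow> \<bar>v\<bar> \<le> M"
    and M: "1 \<le> M" and l: "(3 + 2 * int b) * minor_bound b M \<le> 2 ^ l" and R: "int (b + c) \<le> 2 ^ l"
  shows "runs l period_program (program_input n b c a i) rs (period_steps b (b + c) l) (\<lambda>s' rs'. rs' = [] \<and> 0 \<le> s' 0 0 \<and>
    (\<forall>m. (\<lambda>y. m * unit_at 0 y) \<in> zvec.span ((\<lambda>r x. if x < b then rs ! r ! ((x + i) mod b) else 0) ` {..<b + c})
      \<longleftrightarrow> s' 0 0 dvd m))"
proof -
  let ?F = "\<lambda>r x. if x < b then rs ! r ! ((x + i) mod b) else 0"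
  let ?R = "b + c"
  let ?Q = "\<lambda>s' rs'. rs' = [] \<and> 0 \<le> s' 0 0 \<and>
    (\<forall>m. (\<lambda>y. m * unit_at 0 y) \<in> zvec.span (?F ` {..<?R}) \<longleftrightarrow> s' 0 0 dvd m)"
  let ?s = "program_input n b c a i"
  define U where "U = fact b * M ^ b"
  define V where "V = minor_bound b M"
  have VU: "V = U * M" by (simp add: V_def minor_bound_def U_def mult.assoc mult.commute)
  have U: "1 \<le> U" unfolding U_def using mult_mono[of 1 "fact b :: int" 1 "M ^ b"] M by (simp add: one_le_power fact_ge_1)
  \<comment> \<open>The reduction exchanges relation rows with basis rows, so one bound
    \<open>V\<close> must dominate both the relation entries and \<open>d\<close>.\<close>
  have UV: "U \<le> V" "M \<le> V" unfolding VU using U M mult_left_mono[of 1 M U] mult_right_mono[of 1 U M] by auto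
  have "3 * V \<le> (3 + 2 * int b) * V" using UV U by (intro mult_right_mono) auto
  then have V3: "3 * V \<le> 2 ^ l" using l by (simp add: V_def)
  have Ml: "M \<le> 2 ^ l" using V3 UV M by linarith
  have 1: "runs l (Set aTotal (Op Add (Var 1) (Var 2))) ?s rs 1 (\<lambda>s' rs'. rs' = rs \<and> s' aTotal 0 = int ?R)"
    by (rule runs_Assign[OF mb]) (use R in \<open>auto simp: simple_expr_def store_same program_input_def\<close>)
  have "runs l period_program ?s rs (1 + ((6 * b + 8) * ?R + 3 + (((8 * b * b + 27 * b + 27) * ?R + 5) +
      ((4 * b + 3) + (((16 * b + 23) * (?R * b + b + b * (l + 2)) + 5) + 5 + 1) + 1) + 1) + 1) + 1) ?Q"
    unfolding period_program_def
  proof (rule runs_Seq[OF 1 _ order.refl])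
    fix s1 rs1
    assume s1: "memory_bounded l s1" "\<forall>y. y \<notin> arrays_written (Set aTotal (Op Add (Var 1) (Var 2))) \<longrightarrow> s1 y = ?s y"
      "rs1 = rs \<and> s1 aTotal 0 = int ?R"
    have e1: "s1 1 0 = int b" "s1 3 0 = int i" "s1 aTab = (\<lambda>_. 0)" "s1 aTri = (\<lambda>_. 0)"
      using s1(2) by (auto simp: program_input_def)
    have 2: "runs l read_program s1 rs1 ((6 * b + 8) * ?R + 3) (\<lambda>s' rs'. rs' = [] \<and>
      (\<forall>r<?R. matrix_at s' aRel b r = ?F r))"
      using runs_read[OF s1(1) e1(1,2), of rs] s1(3) len rs b Ml by (auto intro: order_trans)
    show "runs l (Seq read_program (Seq eliminate_program (Seq diagonal_program (Seq reduce_program output_program)))) s1 rs1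
      ((6 * b + 8) * ?R + 3 + (((8 * b * b + 27 * b + 27) * ?R + 5) +
      ((4 * b + 3) + (((16 * b + 23) * (?R * b + b + b * (l + 2)) + 5) + 5 + 1) + 1) + 1) + 1) ?Q"
    proof (rule runs_Seq[OF 2 _ order.refl])
      fix s2 and rs2 :: "int list list"
      assume s2: "memory_bounded l s2" "\<forall>y. y \<notin> arrays_written read_program \<longrightarrow> s2 y = s1 y"
        "rs2 = [] \<and> (\<forall>r<?R. matrix_at s2 aRel b r = ?F r)"
      have e2: "s2 1 0 = int b" "s2 aTotal 0 = int ?R" "s2 aTab = (\<lambda>_. 0)" "s2 aTri = (\<lambda>_. 0)"
        using s2(2) e1 s1(3) by (auto simp: read_program_def)
      define A where "A = matrix_at s2 aRel b"
      have A: "\<bar>A r x\<bar> \<le> M" if "r < ?R" "x < b" for r x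
      proof -
        have "rs ! r \<in> set rs" using that len by simp
        moreover then have "rs ! r ! ((x + i) mod b) \<in> set (rs ! r)" using rs(1) b by auto
        ultimately show ?thesis using rs(2) s2(3) that by (simp add: A_def)
      qed
      have Az: "A r x = 0" if "b \<le> x" for r x using that by (simp add: A_def matrix_at_outside)
      have AF: "A ` {..<?R} = ?F ` {..<?R}" using s2(3) by (intro image_cong) (auto simp: A_def)
      have 3: "runs l eliminate_program s2 rs2 ((8 * b * b + 27 * b + 27) * ?R + 5)
        (\<lambda>s' rs'. rs' = rs2 \<and> (\<exists>P B. pivoted b A ?R (matrix_at s' aTab b) (s' aDen 0) P B))"
        unfolding A_def by (rule runs_eliminate[OF s2(1) e2(1,2) _ M l]) (use A e2 in \<open>auto simp: A_def matrix_at_def\<close>)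
      show "runs l (Seq eliminate_program (Seq diagonal_program (Seq reduce_program output_program))) s2 rs2
        (((8 * b * b + 27 * b + 27) * ?R + 5) +
        ((4 * b + 3) + (((16 * b + 23) * (?R * b + b + b * (l + 2)) + 5) + 5 + 1) + 1) + 1) ?Q"
      proof (rule runs_Seq[OF 3 _ order.refl])
        fix s3 rs3
        assume s3: "memory_bounded l s3" "\<forall>y. y \<notin> arrays_written eliminate_program \<longrightarrow> s3 y = s2 y"
          "rs3 = rs2 \<and> (\<exists>P B. pivoted b A ?R (matrix_at s3 aTab b) (s3 aDen 0) P B)"
        have e3: "s3 1 0 = int b" "s3 aTotal 0 = int ?R" "s3 aTri = (\<lambda>_. 0)" "s3 aRel = s2 aRel"
          using s3(2) e2 by (auto simp: eliminate_program_def residual_program_def search_program_def pivot_program_def)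
        define d where "d = s3 aDen 0"
        obtain P B where "pivoted b A ?R (matrix_at s3 aTab b) d P B" using s3(3) by (auto simp: d_def)
        then interpret pivoted b A ?R "matrix_at s3 aTab b" d P B .
        have dV: "\<bar>d\<bar> \<le> V" using bounds(1)[of M] A M UV by (simp add: U_def)
        have 4: "runs l diagonal_program s3 rs3 (4 * b + 3)
          (\<lambda>s' rs'. rs' = rs3 \<and> (\<forall>j<b. matrix_at s' aTri b j = (\<lambda>x. s3 aDen 0 * unit_at j x)))"
          by (rule runs_diagonal[OF s3(1) e3(1)]) (simp add: matrix_at_def e3)
        show "runs l (Seq diagonal_program (Seq reduce_program output_program)) s3 rs3
          ((4 * b + 3) + (((16 * b + 23) * (?R * b + b + b * (l + 2)) + 5) + 5 + 1) + 1) ?Q"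
        proof (rule runs_Seq[OF 4 _ order.refl])
          fix s4 rs4
          assume s4: "memory_bounded l s4" "\<forall>y. y \<notin> arrays_written diagonal_program \<longrightarrow> s4 y = s3 y"
            "rs4 = rs3 \<and> (\<forall>j<b. matrix_at s4 aTri b j = (\<lambda>x. s3 aDen 0 * unit_at j x))"
          have e4: "s4 1 0 = int b" "s4 aTotal 0 = int ?R" "s4 aDen 0 = d" "s4 aRel = s2 aRel" "s4 aTab = s3 aTab"
            using s4(2) e3 by (auto simp: diagonal_program_def d_def)
          have A4: "matrix_at s4 aRel b = A" unfolding A_def using e4(4) by (rule matrix_at_cong)
          have AV: "\<bar>A r x\<bar> \<le> V" if "r < ?R" "x < b" for r x using A[OF that] UV(2) by (rule order_trans)
          have 5: "runs l reduce_program s4 rs4 ((16 * b + 23) * (?R * b + b + b * (l + 2)) + 5)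
            (\<lambda>s' rs'. rs' = rs4 \<and> inserted b d (matrix_at s4 aRel b) ?R (matrix_at s' aTri b))"
            by (rule runs_reduce[OF s4(1) e4(1-3) b _ _ V3 dV d(2)]) (use s4(3) AV in \<open>auto simp: A4 d_def\<close>)
          show "runs l (Seq reduce_program output_program) s4 rs4
            (((16 * b + 23) * (?R * b + b + b * (l + 2)) + 5) + 5 + 1) ?Q"
          proof (rule runs_Seq[OF 5 _ order.refl])
            fix s5 rs5
            assume s5: "memory_bounded l s5" "\<forall>y. y \<notin> arrays_written reduce_program \<longrightarrow> s5 y = s4 y"
              "rs5 = rs4 \<and> inserted b d (matrix_at s4 aRel b) ?R (matrix_at s5 aTri b)"
            have e5: "s5 aDen 0 = d" "s5 aTab = s3 aTab"
              using s5(2) e4 by (auto simp: reduce_program_def subtract_program_def swap_program_def advance_program_def)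
            have T0: "s5 aTab 0 = matrix_at s3 aTab b 0 0" "s5 aTri 0 = matrix_at s5 aTri b 0 0"
              using b by (auto simp: matrix_at_def e5)
            have T00: "s5 aTab 0 = 0 \<or> s5 aTab 0 = s5 aDen 0"
              using row_0[OF b b] T0 e5 by (auto split: if_splits)
            have dvd: "(\<lambda>y. m * unit_at 0 y) \<in> zvec.span (?F ` {..<?R}) \<longleftrightarrow> s5 aTri 0 * (s5 aTab 0 div s5 aDen 0) dvd m" for m
              using span_target_iff_dvd[OF b Az, of "matrix_at s5 aTri b" m] s5(3) unfolding A4 AF T0 e5(1) by simp
            show "runs l output_program s5 rs5 5 ?Q"
              by (rule runs_conseq[OF runs_output[OF s5(1) T00]])
                (use e5 d(2) dvd s2(3) s3(3) s4(3) s5(3) in auto)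
          qed
        qed
      qed
    qed
  qed
  then show ?thesis by (rule runs_conseq) (auto simp: period_steps_def)
qed

section \<open>Lattices of relations and orders\<close>

text \<open>The image set forgets repeated relations, the sum does not; coefficients of equal
  relations simply add up. Induction on the number of vectors avoids the distinction.\<close>

lemma span_family:
  "f \<in> zvec.span (F ` {..<R}) \<longleftrightarrow> (\<exists>z. f = (\<lambda>x. \<Sum>k<R. z k * F k x))" for R :: nat
proof (induction R arbitrary: f)
  case 0
  show ?case by (auto simp: zero_fun_def)
next
  case (Suc R)
  have "f \<in> zvec.span (F ` {..<Suc R}) \<longleftrightarrow> (\<exists>c. f - (\<lambda>x. c * F R x) \<in> zvec.span (F ` {..<R}))"
    by (simp add: lessThan_Suc zvec.span_insert)
  also have "\<dots> \<longleftrightarrow> (\<exists>c z. f - (\<lambda>x. c * F R x) = (\<lambda>x. \<Sum>k<R. z k * F k x))"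
    by (simp only: Suc.IH)
  also have "\<dots> \<longleftrightarrow> (\<exists>z. f = (\<lambda>x. \<Sum>k<Suc R. z k * F k x))"
  proof (safe, goal_cases)
    case (1 c z)
    have "f x = (\<Sum>k<Suc R. (z(R := c)) k * F k x)" for x
      using fun_cong[OF 1, of x] by (simp add: algebra_simps)
    then show ?case by blast
  next
    case (2 z)
    show ?case by (intro exI[of _ "z R"] exI[of _ z]) (simp add: fun_eq_iff)
  qed
  finally show ?case .
qed

definition coordinate_vector :: "nat \<Rightarrow> nat \<Rightarrow> int \<Rightarrow> int list" where
  "coordinate_vector b i m = (replicate b 0)[i := m]"

lemma coordinate_vector_nth:
  "j < b \<Longrightarrow> coordinate_vector b i m ! j = (if j = i then m else 0)"
  by (simp add: coordinate_vector_def nth_list_update)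

lemma length_coordinate_vector [simp]: "length (coordinate_vector b i m) = b"
  by (simp add: coordinate_vector_def)

lemma coordinate_subspace_eq:
  assumes "i < b"
  shows "coordinate_subspace b i = range (coordinate_vector b i)"
proof (intro equalityI subsetI)
  fix e assume "e \<in> coordinate_subspace b i"
  then have "e = coordinate_vector b i (e ! i)"
    by (intro nth_equalityI) (auto simp: coordinate_subspace_def coordinate_vector_nth)
  then show "e \<in> range (coordinate_vector b i)" by blast
qed (auto simp: coordinate_subspace_def coordinate_vector_nth)

text \<open>The rotation \<open>x \<mapsto> (x + i) mod b\<close> permutes the columns and takes 0
  to \<open>i\<close>, so the same coefficients work on both sides.\<close>

lemma coordinate_vector_generated:
  assumes "i < b"
  shows "coordinate_vector b i m \<in> generated_lattice b rs \<longleftrightarrow>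
    (\<lambda>y. m * unit_at 0 y) \<in> zvec.span ((\<lambda>r x. if x < b then rs ! r ! ((x + i) mod b) else 0) ` {..<length rs})"
proof -
  have "(\<forall>j<b. coordinate_vector b i m ! j = (\<Sum>k<length rs. z k * rs ! k ! j)) \<longleftrightarrow>
    (\<lambda>y. m * unit_at 0 y) = (\<lambda>x. \<Sum>k<length rs. z k * (if x < b then rs ! k ! ((x + i) mod b) else 0))" for z
  proof
    assume *: "\<forall>j<b. coordinate_vector b i m ! j = (\<Sum>k<length rs. z k * rs ! k ! j)"
    show "(\<lambda>y. m * unit_at 0 y) = (\<lambda>x. \<Sum>k<length rs. z k * (if x < b then rs ! k ! ((x + i) mod b) else 0))"
    proof
      fix x
      show "m * unit_at 0 x = (\<Sum>k<length rs. z k * (if x < b then rs ! k ! ((x + i) mod b) else 0))"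
      proof (cases "x < b")
        case True
        have "(x + i) mod b = i \<longleftrightarrow> x = 0"
        proof (cases "x + i < b")
          case False
          then have "(x + i) mod b = x + i - b" using True assms by (simp add: mod_if)
          then show ?thesis using True False assms by auto
        qed auto
        then show ?thesis using True assms *[rule_format, of "(x + i) mod b"] by (auto simp: coordinate_vector_nth)
      qed (use assms in auto)
    qed
  next
    assume *: "(\<lambda>y. m * unit_at 0 y) = (\<lambda>x. \<Sum>k<length rs. z k * (if x < b then rs ! k ! ((x + i) mod b) else 0))"
    show "\<forall>j<b. coordinate_vector b i m ! j = (\<Sum>k<length rs. z k * rs ! k ! j)"
    proof (intro allI impI)
      fix j assume j: "j < b"
      \<comment> \<open>The preimage of \<open>j\<close> under the rotation.\<close>
      define x where "x = (if i \<le> j then j - i else j + b - i)"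
      have x: "x < b" "(x + i) mod b = j" "x = 0 \<longleftrightarrow> j = i" using j assms by (auto simp: x_def)
      show "coordinate_vector b i m ! j = (\<Sum>k<length rs. z k * rs ! k ! j)"
        using fun_cong[OF *, of x] x j by (simp add: coordinate_vector_nth split: if_splits)
    qed
  qed
  then show ?thesis by (simp add: generated_lattice_def span_family)
qed

text \<open>For negative exponents, \<open>x ^ k\<close> and the \<open>k\<close>-th power of the
  inverse multiply to 1, so one is 1 iff the other is. This reduces to the usual property of the
  order.\<close>

lemma unit_power_cong_1_iff:
  assumes "coprime x n" "0 < n"
  shows "[unit_power n x m = 1] (mod int n) \<longleftrightarrow> int (ord n x) dvd m"
proof -
  have pos: "[int x ^ k = 1] (mod int n) \<longleftrightarrow> ord n x dvd k" for k
    using cong_int_iff[of "x ^ k" 1 n] ord_divides[of x k n] by simp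
  show ?thesis
  proof (cases "0 \<le> m")
    case True
    then have "int (ord n x) dvd m \<longleftrightarrow> ord n x dvd nat m" by (metis int_dvd_int_iff int_nat_eq)
    then show ?thesis using True pos by (simp add: unit_power_def)
  next
    case False
    define k where "k = nat (- m)"
    define y where "y = modular_inverse (int n) (int x)"
    have "[int x * y = 1] (mod int n)" unfolding y_def
      using assms(1) by (intro cong_modular_inverse1) simp
    then have "[(int x * y) ^ k = 1 ^ k] (mod int n)" by (rule cong_pow)
    then have xy: "[int x ^ k * y ^ k = 1] (mod int n)" by (simp add: power_mult_distrib)
    have "[y ^ k = 1] (mod int n) \<longleftrightarrow> [int x ^ k = 1] (mod int n)"
    proof
      assume "[y ^ k = 1] (mod int n)"
      then have "[int x ^ k * y ^ k = int x ^ k * 1] (mod int n)" by (rule cong_mult[OF cong_refl])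
      then show "[int x ^ k = 1] (mod int n)" using xy by (metis cong_sym cong_trans mult.right_neutral)
    next
      assume "[int x ^ k = 1] (mod int n)"
      then have "[int x ^ k * y ^ k = 1 * y ^ k] (mod int n)" by (rule cong_mult[OF _ cong_refl])
      then show "[y ^ k = 1] (mod int n)" using xy by (metis cong_sym cong_trans mult_1)
    qed
    moreover have "int (ord n x) dvd m \<longleftrightarrow> ord n x dvd k"
      using False unfolding k_def by (metis dvd_minus_iff int_dvd_int_iff int_nat_eq linorder_le_cases neg_0_le_iff_le)
    ultimately show ?thesis using False pos by (simp add: unit_power_def k_def y_def)
  qed
qed

lemma coordinate_vector_relation:
  assumes "factor_base n b a" "i < b" "0 < n"
  shows "coordinate_vector b i m \<in> relation_lattice n b a \<longleftrightarrow> int (ord n (a i)) dvd m"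
proof -
  have "(\<Prod>j<b. unit_power n (a j) (coordinate_vector b i m ! j)) = (\<Prod>j<b. if j = i then unit_power n (a i) m else 1)"
    by (intro prod.cong refl) (auto simp: coordinate_vector_nth unit_power_def)
  also have "\<dots> = unit_power n (a i) m" using assms(2) by simp
  finally show ?thesis
    using unit_power_cong_1_iff[of "a i" n m] assms by (simp add: relation_lattice_def factor_base_def)
qed

text \<open>Both restrictions correspond to subgroups of the integers, and a nonnegative generator
  is unique. The case \<open>d = 0\<close> means that the generated lattice meets the axis only in
  0.\<close>

lemma restricted_lattices_eq_iff:
  assumes "factor_base n b a" "i < b" "0 < n" "0 \<le> d"
    and d: "\<And>m. coordinate_vector b i m \<in> generated_lattice b rs \<longleftrightarrow> d dvd m"
  shows "generated_lattice b rs \<inter> coordinate_subspace b i = relation_lattice n b a \<inter> coordinate_subspace b i \<longleftrightarrow>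
    d = int (ord n (a i))"
proof -
  have "generated_lattice b rs \<inter> coordinate_subspace b i = relation_lattice n b a \<inter> coordinate_subspace b i \<longleftrightarrow>
    (\<forall>m. d dvd m \<longleftrightarrow> int (ord n (a i)) dvd m)"
    unfolding coordinate_subspace_eq[OF assms(2)]
    using d coordinate_vector_relation[OF assms(1-3)] by blast
  also have "\<dots> \<longleftrightarrow> d = int (ord n (a i))"
    using assms(4) by (metis dvd_refl of_nat_0_le_iff zdvd_antisym_nonneg)
  finally show ?thesis .
qed

text \<open>Each entry is at most the 1-norm, and a logarithm of at most \<open>k ln n\<close> means
  a norm of at most \<open>n ^ k\<close>. The zero vector is treated apart because the logarithm
  carries no information there.\<close>

lemma short_relations_entry_le:
  assumes "e \<in> short_relations K n b a" "v \<in> set e" "1 \<le> n" "K \<le> real k"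
  shows "\<bar>v\<bar> \<le> int n ^ k"
proof -
  define S where "S = (\<Sum>x\<leftarrow>e. \<bar>x\<bar>)"
  have S: "\<bar>v\<bar> \<le> S" unfolding S_def using assms(2) by (intro member_le_sum_list) auto
  show ?thesis
  proof (cases "S \<le> 0")
    case True
    have "(0::int) \<le> int n ^ k" by simp
    then show ?thesis using S True by linarith
  next
    case False
    have "ln (real_of_int S) \<le> K * ln (real n)"
      using assms(1) by (simp add: short_relations_def relation_size_def S_def)
    also have "\<dots> \<le> real k * ln (real n)" using assms by (intro mult_right_mono) auto
    also have "\<dots> = ln (real n ^ k)" using assms by (simp add: ln_realpow)
    finally have "real_of_int S \<le> real n ^ k" using False assms by (simp add: ln_le_cancel_iff)
    then have "S \<le> int n ^ k" by (metis of_int_le_iff of_int_of_nat_eq of_int_power)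
    then show ?thesis using S by linarith
  qed
qed

text \<open>Distinct residues below \<open>n\<close>. This makes \<open>log b\<close> at most
  \<open>log n\<close>.\<close>

lemma factor_base_le:
  assumes "factor_base n b a"
  shows "b \<le> n"
proof -
  have "a ` {..<b} \<subseteq> {..<n}" "inj_on a {..<b}" using assms by (auto simp: factor_base_def)
  then show ?thesis using card_inj_on_le[of a "{..<b}" "{..<n}"] by simp
qed

section \<open>The bound on the running time\<close>

definition word_length :: "nat \<Rightarrow> nat \<Rightarrow> nat" where
  "word_length n c = nat \<lceil>log 2 (real (n + c + 2))\<rceil>"

lemma word_length: "n + c + 2 \<le> 2 ^ word_length n c"
proof -
  have "real (n + c + 2) = 2 powr (log 2 (real (n + c + 2)))" by simp
  also have "\<dots> \<le> 2 powr real (word_length n c)" unfolding word_length_def by (intro powr_mono) linarith+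
  also have "\<dots> = real (2 ^ word_length n c)" by (simp add: powr_realpow)
  finally show ?thesis by (simp only: of_nat_le_iff)
qed

text \<open>\<open>n + c + 2 <= n (c + 3)\<close> separates \<open>c\<close> from \<open>n\<close>,
  \<open>2 ln 2 >= 1\<close> turns the binary logarithm into \<open>2 ln n\<close>, and the final 1
  pays for the ceiling.\<close>

lemma word_length_le:
  assumes "1 \<le> n"
  shows "real (word_length n c) \<le> 2 * ln (real n) + (log 2 (real (c + 3)) + 1)"
proof -
  have n: "1 \<le> real n" using assms by simp
  have "real c * 1 \<le> real c * real n" using n by (intro mult_left_mono) auto
  then have "real (n + c + 2) \<le> real n * real (c + 3)" using n by (simp add: algebra_simps)
  then have "log 2 (real (n + c + 2)) \<le> log 2 (real n * real (c + 3))" by (intro log_mono) auto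
  also have "\<dots> = log 2 (real n) + log 2 (real (c + 3))" using n by (simp add: log_mult)
  also have "log 2 (real n) \<le> 2 * ln (real n)"
  proof -
    have "ln (real n) * 1 \<le> ln (real n) * (2 * ln 2)"
      using ln2_ge_two_thirds n by (intro mult_left_mono) auto
    then show ?thesis by (simp add: log_def field_simps)
  qed
  finally have "log 2 (real (n + c + 2)) \<le> 2 * ln (real n) + log 2 (real (c + 3))" by simp
  moreover have "0 \<le> log 2 (real (n + c + 2))" by simp
  then have "real (word_length n c) \<le> log 2 (real (n + c + 2)) + 1" unfolding word_length_def by linarith
  ultimately show ?thesis by linarith
qed

text \<open>Bits per residue. With word length \<open>w\<close>, the factors \<open>3 + 2 b\<close>,
  \<open>b!\<close> and \<open>(n ^ k) ^ (b + 1)\<close> take \<open>w + 3\<close>,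
  \<open>w b\<close> and \<open>w k (b + 1)\<close> bits; for \<open>b >= 1\<close> their sum is at
  most \<open>b (2 w (k + 1) + 3)\<close>.\<close>

definition row_factor :: "nat \<Rightarrow> nat \<Rightarrow> nat \<Rightarrow> nat" where
  "row_factor n c k = 2 * word_length n c * (k + 1) + 3"

lemma memory_large_enough:
  fixes b c k n :: nat
  assumes "0 < b" "b \<le> n"
  defines "l \<equiv> b * row_factor n c k"
  shows "int (n + c + 2) \<le> 2 ^ l" "(3 + 2 * int b) * minor_bound b (int n ^ k) \<le> 2 ^ l" "0 < l"
proof -
  define w where "w = word_length n c"
  have w: "n + c + 2 \<le> 2 ^ w" unfolding w_def by (rule word_length)
  then have "n \<le> 2 ^ w" "b \<le> 2 ^ w" using assms(2) by linarith+
  then have wi: "int n \<le> 2 ^ w" "int b \<le> 2 ^ w" by simp_all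
  have rf: "row_factor n c k = 2 * w * (k + 1) + 3" by (simp add: row_factor_def w_def)
  show "0 < l" using assms(1) by (simp add: l_def rf)
  have "w \<le> 1 * row_factor n c k" unfolding rf by simp
  also have "\<dots> \<le> l" unfolding l_def using assms(1) by (intro mult_le_mono1) auto
  finally have "(2::int) ^ w \<le> 2 ^ l" by (intro power_increasing) auto
  moreover have "int (n + c + 2) \<le> 2 ^ w" using w by (metis of_nat_le_iff of_nat_numeral of_nat_power)
  ultimately show "int (n + c + 2) \<le> 2 ^ l" by linarith
  have f: "fact b \<le> (2::int) ^ (w * b)"
  proof -
    have "(fact b :: int) \<le> of_nat (b ^ b)" by (rule fact_le_power)
    also have "\<dots> = int b ^ b" by simp
    also have "\<dots> \<le> (2 ^ w) ^ b" using wi by (intro power_mono) auto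
    finally show ?thesis by (simp add: power_mult)
  qed
  have m: "(int n ^ k) ^ Suc b \<le> 2 ^ (w * k * Suc b)"
  proof -
    have "(int n ^ k) ^ Suc b \<le> ((2 ^ w) ^ k) ^ Suc b" using wi by (intro power_mono) auto
    then show ?thesis by (simp only: power_mult)
  qed
  have b: "3 + 2 * int b \<le> 2 ^ (w + 3)"
  proof -
    have "3 + 2 * int b \<le> 8 * int b" using assms(1) by simp
    also have "\<dots> \<le> 8 * 2 ^ w" using wi by simp
    finally show ?thesis by (simp add: power_add)
  qed
  have "minor_bound b (int n ^ k) \<le> 2 ^ (w * b) * 2 ^ (w * k * Suc b)"
    unfolding minor_bound_def by (intro mult_mono f m) auto
  then have "(3 + 2 * int b) * minor_bound b (int n ^ k) \<le> 2 ^ (w + 3) * (2 ^ (w * b) * 2 ^ (w * k * Suc b))"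
    by (intro mult_mono b) (auto simp: minor_bound_def)
  also have "\<dots> = 2 ^ (w + 3 + w * b + w * k * Suc b)" by (simp only: power_add mult.assoc)
  also have "\<dots> \<le> (2::int) ^ l"
  proof (rule power_increasing)
    have "w * 1 \<le> w * b" "w * k * 1 \<le> w * k * b" "3 * 1 \<le> 3 * b" using assms(1) by (intro mult_le_mono2; simp)+
    moreover have "l = 2 * (w * b) + 2 * (w * k * b) + 3 * b" unfolding l_def rf by (simp add: algebra_simps)
    moreover have "w * k * Suc b = w * k + w * k * b" by simp
    ultimately show "w + 3 + w * b + w * k * Suc b \<le> l" by linarith
  qed simp
  finally show "(3 + 2 * int b) * minor_bound b (int n ^ k) \<le> 2 ^ l" .
qed

text \<open>As \<open>b >= 1\<close>, lower powers of \<open>b\<close> are raised to the cube and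
  \<open>b + c <= b (c + 1)\<close>. The swaps stay cubic because \<open>l = b f\<close> gives about
  \<open>b^2 f\<close> of them, each over a row. The collected coefficient is
  \<open>276 + 115 c + 39 f\<close>.\<close>

lemma period_steps_le:
  assumes "0 < b"
  shows "period_steps b (b + c) (b * f) \<le> 300 * (c + 1) * (f + 1) * b ^ 3"
proof -
  define R where "R = b * (c + 1)"
  have R: "b + c \<le> R" unfolding R_def using assms by (cases b) auto
  have b: "b \<le> b * b" "1 \<le> b" "b * b \<le> b ^ 3" "b \<le> b ^ 3" "1 \<le> b ^ 3"
    using assms self_le_power[of b 3] by (auto simp: power3_eq_cube intro: self_le_power)
  have b3R: "b * b * R = (c + 1) * b ^ 3" by (simp add: R_def power3_eq_cube algebra_simps)
  have 1: "(6 * b + 8) * (b + c) \<le> 14 * ((c + 1) * b ^ 3)"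
  proof -
    have "6 * b + 8 \<le> 14 * (b * b)" using b by linarith
    then have "(6 * b + 8) * (b + c) \<le> (14 * (b * b)) * R" using R by (rule mult_le_mono)
    then show ?thesis using b3R by (simp add: mult.assoc)
  qed
  have 2: "(8 * b * b + 27 * b + 27) * (b + c) \<le> 62 * ((c + 1) * b ^ 3)"
  proof -
    have "8 * b * b + 27 * b + 27 \<le> 62 * (b * b)" using b unfolding mult.assoc by linarith
    then have "(8 * b * b + 27 * b + 27) * (b + c) \<le> (62 * (b * b)) * R" using R by (rule mult_le_mono)
    then show ?thesis using b3R by (simp add: mult.assoc)
  qed
  have 3: "(16 * b + 23) * ((b + c) * b + b + b * (b * f + 2)) \<le> 39 * ((c + f + 4) * b ^ 3)"
  proof -
    have "b * (b * f + 2) \<le> b * (b * f + 2 * b)" using assms by (intro mult_le_mono2) simp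
    moreover have "(b + c) * b \<le> R * b" using R by (rule mult_le_mono1)
    ultimately have "(b + c) * b + b + b * (b * f + 2) \<le> R * b + b * b + b * (b * f + 2 * b)" using b by linarith
    also have "\<dots> = (c + f + 4) * (b * b)" by (simp add: R_def algebra_simps)
    finally have "(16 * b + 23) * ((b + c) * b + b + b * (b * f + 2)) \<le> (39 * b) * ((c + f + 4) * (b * b))"
      using b(2) by (intro mult_le_mono) linarith
    then show ?thesis by (simp add: power3_eq_cube algebra_simps)
  qed
  have "(14 * (c + 1) + 62 * (c + 1) + 4 + 39 * (c + f + 4) + 40) * b ^ 3 =
      14 * ((c + 1) * b ^ 3) + 62 * ((c + 1) * b ^ 3) + 4 * b ^ 3 + 39 * ((c + f + 4) * b ^ 3) + 40 * b ^ 3"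
    by (simp add: algebra_simps)
  then have "period_steps b (b + c) (b * f) \<le> (14 * (c + 1) + 62 * (c + 1) + 4 + 39 * (c + f + 4) + 40) * b ^ 3"
    unfolding period_steps_def using 1 2 3 b(4,5) by linarith
  also have "\<dots> \<le> 300 * (c + 1) * (f + 1) * b ^ 3"
    by (intro mult_le_mono1) (simp add: algebra_simps)
  finally show ?thesis .
qed

text \<open>\<open>43200 = 100 * 36 * 12\<close>: the factor in \<open>step_cost\<close>, the bound
  \<open>36 b f\<close> for \<open>32 l + 4\<close>, and \<open>12 (f + 1)\<close> for the bit
  length of the latter. Using \<open>f < 2 ^ f\<close> is crude but keeps that length linear in
  \<open>f\<close>.\<close>

lemma step_cost_le:
  assumes "0 < b" "b \<le> n"
  shows "step_cost (b * row_factor n c k) \<le> 43200 * b * (row_factor n c k + 1) ^ 2"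
proof -
  define w f where "w = word_length n c" and "f = row_factor n c k"
  have wf: "w \<le> f" unfolding f_def row_factor_def w_def by simp
  have f: "1 \<le> f" by (simp add: f_def row_factor_def)
  have k: "32 * (b * f) + 4 \<le> 36 * b * f" using mult_le_mono[of 1 b 1 f] assms f by simp
  have "36 * b * f \<le> 2 ^ 6 * 2 ^ w * 2 ^ f"
    using word_length[of n c] assms less_exp[of f] by (intro mult_le_mono) (auto simp: w_def)
  also have "\<dots> = 2 ^ (6 + w + f)" by (simp add: power_add)
  finally have "32 * (b * f) + 4 \<le> 2 ^ (6 + w + f)" using k by linarith
  then have "\<bar>int (32 * (b * f) + 4)\<bar> \<le> 2 ^ (6 + w + f)"
    by (metis abs_of_nat of_nat_le_iff of_nat_numeral of_nat_power)
  then have "bits (int (32 * (b * f) + 4)) \<le> 6 + w + f + 2" by (rule bits_le)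
  also have "\<dots> \<le> 12 * (f + 1)" using wf by simp
  finally have bits: "bits (int (32 * (b * f) + 4)) \<le> 12 * (f + 1)" .
  have "step_cost (b * f) \<le> 100 * (36 * b * f) * (12 * (f + 1))"
    unfolding step_cost_def by (intro mult_le_mono bits k order.refl)
  also have "\<dots> \<le> 100 * (36 * b * (f + 1)) * (12 * (f + 1))" by (intro mult_le_mono) auto
  finally show ?thesis by (simp add: f_def power2_eq_square algebra_simps)
qed

text \<open>The constant is \<open>300 * 43200\<close>, doubled because
  \<open>1 <= 2 ln (max 2 b)\<close> introduces the logarithm. The number of steps contributes one
  factor \<open>f + 1\<close> and the cost of a step two, hence the cube of a polynomial that is
  linear in \<open>ln n\<close>.\<close>

lemma run_time_le:
  assumes "1 \<le> n" "0 < b" "b \<le> n"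
    and t: "t \<le> period_steps b (b + c) (b * row_factor n c k) * step_cost (b * row_factor n c k)"
  defines "C \<equiv> log 2 (real (c + 3)) + 1"
  shows "real t \<le> real b ^ 4 * ln (real (max 2 b)) *
    poly (Polynomial.smult (25920000 * real (c + 1)) ([: 4 + 2 * real (k + 1) * C, 4 * real (k + 1) :] ^ 3)) (ln (real n))"
proof -
  define f where "f = row_factor n c k"
  define p where "p = poly [: 4 + 2 * real (k + 1) * C, 4 * real (k + 1) :] (ln (real n))"
  have "t \<le> (300 * (c + 1) * (f + 1) * b ^ 3) * (43200 * b * (f + 1) ^ 2)"
    using t mult_le_mono[OF period_steps_le[OF assms(2), of c f] step_cost_le[OF assms(2,3), of c k]]
    unfolding f_def by (rule order_trans)
  also have "\<dots> = 12960000 * (c + 1) * b ^ 4 * (f + 1) ^ 3"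
    by (simp add: power_numeral_reduce algebra_simps)
  finally have "real t \<le> real (12960000 * (c + 1) * b ^ 4 * (f + 1) ^ 3)" by (simp only: of_nat_le_iff)
  also have "\<dots> = 12960000 * real (c + 1) * real b ^ 4 * real (f + 1) ^ 3" by simp
  also have "real (f + 1) ^ 3 \<le> p ^ 3"
  proof (rule power_mono)
    have "real (f + 1) = 2 * real (k + 1) * real (word_length n c) + 4"
      by (simp add: f_def row_factor_def algebra_simps)
    also have "\<dots> \<le> 2 * real (k + 1) * (2 * ln (real n) + C) + 4"
      unfolding C_def using word_length_le[OF assms(1), of c] by (intro add_mono mult_left_mono) auto
    finally show "real (f + 1) \<le> p" by (simp add: p_def algebra_simps)
  qed simp
  finally have 1: "real t \<le> 12960000 * real (c + 1) * real b ^ 4 * p ^ 3"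
    by (simp add: mult_left_mono)
  have C: "0 \<le> C" by (simp add: C_def)
  have p: "0 \<le> p" unfolding p_def using C assms(1) by (simp add: mult_nonneg_nonneg add_nonneg_nonneg)
  have ln2: "1 \<le> 2 * ln (real (max 2 b))"
  proof -
    have "2 / 3 \<le> ln (2::real)" by (rule ln2_ge_two_thirds)
    also have "\<dots> \<le> ln (real (max 2 b))" by (subst ln_le_cancel_iff) auto
    finally show ?thesis by simp
  qed
  have "12960000 * real (c + 1) * real b ^ 4 * p ^ 3 * 1 \<le>
      12960000 * real (c + 1) * real b ^ 4 * p ^ 3 * (2 * ln (real (max 2 b)))"
    using p ln2 by (intro mult_left_mono mult_nonneg_nonneg) auto
  also have "\<dots> = real b ^ 4 * ln (real (max 2 b)) * (25920000 * real (c + 1) * p ^ 3)"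
    by (simp add: algebra_simps)
  finally have "real t \<le> real b ^ 4 * ln (real (max 2 b)) * (25920000 * real (c + 1) * p ^ 3)"
    using 1 by simp
  then show ?thesis by (simp only: p_def poly_smult poly_power)
qed

section \<open>Correctness, success probability and the final assembly\<close>

lemma period_program_correct:
  assumes n: "1 \<le> n" and fb: "factor_base n b a" and i: "i < b" and K: "K \<le> real k"
    and rs: "set rs \<subseteq> short_relations K n b a" "length rs = b + c"
  shows "\<exists>t s. exec period_program (program_input n b c a i, rs) t (s, []) \<and>
    t \<le> period_steps b (b + c) (b * row_factor n c k) * step_cost (b * row_factor n c k) \<and>
    (program_output s = int (ord n (a i)) \<longleftrightarrow>
      generated_lattice b rs \<inter> coordinate_subspace b i = relation_lattice n b a \<inter> coordinate_subspace b i)"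
proof -
  define l where "l = b * row_factor n c k"
  have b: "0 < b" "b \<le> n" using fb factor_base_le by (auto simp: factor_base_def)
  note large = memory_large_enough[OF b, where c = c and k = k, folded l_def]
  have "memory_bounded l (program_input n b c a i)"
    unfolding memory_bounded_def
  proof (intro conjI allI)
    fix x j
    have "int (a (nat j)) \<le> 2 + (int n + int c)" if "0 \<le> j" "j < int b"
    proof -
      have "a (nat j) < n" using fb that by (simp add: factor_base_def nat_less_iff)
      then show ?thesis by simp
    qed
    then have "\<bar>program_input n b c a i x j\<bar> \<le> int (n + c + 2)"
      unfolding program_input_def using b i by auto
    then show "\<bar>program_input n b c a i x j\<bar> \<le> 2 ^ l" using large(1) by linarith
  qed (rule large)
  moreover have "length r = b" if "r \<in> set rs" for r
    using that rs by (auto simp: short_relations_def relation_lattice_def)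
  moreover have "\<bar>v\<bar> \<le> int n ^ k" if "r \<in> set rs" "v \<in> set r" for r v
    using that rs short_relations_entry_le[OF _ that(2) n K] by blast
  moreover have "1 \<le> int n ^ k" using n by (intro one_le_power) simp
  moreover have "int (b + c) \<le> 2 ^ l" using large(1) b by simp
  ultimately have "runs l period_program (program_input n b c a i) rs (period_steps b (b + c) l) (\<lambda>s' rs'. rs' = [] \<and> 0 \<le> s' 0 0 \<and>
    (\<forall>m. (\<lambda>y. m * unit_at 0 y) \<in> zvec.span ((\<lambda>r x. if x < b then rs ! r ! ((x + i) mod b) else 0) ` {..<b + c})
      \<longleftrightarrow> s' 0 0 dvd m))"
    using b large(2) rs(2) by (intro runs_period) auto
  then obtain t s where 1: "exec period_program (program_input n b c a i, rs) t (s, [])"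
    "t \<le> period_steps b (b + c) l * step_cost l" "0 \<le> s 0 0"
    and span: "\<And>m. (\<lambda>y. m * unit_at 0 y) \<in> zvec.span ((\<lambda>r x. if x < b then rs ! r ! ((x + i) mod b) else 0) ` {..<b + c})
      \<longleftrightarrow> s 0 0 dvd m"
    unfolding runs_def by blast
  have "generated_lattice b rs \<inter> coordinate_subspace b i = relation_lattice n b a \<inter> coordinate_subspace b i \<longleftrightarrow>
    s 0 0 = int (ord n (a i))"
    using n span rs(2) by (intro restricted_lattices_eq_iff[OF fb i _ 1(3)]) (auto simp: coordinate_vector_generated[OF i])
  then show ?thesis using 1 unfolding l_def program_output_def by blast
qed

text \<open>On the support of the distribution a run exists and, by determinism, its output is the
  only one. There success and agreement of the lattices are the same event; the remaining lists have
  probability 0.\<close>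

lemma success_probability_eq:
  assumes n: "1 \<le> n" and fb: "factor_base n b a" and i: "i < b"
    and D: "set_pmf D \<subseteq> short_relations K n b a"
  shows "success_probability period_program n b c a i D =
    measure_pmf.prob (replicate_pmf (b + c) D)
      {rs. generated_lattice b rs \<inter> coordinate_subspace b i = relation_lattice n b a \<inter> coordinate_subspace b i}"
proof -
  let ?S = "{rs. \<exists>t s. exec period_program (program_input n b c a i, rs) t (s, []) \<and> program_output s = int (ord n (a i))}"
  let ?L = "{rs. generated_lattice b rs \<inter> coordinate_subspace b i = relation_lattice n b a \<inter> coordinate_subspace b i}"
  let ?M = "replicate_pmf (b + c) D"
  have "rs \<in> ?S \<longleftrightarrow> rs \<in> ?L" if "rs \<in> set_pmf ?M" for rs
  proof -
    have rs: "set rs \<subseteq> short_relations K n b a" "length rs = b + c"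
      using that D by (auto simp: set_replicate_pmf)
    obtain t s where ts: "exec period_program (program_input n b c a i, rs) t (s, [])"
      "program_output s = int (ord n (a i)) \<longleftrightarrow> rs \<in> ?L"
      using period_program_correct[OF n fb i real_nat_ceiling_ge rs] by auto
    have "s' = s" if "exec period_program (program_input n b c a i, rs) t' (s', [])" for t' s'
      using exec_deterministic[OF that ts(1)] by simp
    then show ?thesis using ts by blast
  qed
  then have "?S \<inter> set_pmf ?M = ?L \<inter> set_pmf ?M" by blast
  then have "measure_pmf.prob ?M (?S \<inter> set_pmf ?M) = measure_pmf.prob ?M (?L \<inter> set_pmf ?M)"
    by (rule arg_cong)
  then show ?thesis unfolding success_probability_def measure_Int_set_pmf .
qed

theorem theorem1p1:
  "\<exists>p :: program. \<forall>(c :: nat) (K :: real). \<exists>q :: real poly.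
     \<forall>(b :: nat \<Rightarrow> nat) (a :: nat \<Rightarrow> nat \<Rightarrow> nat) (D :: nat \<Rightarrow> int list pmf).
       (\<forall>n\<ge>1. factor_base n (b n) (a n) \<and> set_pmf (D n) \<subseteq> short_relations K n (b n) (a n)) \<longrightarrow>
         (\<forall>n\<ge>1. \<forall>i<b n. \<forall>rs \<in> set_pmf (replicate_pmf (b n + c) (D n)).
            \<exists>t s. exec p (program_input n (b n) c (a n) i, rs) t (s, []) \<and>
              real t \<le> real (b n) ^ 4 * ln (real (max 2 (b n))) * poly q (ln (real n))) \<and>
         (\<lambda>n. real (b n + c)) \<in> O(\<lambda>n. real (b n)) \<and>
         (\<forall>i :: nat \<Rightarrow> nat. (\<forall>n\<ge>1. i n < b n) \<and> sublattice_generation_hypothesis b a c D i \<longrightarrow>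
            (\<lambda>n. success_probability p n (b n) c (a n) (i n) (D n))
              \<longlonglongrightarrow> enn2real (1 / zeta (c + 1)))"
proof (intro exI[of _ period_program] allI)
  fix c :: nat and K :: real
  define k where "k = nat \<lceil>K\<rceil>"
  \<comment> \<open>The polynomial depends on \<open>c\<close> and \<open>K\<close> alone and is
    fixed before \<open>b\<close>, \<open>a\<close> and \<open>D\<close>.\<close>
  define q where "q = Polynomial.smult (25920000 * real (c + 1))
    ([: 4 + 2 * real (k + 1) * (log 2 (real (c + 3)) + 1), 4 * real (k + 1) :] ^ 3)"
  show "\<exists>q :: real poly.
     \<forall>(b :: nat \<Rightarrow> nat) (a :: nat \<Rightarrow> nat \<Rightarrow> nat) (D :: nat \<Rightarrow> int list pmf).
       (\<forall>n\<ge>1. factor_base n (b n) (a n) \<and> set_pmf (D n) \<subseteq> short_relations K n (b n) (a n)) \<longrightarrow>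
         (\<forall>n\<ge>1. \<forall>i<b n. \<forall>rs \<in> set_pmf (replicate_pmf (b n + c) (D n)).
            \<exists>t s. exec period_program (program_input n (b n) c (a n) i, rs) t (s, []) \<and>
              real t \<le> real (b n) ^ 4 * ln (real (max 2 (b n))) * poly q (ln (real n))) \<and>
         (\<lambda>n. real (b n + c)) \<in> O(\<lambda>n. real (b n)) \<and>
         (\<forall>i :: nat \<Rightarrow> nat. (\<forall>n\<ge>1. i n < b n) \<and> sublattice_generation_hypothesis b a c D i \<longrightarrow>
            (\<lambda>n. success_probability period_program n (b n) c (a n) (i n) (D n))
              \<longlonglongrightarrow> enn2real (1 / zeta (c + 1)))"
  proof (intro exI[of _ q] allI impI conjI ballI)
    fix b :: "nat \<Rightarrow> nat" and a :: "nat \<Rightarrow> nat \<Rightarrow> nat" and D :: "nat \<Rightarrow> int list pmf"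
    assume *: "\<forall>n\<ge>1. factor_base n (b n) (a n) \<and> set_pmf (D n) \<subseteq> short_relations K n (b n) (a n)"
    have fb: "factor_base n (b n) (a n)" and D: "set_pmf (D n) \<subseteq> short_relations K n (b n) (a n)" if "1 \<le> n" for n
      using * that by auto
    have b: "0 < b n" "b n \<le> n" if "1 \<le> n" for n
      using fb[OF that] factor_base_le by (auto simp: factor_base_def)
    have K: "K \<le> real k" unfolding k_def by (rule real_nat_ceiling_ge)
    {
      fix n i rs assume n: "1 \<le> n" and i: "i < b n" and "rs \<in> set_pmf (replicate_pmf (b n + c) (D n))"
      then have rs: "set rs \<subseteq> short_relations K n (b n) (a n)" "length rs = b n + c"
        using D[OF n] by (auto simp: set_replicate_pmf)
      obtain t s where "exec period_program (program_input n (b n) c (a n) i, rs) t (s, [])"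
        "t \<le> period_steps (b n) (b n + c) (b n * row_factor n c k) * step_cost (b n * row_factor n c k)"
        using period_program_correct[OF n fb[OF n] i K rs] by blast
      then show "\<exists>t s. exec period_program (program_input n (b n) c (a n) i, rs) t (s, []) \<and>
          real t \<le> real (b n) ^ 4 * ln (real (max 2 (b n))) * poly q (ln (real n))"
        using run_time_le[OF n b[OF n]] unfolding q_def by blast
    next
      show "(\<lambda>n. real (b n + c)) \<in> O(\<lambda>n. real (b n))"
      \<comment> \<open>A factor base is nonempty, so \<open>b + c <= (c + 1) b\<close>.\<close>
      proof (rule bigoI[where c = "real (c + 1)"], rule eventually_at_top_linorderI[of 1])
        fix n :: nat assume "1 \<le> n"
        then have "real c * 1 \<le> real c * real (b n)" using b[of n] by (intro mult_left_mono) auto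
        then show "norm (real (b n + c)) \<le> real (c + 1) * norm (real (b n))" by (simp add: algebra_simps)
      qed
    next
      fix i :: "nat \<Rightarrow> nat"
      assume i: "(\<forall>n\<ge>1. i n < b n) \<and> sublattice_generation_hypothesis b a c D i"
      \<comment> \<open>The assumptions speak about \<open>n >= 1\<close>, so the two sequences
        agree from there on, which suffices for the limit.\<close>
      have "eventually (\<lambda>n. success_probability period_program n (b n) c (a n) (i n) (D n) =
          measure_pmf.prob (replicate_pmf (b n + c) (D n))
            {rs. generated_lattice (b n) rs \<inter> coordinate_subspace (b n) (i n) =
                 relation_lattice n (b n) (a n) \<inter> coordinate_subspace (b n) (i n)}) sequentially"
        using i fb D by (intro eventually_at_top_linorderI[of 1] success_probability_eq) auto
      then show "(\<lambda>n. success_probability period_program n (b n) c (a n) (i n) (D n)) \<longlonglongrightarrow> enn2real (1 / zeta (c + 1))"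
        using i unfolding sublattice_generation_hypothesis_def by (subst tendsto_cong) auto
    }
  qed
qed

end
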